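(* Let $\Lambda$ be a finite positive measure on $(0,\infty]$ with total mass $b=\Lambda((0,\infty])$ such that $m:=\int_{(0,\infty]}t\,\Lambda(\mathrm{d}t)$ satisfies $1<m<\infty$. Set $\Psi(\theta)=\theta-\int_{(0,\infty]}(1-e^{-\theta t})\Lambda(\mathrm{d}t)$, $\theta\ge0$, and let $\alpha>0$ be the unique positive number with $\Psi(\alpha)=0$. Let $c>0$ be fixed and $p_n\in(0,1)$ with $1-p_n\sim\frac{c}{\ln n}$ as $n\to\infty$. Perform Bernoulli bond percolation with parameter $p_n$ on the family tree $T_n^{\mathrm{hom}}$ of the homogeneous binary Crump-Mode-Jagers process associated with $\Lambda$, stopped when $n$ individuals have been born, and let $C_n$ be the number of vertices of the percolation cluster containing the root. Then, conditionally on the event $\{Z(\infty)=\infty\}$ that the process does not become extinct, $$\lim_{n\to\infty}n^{-1}C_n=e^{-\frac{c}{\Psi'(\alpha)}}\quad\text{in probability}.$$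
   Context: The homogeneous binary Crump-Mode-Jagers process associated with $\Lambda$: start with a single individual born at time $0$. Each individual has a random lifetime $\lambda$ with law $\Lambda(\cdot)/b$ and, given its lifetime, gives birth to single children at the points of a Poisson process of constant rate $b$ during its life. Hence the birth point process $\Xi$ (of the ages of the mother at births) has intensity measure $\mu(\mathrm{d}t)=\Lambda((t,\infty])\,\mathrm{d}t$. Different individuals behave independently with the same law. $Z(t)$ is the total number of individuals born up to time $t$, $T(t)$ is the family tree (edges between parents and children) of all individuals born up to time $t$, rooted at the ancestor. $\tau_n=\inf\{t\ge0:Z(t)\ge n\}$ and $T_n^{\mathrm{hom}}=T(\tau_n)$. Bernoulli bond percolation with parameter $p_n$: each edge is kept with probability $p_n$ and removed with probability $1-p_n$, independently of the other edges and of the branching process; clusters are the resulting connected components. $a_n\sim b_n$ means $a_n/b_n\to1$. *)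

theory Defs
  imports "HOL-Probability.Probability" "HOL-Library.Landau_Symbols" "HOL-Library.Extended_Nat"
begin

(* exp (- theta * t) for t in [0,\<infinity>], theta \<ge> 0, with the conventions exp (-\<infinity>) = 0 and 0 * \<infinity> = 0. *)
definition exp_neg :: "real \<Rightarrow> ennreal \<Rightarrow> real" where
  "exp_neg \<theta> t = (if t = \<infinity> then (if \<theta> = 0 then 1 else 0) else exp (- \<theta> * enn2real t))"

definition Psi :: "ennreal measure \<Rightarrow> real \<Rightarrow> real" where
  "Psi \<Lambda> \<theta> = \<theta> - (LINT t|\<Lambda>. (1 - exp_neg \<theta> t))"

(* Ulam-Harris labels, written from the individual back to the ancestor: the ancestor is [],
   and k # u is the (k+1)-st child of u. *)
type_synonym label = "nat list"

(* The data of one individual: its lifetime, and the waiting times between consecutive points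
   of the Poisson process (on the whole half-line) that governs its births. *)
type_synonym individual = "ennreal \<times> (nat \<Rightarrow> real)"

definition lifetime :: "individual \<Rightarrow> ennreal" where
  "lifetime i = fst i"

definition birth_age :: "individual \<Rightarrow> nat \<Rightarrow> real" where
  "birth_age i k = (\<Sum>j\<le>k. snd i j)"

(* The lifetime has law \<Lambda> / b, where b is the total mass of \<Lambda>. Independently of it, the
   waiting times are i.i.d. exponential of parameter b, so that the points birth_age i k form a
   Poisson process of rate b; only those falling within the lifetime become births. *)
definition individual_law :: "ennreal measure \<Rightarrow> individual measure" where
  "individual_law \<Lambda> =
     uniform_measure \<Lambda> (space \<Lambda>) \<Otimes>\<^sub>M
     (\<Pi>\<^sub>M k\<in>UNIV. density lborel (exponential_density (measure \<Lambda> (space \<Lambda>))))"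

definition process_law :: "ennreal measure \<Rightarrow> (label \<Rightarrow> individual) measure" where
  "process_law \<Lambda> = (\<Pi>\<^sub>M u\<in>UNIV. individual_law \<Lambda>)"

(* Which potential individuals are ever born, and when. *)
fun exists_ind :: "(label \<Rightarrow> individual) \<Rightarrow> label \<Rightarrow> bool" where
  "exists_ind x [] \<longleftrightarrow> True"
| "exists_ind x (k # u) \<longleftrightarrow> exists_ind x u \<and> ennreal (birth_age (x u) k) < lifetime (x u)"

fun birth_time :: "(label \<Rightarrow> individual) \<Rightarrow> label \<Rightarrow> real" where
  "birth_time x [] = 0"
| "birth_time x (k # u) = birth_time x u + birth_age (x u) k"

definition born :: "(label \<Rightarrow> individual) \<Rightarrow> ereal \<Rightarrow> label set" where
  "born x t = {u. exists_ind x u \<and> ereal (birth_time x u) \<le> t}"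

definition Z :: "(label \<Rightarrow> individual) \<Rightarrow> ereal \<Rightarrow> enat" where
  "Z x t = (if finite (born x t) then enat (card (born x t)) else \<infinity>)"

definition tau :: "(label \<Rightarrow> individual) \<Rightarrow> nat \<Rightarrow> ereal" where
  "tau x n = Inf {t. 0 \<le> t \<and> enat n \<le> Z x t}"

(* An edge (u, k) joins the individual u to its child k # u. *)
type_synonym edge = "label \<times> nat"

(* The family tree T(t) has vertex set born x t and the following edges. *)
definition tree_edges :: "(label \<Rightarrow> individual) \<Rightarrow> ereal \<Rightarrow> edge set" where
  "tree_edges x t = {(u, k). u \<in> born x t \<and> k # u \<in> born x t}"

(* Every potential edge is kept with probability p, independently of the others. *)
definition percolation_law :: "real \<Rightarrow> (edge \<Rightarrow> bool) measure" where
  "percolation_law p = (\<Pi>\<^sub>M e\<in>UNIV. measure_pmf (bernoulli_pmf p))"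

definition kept_adj :: "(label \<Rightarrow> individual) \<Rightarrow> (edge \<Rightarrow> bool) \<Rightarrow> ereal \<Rightarrow> (label \<times> label) set" where
  "kept_adj x \<kappa> t = {(u, k # u) | u k. (u, k) \<in> tree_edges x t \<and> \<kappa> (u, k)}"

(* The connected component of v in the percolated family tree T(t). *)
definition cluster :: "(label \<Rightarrow> individual) \<Rightarrow> (edge \<Rightarrow> bool) \<Rightarrow> ereal \<Rightarrow> label \<Rightarrow> label set" where
  "cluster x \<kappa> t v = {w \<in> born x t. (v, w) \<in> (kept_adj x \<kappa> t \<union> (kept_adj x \<kappa> t)\<inverse>)\<^sup>*}"

definition root_cluster_size :: "(label \<Rightarrow> individual) \<Rightarrow> (edge \<Rightarrow> bool) \<Rightarrow> nat \<Rightarrow> nat" where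
  "root_cluster_size x \<kappa> n = card (cluster x \<kappa> (tau x n) [])"

end

theory Submission
  imports Defs "HOL-Library.Sublist" "HOL-Real_Asymp.Real_Asymp"
begin

text \<open>Write \<open>\<mu>\<close> for the Laplace transform of the intensity of the births, so that
  \<open>\<mu>(\<theta>) = 1 - \<Psi>(\<theta>)/\<theta>\<close> and \<open>\<mu>(\<alpha>) = 1\<close>. A first-moment (Chernoff) bound with weights
  \<open>exp (- \<theta> \<sigma>\<^sub>u)\<close> (\<open>\<sigma>\<^sub>u\<close> the birth time of \<open>u\<close>) at \<open>\<theta> = \<alpha> \<plusminus> \<delta>\<close> shows that, among the individuals born up to a time slightly
  larger than \<open>ln n / \<alpha>\<close>, all but \<open>o(n)\<close> have height close to \<open>ln n / \<Psi>'(\<alpha>)\<close>; a bound for pairs,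
  with \<open>\<mu>(2\<alpha>) < 1\<close>, shows that all but \<open>o(n\<^sup>2)\<close> pairs have their last common ancestor at
  height \<open>o(ln n)\<close>. A second-moment argument gives a population of size \<open>n\<close> before that time with
  probability bounded below, and on survival this is boosted to probability 1 by restarting from
  a large generation. Given the tree, an individual at height \<open>h\<close> is in the root cluster with
  probability \<open>p\<^sub>n\<^sup>h\<close>, so that \<open>C\<^sub>n/n\<close> has mean about
  \<open>exp (- c / \<Psi>'(\<alpha>))\<close> and, by the bound for pairs, a variance tending to 0.\<close>

subsection \<open>Infinite products\<close>

text \<open>The exact asymptotics of \<open>tau x n\<close> is never established; a one-sided bound
  suffices. With L = ln n, on survival the population reaches n before the deterministic time (1 +
  \<eta>) L / \<alpha> with probability tending to 1, so the n individuals of the tree are a subset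
  of the population at that time. The expectation bounds for that population are of order n to the
  power 1 + \<eta>, so exceptional individuals must be rare enough to absorb the excess as well: a
  deviation of the height by \<epsilon> L gains a power of n depending on \<epsilon> only, and
  \<eta> is taken small compared with it. The constant comes from \<beta> = - \<mu>'(\<alpha>) =
  \<Psi>'(\<alpha>) / \<alpha>, the mean age of a mother at a birth under the tilted intensity:
  birth times in generation g concentrate near \<beta> g, so time L / \<alpha> corresponds to
  generation L / (\<alpha> \<beta>) = L / \<Psi>'(\<alpha>). The cluster is compared with y = exp (-
  c / \<Psi>'(\<alpha>)) through the second moment of C - y n given the tree. This treats bias and
  variance together and asks only for upper bounds on pair probabilities and lower bounds on single
  ones.\<close>

lemma nn_integral_PiM_resample:
  fixes M :: "'a measure" and f :: "('i \<Rightarrow> 'a) \<Rightarrow> ennreal"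
  assumes M: "prob_space M" and f[measurable]: "f \<in> borel_measurable (\<Pi>\<^sub>M i\<in>UNIV. M)"
  shows "(\<integral>\<^sup>+x. f x \<partial>(\<Pi>\<^sub>M i\<in>UNIV. M)) = (\<integral>\<^sup>+x. \<integral>\<^sup>+y. f (x(l := y)) \<partial>M \<partial>(\<Pi>\<^sub>M i\<in>UNIV. M))"
proof -
  let ?P = "\<Pi>\<^sub>M i\<in>(UNIV :: 'i set). M"
  interpret M: prob_space M by (rule M)
  interpret P: prob_space ?P by (intro prob_space_PiM M)
  interpret MP: pair_sigma_finite M ?P ..
  have [measurable]: "(\<lambda>(y, x). x(l := y)) \<in> M \<Otimes>\<^sub>M ?P \<rightarrow>\<^sub>M ?P"
    unfolding split_beta' by (rule measurable_PiM_single') (auto simp: space_pair_measure space_PiM fun_upd_def PiE_iff)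
  have "?P = distr (M \<Otimes>\<^sub>M ?P) ?P (\<lambda>(y, x). x(l := y))"
    using distr_pair_PiM_eq_PiM[of "UNIV :: 'i set" "\<lambda>_. M" l] M by simp
  then have "(\<integral>\<^sup>+x. f x \<partial>?P) = (\<integral>\<^sup>+x. f x \<partial>distr (M \<Otimes>\<^sub>M ?P) ?P (\<lambda>(y, x). x(l := y)))"
    by (rule arg_cong)
  also have "\<dots> = (\<integral>\<^sup>+z. f (case z of (y, x) \<Rightarrow> x(l := y)) \<partial>(M \<Otimes>\<^sub>M ?P))"
    by (rule nn_integral_distr) measurable
  also have "\<dots> = (\<integral>\<^sup>+x. \<integral>\<^sup>+y. f (x(l := y)) \<partial>M \<partial>?P)"
    by (subst MP.nn_integral_snd[symmetric]) auto
  finally show ?thesis .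
qed

text \<open>The independence step behind the moment computations: whether and when an individual is
  born is decided by its proper ancestors, so its own data sit in a coordinate \<open>l\<close> on
  which \<open>f\<close> does not depend.\<close>

lemma nn_integral_PiM_mult_coordinate:
  fixes M :: "'a measure" and f :: "('i \<Rightarrow> 'a) \<Rightarrow> ennreal"
  assumes M: "prob_space M"
    and f[measurable]: "f \<in> borel_measurable (\<Pi>\<^sub>M i\<in>UNIV. M)"
    and g[measurable]: "g \<in> borel_measurable M"
    and indep: "\<And>x y. f (x(l := y)) = f x"
  shows "(\<integral>\<^sup>+x. f x * g (x l) \<partial>(\<Pi>\<^sub>M i\<in>UNIV. M)) = (\<integral>\<^sup>+x. f x \<partial>(\<Pi>\<^sub>M i\<in>UNIV. M)) * (\<integral>\<^sup>+y. g y \<partial>M)"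
proof -
  have "(\<integral>\<^sup>+x. f x * g (x l) \<partial>(\<Pi>\<^sub>M i\<in>UNIV. M))
    = (\<integral>\<^sup>+x. \<integral>\<^sup>+y. f (x(l := y)) * g y \<partial>M \<partial>(\<Pi>\<^sub>M i\<in>UNIV. M))"
    by (subst nn_integral_PiM_resample[OF M, where l = l]) auto
  also have "\<dots> = (\<integral>\<^sup>+x. f x * (\<integral>\<^sup>+y. g y \<partial>M) \<partial>(\<Pi>\<^sub>M i\<in>UNIV. M))"
    by (simp add: indep nn_integral_cmult)
  also have "\<dots> = (\<integral>\<^sup>+x. f x \<partial>(\<Pi>\<^sub>M i\<in>UNIV. M)) * (\<integral>\<^sup>+y. g y \<partial>M)"
    by (simp add: nn_integral_multc)
  finally show ?thesis .
qed

text \<open>With \<open>h\<close> appending a fixed label, this replaces the data of all descendants of an individual by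
  an independent copy of the whole process.\<close>

definition graft :: "('i \<Rightarrow> 'i) \<Rightarrow> ('i \<Rightarrow> 'a) \<Rightarrow> ('i \<Rightarrow> 'a) \<Rightarrow> 'i \<Rightarrow> 'a" where
  "graft h y x = (\<lambda>l. if l \<in> range h then y (inv h l) else x l)"

lemma measurable_graft[measurable]:
  "(\<lambda>(y, x). graft h y x) \<in> (\<Pi>\<^sub>M i\<in>UNIV. M) \<Otimes>\<^sub>M (\<Pi>\<^sub>M i\<in>UNIV. M) \<rightarrow>\<^sub>M (\<Pi>\<^sub>M i\<in>UNIV. M)"
  unfolding graft_def split_beta' 
proof (rule measurable_PiM_single')
  fix i
  show "(\<lambda>x. if i \<in> range h then fst x (inv h i) else snd x i) \<in> (\<Pi>\<^sub>M i\<in>UNIV. M) \<Otimes>\<^sub>M (\<Pi>\<^sub>M i\<in>UNIV. M) \<rightarrow>\<^sub>M M"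
    by measurable
qed (auto simp: space_pair_measure space_PiM PiE_iff)

text \<open>It is enough to compare cylinders. The preimage of a cylinder is a rectangle, since
  \<open>graft\<close> reads the coordinates in \<open>range h\<close> from \<open>y\<close> and all
  others from \<open>x\<close>; injectivity of \<open>h\<close> allows the first group to be
  reindexed.\<close>

lemma distr_graft:
  fixes h :: "'i \<Rightarrow> 'i"
  assumes M: "prob_space M" and h: "inj h"
  shows "distr ((\<Pi>\<^sub>M i\<in>UNIV. M) \<Otimes>\<^sub>M (\<Pi>\<^sub>M i\<in>UNIV. M)) (\<Pi>\<^sub>M i\<in>UNIV. M) (\<lambda>(y, x). graft h y x)
    = (\<Pi>\<^sub>M i\<in>UNIV. M)" (is "distr (?P \<Otimes>\<^sub>M ?P) _ _ = _")
proof (rule measure_eqI_PiM_infinite[symmetric, OF refl])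
  interpret M: prob_space M by (rule M)
  interpret P: prob_space ?P by (intro prob_space_PiM M)
  show "finite_measure ?P" by unfold_locales
  fix J :: "'i set" and A assume J: "finite J" and A: "\<And>i. i \<in> J \<Longrightarrow> A i \<in> sets M"
  let ?J1 = "h -` J" and ?J2 = "J - range h"
  let ?E1 = "prod_emb UNIV (\<lambda>_. M) ?J1 (\<Pi>\<^sub>E i\<in>?J1. A (h i))"
  let ?E2 = "prod_emb UNIV (\<lambda>_. M) ?J2 (Pi\<^sub>E ?J2 A)"
  let ?E = "prod_emb UNIV (\<lambda>_. M) J (Pi\<^sub>E J A)"
  have J1: "finite ?J1" using J h by (intro finite_vimageI)
  have E: "?E \<in> sets ?P" using J A by (intro sets_PiM_I) auto
  have E1: "?E1 \<in> sets ?P" using J1 A by (intro sets_PiM_I) auto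
  have E2: "?E2 \<in> sets ?P" using J A by (intro sets_PiM_I) auto
  have Asub: "A i \<subseteq> space M" if "i \<in> J" for i using A[OF that] sets.sets_into_space by auto
  have pre: "(\<lambda>(y, x). graft h y x) -` ?E \<inter> space (?P \<Otimes>\<^sub>M ?P) = ?E1 \<times> ?E2"
  proof (intro set_eqI iffI)
    fix z assume "z \<in> (\<lambda>(y, x). graft h y x) -` ?E \<inter> space (?P \<Otimes>\<^sub>M ?P)"
    then obtain y x where z: "z = (y, x)" and yx: "\<And>i. y i \<in> space M" "\<And>i. x i \<in> space M"
      and *: "\<And>i. i \<in> J \<Longrightarrow> graft h y x i \<in> A i"
      by (auto simp: prod_emb_def space_PiM PiE_iff space_pair_measure)
    have "y i \<in> A (h i)" if "h i \<in> J" for i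
      using *[OF that] h by (simp add: graft_def)
    moreover have "x i \<in> A i" if "i \<in> J" "i \<notin> range h" for i
      using *[OF that(1)] that(2) unfolding graft_def by (metis (mono_tags, lifting))
    ultimately show "z \<in> ?E1 \<times> ?E2"
      using z yx by (auto simp: prod_emb_def space_PiM PiE_iff)
  next
    fix z assume "z \<in> ?E1 \<times> ?E2"
    then obtain y x where z: "z = (y, x)" and yx: "\<And>i. y i \<in> space M" "\<And>i. x i \<in> space M"
      and *: "\<And>i. h i \<in> J \<Longrightarrow> y i \<in> A (h i)" "\<And>i. i \<in> J \<Longrightarrow> i \<notin> range h \<Longrightarrow> x i \<in> A i"
      by (auto simp: prod_emb_def space_PiM PiE_iff)
    have "graft h y x i \<in> A i" if "i \<in> J" for i
      using * that h by (auto simp: graft_def)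
    moreover have "graft h y x i \<in> space M" for i
      using yx by (auto simp: graft_def)
    ultimately show "z \<in> (\<lambda>(y, x). graft h y x) -` ?E \<inter> space (?P \<Otimes>\<^sub>M ?P)"
      using z yx by (auto simp: prod_emb_def space_PiM PiE_iff space_pair_measure)
  qed
  have "?P ?E = (\<Prod>i\<in>J. M (A i))"
    using J A M by (intro emeasure_PiM_emb) auto
  also have "\<dots> = (\<Prod>i\<in>J \<inter> range h. M (A i)) * (\<Prod>i\<in>?J2. M (A i))"
    using J by (rule prod.Int_Diff)
  also have "J \<inter> range h = h ` ?J1" by auto
  also have "(\<Prod>i\<in>h ` ?J1. M (A i)) = (\<Prod>i\<in>?J1. M (A (h i)))"
    using h by (subst prod.reindex) (auto intro: inj_on_subset)
  also have "\<dots> = ?P ?E1"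
    using J1 A M by (intro emeasure_PiM_emb[symmetric]) auto
  also have "(\<Prod>i\<in>?J2. M (A i)) = ?P ?E2"
    using J A M by (intro emeasure_PiM_emb[symmetric]) auto
  also have "?P ?E1 * ?P ?E2 = (?P \<Otimes>\<^sub>M ?P) (?E1 \<times> ?E2)"
    using E1 E2 by (intro P.emeasure_pair_measure_Times[symmetric])
  finally show "?P ?E = distr (?P \<Otimes>\<^sub>M ?P) ?P (\<lambda>(y, x). graft h y x) ?E"
    using E by (simp add: emeasure_distr pre)
qed auto

text \<open>An abstract branching property. If the configuration is drawn as
  \<open>graft h y x\<close> with independent \<open>x\<close> and \<open>y\<close>, then its
  restriction along \<open>h\<close> is \<open>y\<close> itself, while membership in
  \<open>A\<close> is decided by \<open>x\<close>; the event becomes the rectangle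
  \<open>D \<times> A\<close>.\<close>

lemma prob_PiM_graft:
  fixes h :: "'i \<Rightarrow> 'i"
  assumes M: "prob_space M" and h: "inj h"
    and A[measurable]: "A \<in> sets (\<Pi>\<^sub>M i\<in>UNIV. M)" and D[measurable]: "D \<in> sets (\<Pi>\<^sub>M i\<in>UNIV. M)"
    and indep: "\<And>x y. x \<in> space (\<Pi>\<^sub>M i\<in>UNIV. M) \<Longrightarrow> y \<in> space (\<Pi>\<^sub>M i\<in>UNIV. M) \<Longrightarrow>
      graft h y x \<in> A \<longleftrightarrow> x \<in> A"
  shows "measure (\<Pi>\<^sub>M i\<in>UNIV. M) {x \<in> A. (\<lambda>i. x (h i)) \<in> D}
    = measure (\<Pi>\<^sub>M i\<in>UNIV. M) A * measure (\<Pi>\<^sub>M i\<in>UNIV. M) D" (is "measure ?P _ = _")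
proof -
  interpret P: prob_space ?P by (intro prob_space_PiM M)
  have [measurable]: "(\<lambda>x i. x (h i)) \<in> ?P \<rightarrow>\<^sub>M ?P"
    by (rule measurable_PiM_single') (auto simp: space_PiM)
  have [measurable]: "{x \<in> A. (\<lambda>i. x (h i)) \<in> D} \<in> sets ?P" 
  proof -
    have "{x \<in> A. (\<lambda>i. x (h i)) \<in> D} = {x \<in> space ?P. x \<in> A \<and> (\<lambda>i. x (h i)) \<in> D}"
      using sets.sets_into_space[OF A] by auto
    then show ?thesis by simp
  qed
  have "measure ?P {x \<in> A. (\<lambda>i. x (h i)) \<in> D}
      = measure (distr (?P \<Otimes>\<^sub>M ?P) ?P (\<lambda>(y, x). graft h y x)) {x \<in> A. (\<lambda>i. x (h i)) \<in> D}"
    by (simp add: distr_graft[OF M h])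
  also have "\<dots> = measure (?P \<Otimes>\<^sub>M ?P)
      ((\<lambda>(y, x). graft h y x) -` {x \<in> A. (\<lambda>i. x (h i)) \<in> D} \<inter> space (?P \<Otimes>\<^sub>M ?P))"
    by (subst measure_distr) auto
  also have "(\<lambda>(y, x). graft h y x) -` {x \<in> A. (\<lambda>i. x (h i)) \<in> D} \<inter> space (?P \<Otimes>\<^sub>M ?P) = D \<times> A"
  proof -
    have "(\<lambda>i. graft h y x (h i)) = y" for x y :: "'i \<Rightarrow> 'a"
      using h by (auto simp: graft_def)
    then show ?thesis
      using sets.sets_into_space[OF A] sets.sets_into_space[OF D]
      by (auto simp: indep subset_eq space_pair_measure)
  qed
  also have "measure (?P \<Otimes>\<^sub>M ?P) (D \<times> A) = measure ?P D * measure ?P A"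
    by (simp add: measure_def P.emeasure_pair_measure_Times enn2real_mult)
  finally show ?thesis by simp
qed

subsection \<open>The exponent \<open>\<Psi>\<close>\<close>

text \<open>Supplies the majorant \<open>enn2real\<close>, integrable because the mean is finite,
  when \<open>Psi\<close> is differentiated under the integral.\<close>

lemma exp_diff_le:
  fixes x y t :: real
  assumes "x \<ge> 0" "y \<ge> 0" "t \<ge> 0"
  shows "\<bar>exp (- x * t) - exp (- y * t)\<bar> \<le> \<bar>x - y\<bar> * t"
proof -
  have *: "\<bar>exp (- x * t) - exp (- y * t)\<bar> \<le> \<bar>x - y\<bar> * t" if "0 \<le> x" "x \<le> y" for x y
  proof -
    have "exp (- y * t) = exp (- x * t) * exp (- ((y - x) * t))"
      by (simp add: algebra_simps flip: exp_add)
    then have "exp (- x * t) - exp (- y * t) = exp (- x * t) * (1 - exp (- ((y - x) * t)))"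
      by (simp add: algebra_simps)
    also have "\<dots> \<le> 1 * ((y - x) * t)"
      using that assms exp_ge_add_one_self[of "- ((y - x) * t)"]
      by (intro mult_mono) auto
    finally show ?thesis using that assms by (simp add: mult_right_mono)
  qed
  show ?thesis
    using *[of x y] *[of y x] assms by (cases "x \<le> y") (auto simp: abs_minus_commute)
qed

text \<open>This is 1 + s < exp s, multiplied by exp (- s); it is the integrand behind
  \<open>dPsi_pos\<close>.\<close>

lemma one_minus_exp_pos:
  fixes s :: real
  assumes "s > 0"
  shows "1 - exp (- s) - s * exp (- s) > 0"
proof -
  have "(1 + s) * exp (- s) < exp s * exp (- s)"
    using assms exp_gt_one[of s] by (intro mult_strict_right_mono) (auto intro!: exp_ge_add_one_self less_le_trans[OF _ exp_lower_Taylor_quadratic] simp: power2_eq_square)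
  also have "\<dots> = 1" by (simp flip: exp_add)
  finally show ?thesis by (simp add: algebra_simps)
qed

locale cmj =
  fixes \<Lambda> :: "ennreal measure" and \<alpha> :: real
  assumes sets_Lambda: "sets \<Lambda> = sets (restrict_space borel {0<..})"
    and finite_Lambda: "finite_measure \<Lambda>"
    and mean_finite: "(\<integral>\<^sup>+ t. t \<partial>\<Lambda>) < \<infinity>"
    and alpha_pos: "\<alpha> > 0"
    and Psi_alpha: "Psi \<Lambda> \<alpha> = 0"

sublocale cmj \<subseteq> L: finite_measure \<Lambda>
  by (rule finite_Lambda)

context cmj
begin

abbreviation b :: real where "b \<equiv> measure \<Lambda> (space \<Lambda>)"

lemma space_Lambda: "space \<Lambda> = {0<..}"
  using sets_eq_imp_space_eq[OF sets_Lambda] by (simp add: space_restrict_space)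

lemma measurable_Lambda:
  "f \<in> borel_measurable borel \<Longrightarrow> f \<in> borel_measurable \<Lambda>"
  using measurable_restrict_space1[of f borel borel "{0<..}"] measurable_cong_sets[OF sets_Lambda refl] by blast

lemma borel_measurable_id_Lambda[measurable]: "(\<lambda>t. t) \<in> borel_measurable \<Lambda>"
  by (rule measurable_Lambda) simp

lemma borel_measurable_exp_neg[measurable]: "exp_neg \<theta> \<in> borel_measurable borel"
  unfolding exp_neg_def by measurable

text \<open>The finite mean excludes an atom at infinity, so the convention for
  \<open>exp_neg\<close> there matters only on a null set.\<close>

lemma AE_finite: "AE t in \<Lambda>. t \<noteq> \<infinity>"
  using mean_finite by (intro nn_integral_PInf_AE) auto

lemma AE_pos: "AE t in \<Lambda>. 0 < enn2real t \<and> t = ennreal (enn2real t)"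
  using AE_finite AE_space
proof eventually_elim
  case (elim t)
  then show ?case by (auto simp: space_Lambda enn2real_positive_iff less_top ennreal_enn2real)
qed

lemma integrable_mean: "integrable \<Lambda> enn2real"
proof (rule integrableI_nonneg)
  have "(\<integral>\<^sup>+ t. ennreal (enn2real t) \<partial>\<Lambda>) = (\<integral>\<^sup>+ t. t \<partial>\<Lambda>)"
    using AE_pos by (intro nn_integral_cong_AE) (auto elim: eventually_mono)
  then show "(\<integral>\<^sup>+ t. ennreal (enn2real t) \<partial>\<Lambda>) < \<infinity>"
    using mean_finite by simp
qed (auto intro!: measurable_Lambda)

lemma exp_neg_bounds: "\<theta> \<ge> 0 \<Longrightarrow> 0 \<le> exp_neg \<theta> t \<and> exp_neg \<theta> t \<le> 1"
  by (auto simp: exp_neg_def)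

lemma integrable_exp_neg: "\<theta> \<ge> 0 \<Longrightarrow> integrable \<Lambda> (exp_neg \<theta>)"
  using exp_neg_bounds by (intro L.integrable_const_bound[where B = 1]) (auto intro!: measurable_Lambda)

lemma integrable_mean_exp_neg: "\<theta> \<ge> 0 \<Longrightarrow> integrable \<Lambda> (\<lambda>t. enn2real t * exp_neg \<theta> t)"
  using exp_neg_bounds[of \<theta>]
  by (intro Bochner_Integration.integrable_bound[OF integrable_mean])
     (auto intro!: measurable_Lambda AE_I2 mult_left_le simp: abs_mult)

lemma Psi_eq: "\<theta> \<ge> 0 \<Longrightarrow> Psi \<Lambda> \<theta> = \<theta> - b + (LINT t|\<Lambda>. exp_neg \<theta> t)"
  unfolding Psi_def using integrable_exp_neg[of \<theta>]
  by (subst Bochner_Integration.integral_diff) auto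

definition dPsi :: real where
  "dPsi = 1 - (LINT t|\<Lambda>. enn2real t * exp_neg \<alpha> t)"

lemma Psi_has_derivative: "(Psi \<Lambda> has_real_derivative dPsi) (at \<alpha>)"
  unfolding has_field_derivative_iff tendsto_at_iff_sequentially
proof (intro allI impI)
  fix X :: "nat \<Rightarrow> real" assume X: "\<forall>i. X i \<in> UNIV - {\<alpha>}" "X \<longlonglongrightarrow> \<alpha>"
  have ev: "eventually (\<lambda>i. X i > 0) sequentially"
    using X(2) alpha_pos by (rule order_tendstoD)
  \<comment> \<open>\<open>Psi_eq\<close> and \<open>exp_diff_le\<close> need nonnegative exponents,
    which a sequence tending to \<alpha> > 0 has from some index on; \<open>Y\<close> is that
    tail.\<close>
  then obtain N where N: "\<And>i. i \<ge> N \<Longrightarrow> X i > 0" by (auto simp: eventually_sequentially)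
  define Y where "Y i = X (i + N)" for i
  have Y: "Y i > 0" "Y i \<noteq> \<alpha>" "Y \<longlonglongrightarrow> \<alpha>" for i
    using X N LIMSEQ_ignore_initial_segment[OF X(2), of N] by (auto simp: Y_def[abs_def])
  have "(\<lambda>i. LINT t|\<Lambda>. (exp_neg (Y i) t - exp_neg \<alpha> t) / (Y i - \<alpha>))
      \<longlonglongrightarrow> (LINT t|\<Lambda>. - (enn2real t * exp_neg \<alpha> t))"
  proof (rule integral_dominated_convergence[where w = enn2real])
    show "AE t in \<Lambda>. (\<lambda>i. (exp_neg (Y i) t - exp_neg \<alpha> t) / (Y i - \<alpha>)) \<longlonglongrightarrow> - (enn2real t * exp_neg \<alpha> t)"
      using AE_pos
    proof eventually_elim
      case (elim t)
      have "((\<lambda>\<theta>. exp (- \<theta> * enn2real t)) has_real_derivative - (enn2real t * exp (- \<alpha> * enn2real t))) (at \<alpha>)"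
        by (auto intro!: derivative_eq_intros)
      then have "(\<lambda>i. (exp (- Y i * enn2real t) - exp (- \<alpha> * enn2real t)) / (Y i - \<alpha>))
          \<longlonglongrightarrow> - (enn2real t * exp (- \<alpha> * enn2real t))"
        using Y unfolding has_field_derivative_iff tendsto_at_iff_sequentially comp_def by auto
      moreover have "t \<noteq> \<infinity>" using elim by (metis ennreal_neq_top infinity_ennreal_def)
      ultimately show ?case by (simp add: exp_neg_def)
    qed
    show "AE t in \<Lambda>. norm ((exp_neg (Y i) t - exp_neg \<alpha> t) / (Y i - \<alpha>)) \<le> enn2real t" for i
      using AE_pos
    proof eventually_elim
      case (elim t)
      moreover have "t \<noteq> \<infinity>" using elim by (metis ennreal_neq_top infinity_ennreal_def)
      moreover have "\<bar>exp (- Y i * enn2real t) - exp (- \<alpha> * enn2real t)\<bar> \<le> \<bar>Y i - \<alpha>\<bar> * enn2real t"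
        using Y(1)[of i] alpha_pos by (intro exp_diff_le) auto
      ultimately show ?case using Y(2)[of i]
        by (simp add: exp_neg_def divide_simps mult.commute)
    qed
  qed (auto intro!: measurable_Lambda integrable_mean)
  \<comment> \<open>The - 1 is the contribution of the linear term of \<open>Psi\<close>.\<close>
  moreover have "(LINT t|\<Lambda>. (exp_neg (Y i) t - exp_neg \<alpha> t) / (Y i - \<alpha>))
      = (Psi \<Lambda> (Y i) - Psi \<Lambda> \<alpha>) / (Y i - \<alpha>) - 1" for i
    using Y(1,2)[of i] alpha_pos integrable_exp_neg
    by (simp add: Psi_eq field_simps)
  ultimately have "(\<lambda>i. (Psi \<Lambda> (Y i) - Psi \<Lambda> \<alpha>) / (Y i - \<alpha>) - 1) \<longlonglongrightarrow> - (1 - dPsi)"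
    by (simp add: dPsi_def)
  from tendsto_add[OF this tendsto_const[of 1]]
  have "(\<lambda>i. (Psi \<Lambda> (Y i) - Psi \<Lambda> \<alpha>) / (Y i - \<alpha>)) \<longlonglongrightarrow> dPsi" by simp
  then have "(\<lambda>i. ((\<lambda>y. (Psi \<Lambda> y - Psi \<Lambda> \<alpha>) / (y - \<alpha>)) \<circ> X) (i + N)) \<longlonglongrightarrow> dPsi"
    by (simp add: Y_def)
  then show "((\<lambda>y. (Psi \<Lambda> y - Psi \<Lambda> \<alpha>) / (y - \<alpha>)) \<circ> X) \<longlonglongrightarrow> dPsi"
    by (rule LIMSEQ_offset)
qed

lemma deriv_Psi: "deriv (Psi \<Lambda>) \<alpha> = dPsi"
  using Psi_has_derivative by (rule DERIV_imp_deriv)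

lemma integral_exp_neg_alpha: "(LINT t|\<Lambda>. exp_neg \<alpha> t) = b - \<alpha>"
  using Psi_eq[of \<alpha>] Psi_alpha alpha_pos by simp

text \<open>\<open>Psi_alpha\<close> writes \<alpha> as \<open>b\<close> minus a nonnegative
  integral, so \<open>b\<close> = 0 would contradict \<alpha> > 0.\<close>

lemma b_pos: "b > 0"
proof (rule ccontr)
  assume "\<not> b > 0"
  then have "b = 0" using measure_nonneg[of \<Lambda> "space \<Lambda>"] by linarith
  moreover have "(LINT t|\<Lambda>. exp_neg \<alpha> t) \<ge> 0"
    using exp_neg_bounds alpha_pos by (intro integral_nonneg_AE) auto
  ultimately show False using integral_exp_neg_alpha alpha_pos by simp
qed

lemma integral_pos:
  fixes f :: "ennreal \<Rightarrow> real"
  assumes "integrable \<Lambda> f" "AE t in \<Lambda>. f t > 0"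
  shows "(LINT t|\<Lambda>. f t) > 0"
proof -
  have nn: "AE t in \<Lambda>. f t \<ge> 0" using assms(2) by eventually_elim (rule less_imp_le)
  then have "(LINT t|\<Lambda>. f t) \<ge> 0" by (rule integral_nonneg_AE)
  moreover have "(LINT t|\<Lambda>. f t) \<noteq> 0"
  proof
    assume "(LINT t|\<Lambda>. f t) = 0"
    then have "AE t in \<Lambda>. f t = 0" using integral_nonneg_eq_0_iff_AE[OF assms(1) nn] by simp
    with assms(2) have "AE t in \<Lambda>. False" by eventually_elim simp
    then have "emeasure \<Lambda> (space \<Lambda>) = 0"
      using AE_iff_null[of \<Lambda> "\<lambda>_. False"] by (simp add: null_sets_def)
    with b_pos show False by (simp add: measure_def)
  qed
  ultimately show ?thesis by linarith
qed

text \<open>By \<open>Psi_alpha\<close>, the product \<alpha> * \<open>dPsi\<close> is the integral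
  of 1 - exp (- \<alpha> t) - \<alpha> t exp (- \<alpha> t), which is positive by
  \<open>one_minus_exp_pos\<close>.\<close>

lemma dPsi_pos: "dPsi > 0"
proof -
  have "0 < (LINT t|\<Lambda>. 1 - exp_neg \<alpha> t - \<alpha> * (enn2real t * exp_neg \<alpha> t))"
  proof (rule integral_pos)
    show "AE t in \<Lambda>. 0 < 1 - exp_neg \<alpha> t - \<alpha> * (enn2real t * exp_neg \<alpha> t)"
      using AE_pos
    proof eventually_elim
      case (elim t)
      moreover have "t \<noteq> \<infinity>" using elim by (metis ennreal_neq_top infinity_ennreal_def)
      ultimately show ?case
        using one_minus_exp_pos[of "\<alpha> * enn2real t"] alpha_pos by (simp add: exp_neg_def mult.assoc)
    qed
  qed (use integrable_exp_neg integrable_mean_exp_neg alpha_pos in auto)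
  also have "\<dots> = b - (b - \<alpha>) - \<alpha> * (1 - dPsi)"
    using integrable_exp_neg[of \<alpha>] integrable_mean_exp_neg[of \<alpha>] alpha_pos
    by (simp add: integral_exp_neg_alpha dPsi_def)
  also have "\<dots> = \<alpha> * dPsi" by (simp add: algebra_simps)
  finally show ?thesis using alpha_pos by (simp add: zero_less_mult_iff)
qed

text \<open>The Laplace transform of the intensity measure of the births.\<close>

definition mu :: "real \<Rightarrow> real" where
  "mu \<theta> = (LINT t|\<Lambda>. 1 - exp_neg \<theta> t) / \<theta>"

lemma mu_eq_Psi: "\<theta> > 0 \<Longrightarrow> mu \<theta> = 1 - Psi \<Lambda> \<theta> / \<theta>"
  by (simp add: mu_def Psi_def field_simps)

lemma mu_alpha: "mu \<alpha> = 1"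
  using alpha_pos by (simp add: mu_eq_Psi Psi_alpha)

lemma mu_pos: "\<theta> > 0 \<Longrightarrow> mu \<theta> > 0"
  unfolding mu_def
proof (intro divide_pos_pos integral_pos)
  assume "\<theta> > 0"
  show "AE t in \<Lambda>. 0 < 1 - exp_neg \<theta> t"
    using AE_pos
  proof eventually_elim
    case (elim t)
    then show ?case using \<open>\<theta> > 0\<close> by (auto simp: exp_neg_def)
  qed
qed (use integrable_exp_neg in auto)

text \<open>Because of \<open>Psi_alpha\<close>, the integral of the square of 1 - exp (- \<alpha>
  t) equals 2 \<alpha> (1 - mu (2 \<alpha>)). This is the source of all geometric decay over
  generations below.\<close>

lemma mu_2_alpha_less_1: "mu (2 * \<alpha>) < 1"
proof -
  have "0 < (LINT t|\<Lambda>. 1 - 2 * exp_neg \<alpha> t + exp_neg (2 * \<alpha>) t)"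
  proof (rule integral_pos)
    show "AE t in \<Lambda>. 0 < 1 - 2 * exp_neg \<alpha> t + exp_neg (2 * \<alpha>) t"
      using AE_pos
    proof eventually_elim
      case (elim t)
      define y where "y = exp (- \<alpha> * enn2real t)"
      have "exp (- (2 * \<alpha>) * enn2real t) = y * y"
        by (simp add: y_def flip: exp_add)
      moreover have "y < 1" using elim alpha_pos by (simp add: y_def)
      moreover have "(1 - y) * (1 - y) > 0" using \<open>y < 1\<close> by simp
      ultimately have "1 - 2 * y + exp (- (2 * \<alpha>) * enn2real t) > 0"
        by (simp add: algebra_simps)
      moreover have "t \<noteq> \<infinity>" using elim by (metis ennreal_neq_top infinity_ennreal_def)
      ultimately show ?case by (simp add: exp_neg_def y_def)
    qed
  qed (use integrable_exp_neg alpha_pos in auto)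
  also have "\<dots> = b - 2 * (b - \<alpha>) + (LINT t|\<Lambda>. exp_neg (2 * \<alpha>) t)"
    using integrable_exp_neg[of \<alpha>] integrable_exp_neg[of "2 * \<alpha>"] alpha_pos
    by (simp add: integral_exp_neg_alpha)
  finally show ?thesis
    using integrable_exp_neg[of "2 * \<alpha>"] alpha_pos by (simp add: mu_def field_simps)
qed

text \<open>In the quotient rule for \<open>Psi \<Lambda> \<theta> / \<theta>\<close> one of the two
  terms vanishes at \<alpha>, by \<open>Psi_alpha\<close>.\<close>

lemma mu_has_derivative: "(mu has_real_derivative - (dPsi / \<alpha>)) (at \<alpha>)"
proof -
  have "((\<lambda>\<theta>. 1 - Psi \<Lambda> \<theta> / \<theta>) has_real_derivative - (dPsi / \<alpha>)) (at \<alpha>)"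
    using Psi_has_derivative alpha_pos
    by (auto intro!: derivative_eq_intros simp: Psi_alpha field_simps power2_eq_square)
  moreover have "eventually (\<lambda>\<theta>. 1 - Psi \<Lambda> \<theta> / \<theta> = mu \<theta>) (nhds \<alpha>)"
    using eventually_nhds_in_open[of "{0<..}" \<alpha>] alpha_pos
    by (auto elim!: eventually_mono simp: mu_eq_Psi)
  ultimately show ?thesis
    using alpha_pos by (subst (asm) DERIV_cong_ev[OF refl _ refl]) (auto simp: mu_eq_Psi)
qed

end

subsection \<open>The law of an individual\<close>

text \<open>The points of a Poisson process of rate \<open>b\<close> have Erlang densities; by the
  exponential series these add up to the intensity, which is constant on the half-line.\<close>

lemma suminf_erlang_density:
  assumes "b > 0"
  shows "(\<Sum>k. ennreal (erlang_density k b x)) = (if x < 0 then 0 else ennreal b)"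
proof (cases "x < 0")
  case True
  then show ?thesis by (simp add: erlang_density_def)
next
  case False
  have "(\<lambda>k. b * exp (- b * x) * (inverse (fact k) * (b * x) ^ k)) sums (b * exp (- b * x) * exp (b * x))"
    using exp_converges[of "b * x"] by (intro sums_mult) (simp add: scaleR_conv_of_real divide_inverse)
  moreover have "b * exp (- b * x) * (inverse (fact k) * (b * x) ^ k) = erlang_density k b x" for k
    using False by (simp add: erlang_density_def power_mult_distrib field_simps)
  moreover have "b * exp (- b * x) * exp (b * x) = b"
    by (simp flip: exp_add)
  ultimately have "(\<lambda>k. erlang_density k b x) sums b" by (simp only:)
  then have "(\<Sum>k. ennreal (erlang_density k b x)) = ennreal b"
    using assms by (subst suminf_ennreal2) (auto simp: sums_iff)
  with False show ?thesis by simp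
qed

lemma distributed_sum_PiM_exponential:
  assumes b: "b > 0"
  shows "distributed (\<Pi>\<^sub>M k\<in>(UNIV :: nat set). density lborel (exponential_density b)) lborel
    (\<lambda>w. \<Sum>j\<le>k. w j) (erlang_density k b)"
proof -
  let ?D = "density lborel (exponential_density b)"
  let ?E = "\<Pi>\<^sub>M k\<in>(UNIV :: nat set). ?D"
  have D: "prob_space ?D" using b by (rule prob_space_exponential_density)
  interpret E: product_prob_space "\<lambda>_. ?D" "UNIV :: nat set"
    by (intro product_prob_spaceI D)
  interpret E: prob_space ?E by (intro prob_space_PiM D)
  have comp: "distr ?E borel (\<lambda>w. w i) = ?D" for i
    using E.PiM_component[of i] by (simp cong: distr_cong)
  \<comment> \<open>The point of index \<open>k\<close> is a sum of k + 1 waiting times, while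
    \<open>erlang_density\<close> is indexed by the number of summands minus one.\<close>
  have "distributed ?E lborel (\<lambda>w. \<Sum>j\<in>{..k}. w j) (erlang_density (card {..k} - 1) b)"
  proof (rule E.exponential_distributed_sum)
    show "distributed ?E lborel (\<lambda>w. w i) (exponential_density b)" for i
      using comp[of i] b by (auto simp: distributed_def cong: distr_cong)
    have "distr ?E (\<Pi>\<^sub>M i\<in>{..k}. borel) (\<lambda>x. \<lambda>i\<in>{..k}. x i) = distr ?E (\<Pi>\<^sub>M i\<in>{..k}. ?D) (\<lambda>x. \<lambda>i\<in>{..k}. x i)"
      by (intro distr_cong refl sets_PiM_cong) auto
    also have "\<dots> = (\<Pi>\<^sub>M i\<in>{..k}. ?D)"
      using distr_PiM_reindex[of UNIV "\<lambda>_. ?D" "\<lambda>i. i" "{..k}"] D by simp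
    also have "\<dots> = (\<Pi>\<^sub>M i\<in>{..k}. distr ?E borel (\<lambda>w. w i))" by (simp add: comp)
    finally show "E.indep_vars (\<lambda>i. borel) (\<lambda>i w. w i) {..k}"
      by (subst E.indep_vars_iff_distr_eq_PiM') auto
  qed (use b in auto)
  then show ?thesis by simp
qed

lemma nn_integral_exp_Ico:
  fixes \<theta> l :: real
  assumes "\<theta> > 0" "l > 0"
  shows "(\<integral>\<^sup>+x. indicator {0..<l} x * ennreal (exp (- \<theta> * x)) \<partial>lborel) = ennreal ((1 - exp (- \<theta> * l)) / \<theta>)"
proof -
  have "(\<integral>\<^sup>+x. indicator {0..<l} x * ennreal (exp (- \<theta> * x)) \<partial>lborel)
      = (\<integral>\<^sup>+x. ennreal (exp (- \<theta> * x)) * indicator {0..l} x \<partial>lborel)"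
    using AE_lborel_singleton[of l]
    by (intro nn_integral_cong_AE) (auto simp: indicator_def)
  also have "\<dots> = ennreal (- exp (- \<theta> * l) / \<theta> - (- exp (- \<theta> * 0) / \<theta>))"
    using assms by (intro nn_integral_FTC_Icc) (auto intro!: derivative_eq_intros)
  finally show ?thesis by (simp add: diff_divide_distrib)
qed

context cmj
begin

abbreviation U :: "ennreal measure" where "U \<equiv> uniform_measure \<Lambda> (space \<Lambda>)"
abbreviation W :: "(nat \<Rightarrow> real) measure" where
  "W \<equiv> \<Pi>\<^sub>M k\<in>UNIV. density lborel (exponential_density b)"
abbreviation I :: "individual measure" where "I \<equiv> individual_law \<Lambda>"
abbreviation P :: "(label \<Rightarrow> individual) measure" where "P \<equiv> process_law \<Lambda>"

lemma prob_space_U: "prob_space U"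
  using b_pos by (intro prob_space_uniform_measure) (auto simp: L.emeasure_eq_measure)

lemma prob_space_W: "prob_space W"
  by (intro prob_space_PiM prob_space_exponential_density b_pos)

lemma individual_law_eq: "I = U \<Otimes>\<^sub>M W"
  by (simp add: individual_law_def)

lemma prob_space_I: "prob_space I"
proof -
  interpret U: prob_space U by (rule prob_space_U)
  interpret W: prob_space W by (rule prob_space_W)
  interpret pair_prob_space U W ..
  show ?thesis unfolding individual_law_eq by unfold_locales
qed

lemma prob_space_P: "prob_space P"
  unfolding process_law_def by (intro prob_space_PiM prob_space_I)

end

sublocale cmj \<subseteq> P: prob_space "process_law \<Lambda>"
  by (rule prob_space_P)

context cmj
begin

lemma measurable_lifetime[measurable]: "lifetime \<in> borel_measurable I"
proof -
  have "fst \<in> U \<Otimes>\<^sub>M W \<rightarrow>\<^sub>M \<Lambda>" by (rule measurable_compose[OF measurable_fst]) simp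
  then have "(\<lambda>i. fst i) \<in> borel_measurable (U \<Otimes>\<^sub>M W)"
    by (rule measurable_compose) (rule borel_measurable_id_Lambda)
  then show ?thesis by (simp add: individual_law_eq lifetime_def[abs_def])
qed

lemma measurable_snd_individual[measurable]: "(\<lambda>i. snd i j) \<in> borel_measurable I"
proof -
  have "(\<lambda>w. w j) \<in> borel_measurable W"
    using measurable_component_singleton[of j UNIV "\<lambda>_. density lborel (exponential_density b)"]
    by simp
  then have "(\<lambda>i. snd i j) \<in> borel_measurable (U \<Otimes>\<^sub>M W)"
    by (rule measurable_compose[OF measurable_snd])
  then show ?thesis by (simp add: individual_law_eq)
qed

lemma measurable_birth_age[measurable]: "(\<lambda>i. birth_age i k) \<in> borel_measurable I"
  unfolding birth_age_def by measurable

lemma sets_P[measurable_cong]: "sets P = sets (\<Pi>\<^sub>M u\<in>UNIV. I)"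
  by (simp add: process_law_def)

lemma measurable_individual[measurable]: "(\<lambda>x. x u) \<in> P \<rightarrow>\<^sub>M I"
  unfolding process_law_def by measurable

lemma measurable_exists_ind[measurable]: "Measurable.pred P (\<lambda>x. exists_ind x u)"
  by (induction u) auto

lemma measurable_birth_time[measurable]: "(\<lambda>x. birth_time x u) \<in> borel_measurable P"
  by (induction u) auto

lemma nn_integral_individual:
  assumes [measurable]: "f \<in> borel_measurable (U \<Otimes>\<^sub>M W)"
  shows "(\<integral>\<^sup>+i. f i \<partial>I) = (\<integral>\<^sup>+t. \<integral>\<^sup>+w. f (t, w) \<partial>W \<partial>U)"
proof -
  interpret W: prob_space W by (rule prob_space_W)
  show ?thesis unfolding individual_law_eq by (simp add: W.nn_integral_fst)
qed

text \<open>Summed over \<open>k\<close>, this is the integral of exp (- \<theta> t) against the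
  birth point process of one individual.\<close>

definition disc :: "real \<Rightarrow> nat \<Rightarrow> individual \<Rightarrow> ennreal" where
  "disc \<theta> k i = (if ennreal (birth_age i k) < lifetime i then ennreal (exp (- \<theta> * birth_age i k)) else 0)"

lemma measurable_disc[measurable]: "disc \<theta> k \<in> borel_measurable I"
  unfolding disc_def[abs_def] by measurable

text \<open>Campbell's formula. For a fixed lifetime the Erlang densities add up to
  \<open>b\<close>, which cancels against the normalisation of the lifetime law. With \<theta>
  arbitrary it serves both the Laplace transform and, at \<theta> = 0, the mean number of
  children.\<close>

lemma suminf_disc_aux:
  "(\<Sum>k. \<integral>\<^sup>+i. disc \<theta> k i \<partial>I)
    = (\<integral>\<^sup>+t. (\<integral>\<^sup>+x. (if 0 \<le> x \<and> ennreal x < t then ennreal (exp (- \<theta> * x)) else 0) \<partial>lborel) \<partial>\<Lambda>)"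
proof -
  interpret U: prob_space U by (rule prob_space_U)
  interpret W: prob_space W by (rule prob_space_W)
  let ?H = "\<lambda>t. \<integral>\<^sup>+x. (if 0 \<le> x \<and> ennreal x < t then ennreal (exp (- \<theta> * x)) else 0) \<partial>lborel"
  have "(\<lambda>(t::ennreal, x::real). (if 0 \<le> x \<and> ennreal x < t then ennreal (exp (- \<theta> * x)) else 0)) \<in> borel_measurable (borel \<Otimes>\<^sub>M lborel)"
    by measurable
  then have H: "?H \<in> borel_measurable \<Lambda>"
    using lborel.borel_measurable_nn_integral[of "\<lambda>t x. (if 0 \<le> x \<and> ennreal x < t then ennreal (exp (- \<theta> * x)) else 0)" borel]
    by (intro measurable_Lambda) auto
  let ?h = "\<lambda>t x. (if ennreal x < t then ennreal (exp (- \<theta> * x)) else 0)"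
  have disc: "disc \<theta> k (t, w) = ?h t (\<Sum>j\<le>k. w j)" for k t w
    by (simp add: disc_def birth_age_def lifetime_def)
  have h: "?h t \<in> borel_measurable borel" for t by measurable
  have inner: "(\<integral>\<^sup>+w. disc \<theta> k (t, w) \<partial>W) = (\<integral>\<^sup>+x. ennreal (erlang_density k b x) * ?h t x \<partial>lborel)" for k t
    unfolding disc
    by (rule distributed_nn_integral[OF distributed_sum_PiM_exponential[OF b_pos], symmetric]) (use h in simp)
  have m: "disc \<theta> k \<in> borel_measurable (U \<Otimes>\<^sub>M W)" for k
    using measurable_disc[of \<theta> k] by (simp add: individual_law_eq)
  have "(\<Sum>k. \<integral>\<^sup>+i. disc \<theta> k i \<partial>I) = (\<Sum>k. \<integral>\<^sup>+t. \<integral>\<^sup>+w. disc \<theta> k (t, w) \<partial>W \<partial>U)"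
    using m by (simp add: nn_integral_individual)
  also have "\<dots> = (\<integral>\<^sup>+t. (\<Sum>k. \<integral>\<^sup>+w. disc \<theta> k (t, w) \<partial>W) \<partial>U)"
    using m by (intro nn_integral_suminf[symmetric]) (auto intro!: W.borel_measurable_nn_integral)
  also have "\<dots> = (\<integral>\<^sup>+t. (\<integral>\<^sup>+x. (\<Sum>k. ennreal (erlang_density k b x) * ?h t x) \<partial>lborel) \<partial>U)"
    unfolding inner using h by (intro nn_integral_cong nn_integral_suminf[symmetric]) simp
  also have "\<dots> = (\<integral>\<^sup>+t. (\<integral>\<^sup>+x. ennreal b * (if 0 \<le> x \<and> ennreal x < t then ennreal (exp (- \<theta> * x)) else 0) \<partial>lborel) \<partial>U)"
    by (intro nn_integral_cong) (auto simp: ennreal_suminf_multc suminf_erlang_density[OF b_pos])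
  also have "\<dots> = (\<integral>\<^sup>+t. ennreal b * (\<integral>\<^sup>+x. (if 0 \<le> x \<and> ennreal x < t then ennreal (exp (- \<theta> * x)) else 0) \<partial>lborel) \<partial>U)"
    by (intro nn_integral_cong nn_integral_cmult) auto
  also have "\<dots> = (\<integral>\<^sup>+t. ennreal b * ?H t * indicator (space \<Lambda>) t \<partial>\<Lambda>) / ennreal b"
    using H by (subst nn_integral_uniform_measure) (auto simp: L.emeasure_eq_measure)
  also have "\<dots> = (\<integral>\<^sup>+t. ennreal b * ?H t \<partial>\<Lambda>) / ennreal b"
    by (intro arg_cong2[where f = "(/)"] nn_integral_cong) auto
  also have "\<dots> = ennreal b * (\<integral>\<^sup>+t. ?H t \<partial>\<Lambda>) / ennreal b"
    using H by (simp add: nn_integral_cmult)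
  also have "\<dots> = (\<integral>\<^sup>+t. ?H t \<partial>\<Lambda>)"
    using b_pos by (subst mult.commute) (intro ennreal_mult_divide_eq, auto)
  finally show ?thesis .
qed

lemma suminf_disc:
  assumes "\<theta> > 0"
  shows "(\<Sum>k. \<integral>\<^sup>+i. disc \<theta> k i \<partial>I) = ennreal (mu \<theta>)"
proof -
  have "(\<Sum>k. \<integral>\<^sup>+i. disc \<theta> k i \<partial>I) = (\<integral>\<^sup>+t. ennreal ((1 - exp_neg \<theta> t) / \<theta>) \<partial>\<Lambda>)"
    unfolding suminf_disc_aux using AE_pos
  proof (intro nn_integral_cong_AE, eventually_elim)
    case (elim t)
    have "(0 \<le> x \<and> ennreal x < t) \<longleftrightarrow> x \<in> {0..<enn2real t}" for x
      using elim ennreal_less_iff[of x "enn2real t"] by auto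
    then have "(\<integral>\<^sup>+x. (if 0 \<le> x \<and> ennreal x < t then ennreal (exp (- \<theta> * x)) else 0) \<partial>lborel)
        = (\<integral>\<^sup>+x. indicator {0..<enn2real t} x * ennreal (exp (- \<theta> * x)) \<partial>lborel)"
      by (intro nn_integral_cong) (auto simp: indicator_def)
    moreover have "t \<noteq> \<infinity>" using elim by (metis ennreal_neq_top infinity_ennreal_def)
    ultimately show ?case
      using nn_integral_exp_Ico[OF assms, of "enn2real t"] elim
      by (simp add: exp_neg_def)
  qed
  also have "\<dots> = ennreal (LINT t|\<Lambda>. (1 - exp_neg \<theta> t) / \<theta>)"
    using integrable_exp_neg[of \<theta>] exp_neg_bounds[of \<theta>] assms by (intro nn_integral_eq_integral) auto
  finally show ?thesis by (simp add: mu_def)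
qed

text \<open>The mean number of children; its finiteness makes the generations finite almost
  surely.\<close>

lemma suminf_disc_0: "(\<Sum>k. \<integral>\<^sup>+i. disc 0 k i \<partial>I) < \<infinity>"
proof -
  have "(\<Sum>k. \<integral>\<^sup>+i. disc 0 k i \<partial>I) = (\<integral>\<^sup>+t. t \<partial>\<Lambda>)"
    unfolding suminf_disc_aux using AE_pos
  proof (intro nn_integral_cong_AE, eventually_elim)
    case (elim t)
    have "(0 \<le> x \<and> ennreal x < t) \<longleftrightarrow> x \<in> {0..<enn2real t}" for x
      using elim ennreal_less_iff[of x "enn2real t"] by auto
    then have "(\<integral>\<^sup>+x. (if 0 \<le> x \<and> ennreal x < t then ennreal (exp (- 0 * x)) else 0) \<partial>lborel)
        = (\<integral>\<^sup>+x. indicator {0..<enn2real t} x \<partial>lborel)"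
      by (intro nn_integral_cong) (auto simp: indicator_def)
    also have "\<dots> = ennreal (enn2real t)" using elim by simp
    finally show ?case using elim by simp
  qed
  with mean_finite show ?thesis by simp
qed

end

subsection \<open>Moments of discounted generation sums\<close>

lemma ennreal_exp_add:
  fixes \<theta> s t :: real
  shows "ennreal (exp (- \<theta> * (s + t))) = ennreal (exp (- \<theta> * s)) * ennreal (exp (- \<theta> * t))"
proof -
  have "exp (- \<theta> * (s + t)) = exp (- \<theta> * s) * exp (- \<theta> * t)"
    by (simp add: algebra_simps flip: exp_add)
  then show ?thesis by (simp add: ennreal_mult')
qed

text \<open>The data of an individual govern only the births of its children, so its own birth is
  read off from its proper ancestors, which are the strict suffixes of its label.\<close>

lemma exists_birth_cong:
  assumes "\<And>w. strict_suffix w u \<Longrightarrow> x w = y w"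
  shows "exists_ind x u = exists_ind y u" "birth_time x u = birth_time y u"
proof -
  have "exists_ind x u = exists_ind y u \<and> birth_time x u = birth_time y u"
    using assms
  proof (induction u)
    case (Cons k u)
    have "strict_suffix w (k # u)" if "strict_suffix w u" for w
      using that by (auto simp: strict_suffix_def suffix_Cons dest: suffix_length_le)
    then have "exists_ind x u = exists_ind y u \<and> birth_time x u = birth_time y u"
      using Cons by blast
    moreover have "x u = y u"
      using Cons.prems[of u] by (simp add: strict_suffix_def suffix_Cons)
    ultimately show ?case by simp
  qed simp
  then show "exists_ind x u = exists_ind y u" "birth_time x u = birth_time y u" by auto
qed

lemma exists_birth_update:
  assumes "\<not> strict_suffix l u"
  shows "exists_ind (x(l := i)) u = exists_ind x u" "birth_time (x(l := i)) u = birth_time x u"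
  using assms by (auto intro!: exists_birth_cong)

lemma strict_suffix_length: "strict_suffix w u \<Longrightarrow> length w < length u"
  unfolding strict_suffix_def by (metis suffix_length_le le_neq_implies_less suffix_order.order_refl suffix_def append_eq_append_conv append_Nil)

section \<open>Sums over a generation and their first moments\<close>

text \<open>An integral instead of a sum, so that Tonelli and monotonicity are available in
  \<open>ennreal\<close> without summability conditions.\<close>

definition gsum :: "nat \<Rightarrow> (nat list \<Rightarrow> ennreal) \<Rightarrow> ennreal" where
  "gsum g f = (\<integral>\<^sup>+u. f u \<partial>count_space {u. length u = g})"

lemma gsum_cong: "(\<And>u. length u = g \<Longrightarrow> f u = f' u) \<Longrightarrow> gsum g f = gsum g f'"
  unfolding gsum_def by (intro nn_integral_cong) simp

lemma gsum_mono: "(\<And>u. length u = g \<Longrightarrow> f u \<le> f' u) \<Longrightarrow> gsum g f \<le> gsum g f'"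
  unfolding gsum_def by (intro nn_integral_mono) simp

lemma gsum_add: "gsum g (\<lambda>u. f u + f' u) = gsum g f + gsum g f'"
  unfolding gsum_def by (intro nn_integral_add) simp_all

lemma gsum_multc: "gsum g (\<lambda>u. f u * c) = gsum g f * c"
  unfolding gsum_def by (intro nn_integral_multc) simp_all

lemma gsum_0: "gsum 0 f = f []"
proof -
  have "{u :: nat list. length u = 0} = {[]}" by auto
  then show ?thesis by (simp add: gsum_def nn_integral_count_space_finite)
qed

lemma gsum_suminf: "gsum g (\<lambda>u. \<Sum>k. f k u) = (\<Sum>k. gsum g (f k))"
  unfolding gsum_def by (intro nn_integral_suminf) simp_all

lemma gsum_swap: "gsum g (\<lambda>u. gsum h (f u)) = gsum h (\<lambda>v. gsum g (\<lambda>u. f u v))"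
proof -
  interpret A: sigma_finite_measure "count_space {u :: nat list. length u = g}"
    by (rule sigma_finite_measure_count_space_countable) simp
  interpret B: sigma_finite_measure "count_space {u :: nat list. length u = h}"
    by (rule sigma_finite_measure_count_space_countable) simp
  interpret AB: pair_sigma_finite "count_space {u :: nat list. length u = h}" "count_space {u :: nat list. length u = g}" ..
  show ?thesis unfolding gsum_def
    by (rule AB.Fubini'[of "\<lambda>v u. f u v"]) (simp add: pair_measure_countable)
qed

lemma nn_integral_gsum:
  assumes "sigma_finite_measure M" "\<And>u. f u \<in> borel_measurable M"
  shows "(\<integral>\<^sup>+x. gsum g (\<lambda>u. f u x) \<partial>M) = gsum g (\<lambda>u. \<integral>\<^sup>+x. f u x \<partial>M)"
proof -
  interpret M: sigma_finite_measure M by fact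
  interpret A: sigma_finite_measure "count_space {u :: nat list. length u = g}"
    by (rule sigma_finite_measure_count_space_countable) simp
  interpret AB: pair_sigma_finite "count_space {u :: nat list. length u = g}" M ..
  show ?thesis unfolding gsum_def
    by (rule AB.Fubini'[of f]) (use assms(2) in \<open>simp add: measurable_pair_measure_countable1\<close>)
qed

lemma borel_measurable_gsum:
  assumes "\<And>u. f u \<in> borel_measurable M"
  shows "(\<lambda>x. gsum g (\<lambda>u. f u x)) \<in> borel_measurable M"
proof -
  interpret A: sigma_finite_measure "count_space {u :: nat list. length u = g}"
    by (rule sigma_finite_measure_count_space_countable) simp
  have *: "case_prod (\<lambda>x u. f u x) \<in> borel_measurable (M \<Otimes>\<^sub>M count_space {u :: nat list. length u = g})"
    using measurable_pair_swap[OF measurable_pair_measure_countable1[of "{u :: nat list. length u = g}" "\<lambda>(u, x). f u x" M borel]] assms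
    by simp
  show ?thesis unfolding gsum_def
    using A.borel_measurable_nn_integral[OF *] by simp
qed

lemma gsum_Suc: "gsum (Suc g) f = gsum g (\<lambda>u. \<Sum>k. f (k # u))"
proof -
  interpret A: sigma_finite_measure "count_space {u :: nat list. length u = g}"
    by (rule sigma_finite_measure_count_space_countable) simp
  have bij: "bij_betw (\<lambda>(k, u). k # u) (UNIV \<times> {u :: nat list. length u = g}) {u. length u = Suc g}"
    by (auto simp: bij_betw_def inj_on_def length_Suc_conv image_iff)
  have "gsum (Suc g) f = (\<integral>\<^sup>+z. f (case z of (k, u) \<Rightarrow> k # u) \<partial>count_space (UNIV \<times> {u. length u = g}))"
    unfolding gsum_def by (rule nn_integral_bij_count_space[OF bij, symmetric])
  also have "count_space ((UNIV :: nat set) \<times> {u :: nat list. length u = g}) = count_space UNIV \<Otimes>\<^sub>M count_space {u. length u = g}"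
    by (rule pair_measure_countable[symmetric]) auto
  also have "(\<integral>\<^sup>+z. f (case z of (k, u) \<Rightarrow> k # u) \<partial>(count_space UNIV \<Otimes>\<^sub>M count_space {u. length u = g}))
      = (\<Sum>k. gsum g (\<lambda>u. f (k # u)))"
    by (subst A.nn_integral_fst[symmetric])
       (simp_all add: pair_measure_countable nn_integral_count_space_nat gsum_def)
  finally show ?thesis by (simp add: gsum_suminf)
qed

context cmj
begin

text \<open>At \<theta> = \<alpha> the generation sums form the additive martingale of the branching
  random walk of birth times; at \<theta> = 0 they count the generation.\<close>

definition wt :: "real \<Rightarrow> label \<Rightarrow> (label \<Rightarrow> individual) \<Rightarrow> ennreal" where
  "wt \<theta> u x = (if exists_ind x u then ennreal (exp (- \<theta> * birth_time x u)) else 0)"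

lemma measurable_wt[measurable]: "wt \<theta> u \<in> borel_measurable P"
  unfolding wt_def[abs_def] by measurable

lemma wt_Nil[simp]: "wt \<theta> [] = (\<lambda>_. 1)"
  by (simp add: wt_def fun_eq_iff)

lemma wt_Cons: "wt \<theta> (k # u) x = wt \<theta> u x * disc \<theta> k (x u)"
  unfolding wt_def disc_def exists_ind.simps birth_time.simps ennreal_exp_add by simp

lemma wt_update: "\<not> strict_suffix l u \<Longrightarrow> wt \<theta> u (x(l := i)) = wt \<theta> u x"
  by (simp add: wt_def exists_birth_update)

lemma nn_integral_mult_individual:
  assumes f: "f \<in> borel_measurable P" and g: "g \<in> borel_measurable I"
    and indep: "\<And>x y. f (x(u := y)) = f x"
  shows "(\<integral>\<^sup>+x. f x * g (x u) \<partial>P) = (\<integral>\<^sup>+x. f x \<partial>P) * (\<integral>\<^sup>+y. g y \<partial>I)"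
  unfolding process_law_def
  by (rule nn_integral_PiM_mult_coordinate[OF prob_space_I])
     (use assms in \<open>simp_all add: process_law_def\<close>)

lemma nn_integral_wt_Cons:
  "(\<integral>\<^sup>+x. wt \<theta> (k # u) x \<partial>P) = (\<integral>\<^sup>+x. wt \<theta> u x \<partial>P) * (\<integral>\<^sup>+i. disc \<theta> k i \<partial>I)"
  unfolding wt_Cons by (rule nn_integral_mult_individual) (auto simp: wt_update)

text \<open>The weight of a mother is independent of her own data, so each generation multiplies the
  expected sum by the mean discounted offspring.\<close>

lemma gsum_wt: "gsum g (\<lambda>u. \<integral>\<^sup>+x. wt \<theta> u x \<partial>P) = (\<Sum>k. \<integral>\<^sup>+i. disc \<theta> k i \<partial>I) ^ g"
proof (induction g)
  case 0
  then show ?case by (simp add: gsum_0 P.emeasure_space_1)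
next
  case (Suc g)
  then show ?case
    by (simp add: gsum_Suc nn_integral_wt_Cons ennreal_suminf_cmult gsum_multc mult.commute)
qed

lemma gsum_wt_mu: "\<theta> > 0 \<Longrightarrow> gsum g (\<lambda>u. \<integral>\<^sup>+x. wt \<theta> u x \<partial>P) = ennreal (mu \<theta> ^ g)"
  using mu_pos[of \<theta>] by (simp add: gsum_wt suminf_disc ennreal_power)

lemma AE_waiting_pos_I: "AE i in I. \<forall>j. snd i j > 0"
proof -
  have D: "prob_space (density lborel (exponential_density b))"
    by (rule prob_space_exponential_density[OF b_pos])
  interpret U: prob_space U by (rule prob_space_U)
  interpret W: prob_space W by (rule prob_space_W)
  interpret UW: pair_sigma_finite U W ..
  have "AE y in density lborel (exponential_density b). y > 0"
    using b_pos AE_lborel_singleton[of "0 :: real"]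
    by (subst AE_density) (auto elim!: eventually_mono simp: erlang_density_def)
  then have W: "AE w in W. w j > 0" for j
    using D by (intro AE_PiM_component) auto
  have "AE i in I. snd i j > 0" for j
  proof -
    have "{z \<in> space (U \<Otimes>\<^sub>M W). snd z j > 0} \<in> sets (U \<Otimes>\<^sub>M W)"
      using measurable_snd_individual[of j] unfolding individual_law_eq by measurable
    moreover have "AE t in U. AE w in W. snd (t, w) j > 0" using W by simp
    ultimately show ?thesis
      unfolding individual_law_eq by (rule UW.AE_pair_measure)
  qed
  then show ?thesis by (simp add: AE_all_countable)
qed

lemma AE_waiting_pos: "AE x in P. \<forall>u j. snd (x u) j > 0"
proof -
  have "AE x in P. \<forall>j. snd (x u) j > 0" for u
    unfolding process_law_def
    using AE_PiM_component[of UNIV "\<lambda>_. I" u "\<lambda>i. \<forall>j. snd i j > 0"] prob_space_I AE_waiting_pos_I by auto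
  then show ?thesis by (simp add: AE_all_countable)
qed

text \<open>The last waiting time is peeled off by independence. Each one contributes b / (b +
  \<theta>), since exp (- \<theta> y) times the exponential density of rate \<open>b\<close> is this
  multiple of the density of rate b + \<theta>.\<close>

lemma nn_integral_exp_waiting:
  assumes "\<theta> > 0"
  shows "(\<integral>\<^sup>+w. ennreal (exp (- \<theta> * (\<Sum>j\<le>k. w j))) \<partial>W) = ennreal ((b / (b + \<theta>)) ^ Suc k)"
proof -
  let ?D = "density lborel (exponential_density b)"
  have D: "prob_space ?D" by (rule prob_space_exponential_density[OF b_pos])
  interpret W: prob_space W by (rule prob_space_W)
  have r: "(\<integral>\<^sup>+y. ennreal (exp (- \<theta> * y)) \<partial>?D) = ennreal (b / (b + \<theta>))"
  proof -
    interpret X: prob_space "density lborel (exponential_density (b + \<theta>))"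
      using b_pos assms by (intro prob_space_exponential_density) auto
    have "(\<integral>\<^sup>+y. ennreal (exp (- \<theta> * y)) \<partial>?D)
        = (\<integral>\<^sup>+y. ennreal (exponential_density b y) * ennreal (exp (- \<theta> * y)) \<partial>lborel)"
      by (simp add: nn_integral_density)
    also have "\<dots> = (\<integral>\<^sup>+y. ennreal (b / (b + \<theta>)) * ennreal (exponential_density (b + \<theta>) y) \<partial>lborel)"
    proof (intro nn_integral_cong)
      fix y :: real
      have "exp (- b * y) * exp (- \<theta> * y) = exp (- (b + \<theta>) * y)"
        by (simp add: algebra_simps flip: exp_add)
      then have "exponential_density b y * exp (- \<theta> * y)
          = b / (b + \<theta>) * exponential_density (b + \<theta>) y"
        using b_pos assms by (simp add: erlang_density_def)
      then show "ennreal (exponential_density b y) * ennreal (exp (- \<theta> * y))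
          = ennreal (b / (b + \<theta>)) * ennreal (exponential_density (b + \<theta>) y)"
        using b_pos assms by (metis ennreal_mult'' erlang_density_nonneg exp_ge_zero less_imp_le add_nonneg_nonneg)
    qed
    also have "\<dots> = ennreal (b / (b + \<theta>)) * (\<integral>\<^sup>+y. ennreal (exponential_density (b + \<theta>) y) \<partial>lborel)"
      by (simp add: nn_integral_cmult)
    also have "(\<integral>\<^sup>+y. ennreal (exponential_density (b + \<theta>) y) \<partial>lborel) = 1"
      using X.emeasure_space_1 by (simp add: emeasure_density)
    finally show ?thesis by simp
  qed
  have step: "(\<integral>\<^sup>+w. f w * ennreal (exp (- \<theta> * w l)) \<partial>W) = (\<integral>\<^sup>+w. f w \<partial>W) * ennreal (b / (b + \<theta>))"
    if "f \<in> borel_measurable W" "\<And>x y. f (x(l := y)) = f x" for f l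
    using nn_integral_PiM_mult_coordinate[OF D, of f "\<lambda>y. ennreal (exp (- \<theta> * y))" l] that r by simp
  show ?thesis
  proof (induction k)
    case 0
    show ?case using step[of "\<lambda>_. 1" 0] by (simp add: W.emeasure_space_1)
  next
    case (Suc k)
    have "(\<integral>\<^sup>+w. ennreal (exp (- \<theta> * (\<Sum>j\<le>Suc k. w j))) \<partial>W)
        = (\<integral>\<^sup>+w. ennreal (exp (- \<theta> * (\<Sum>j\<le>k. w j))) * ennreal (exp (- \<theta> * w (Suc k))) \<partial>W)"
      by (simp only: sum.atMost_Suc ennreal_exp_add)
    also have "\<dots> = ennreal ((b / (b + \<theta>)) ^ Suc k) * ennreal (b / (b + \<theta>))"
      by (subst step) (use Suc in auto)
    also have "\<dots> = ennreal ((b / (b + \<theta>)) ^ Suc (Suc k))"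
      using b_pos assms by (simp flip: ennreal_mult' add: mult.commute)
    finally show ?case .
  qed
qed

text \<open>Second moment of the discounted offspring sum of one individual.\<close>

definition M2 :: ennreal where
  "M2 = (\<Sum>k. \<Sum>l. \<integral>\<^sup>+i. disc \<alpha> k i * disc \<alpha> l i \<partial>I)"

text \<open>Dropping the lifetime constraint only enlarges the discounts, and a product of two of
  them is at most the one of the later point. Its expectation is r to the power m + 1 with m = max k
  l, and with q = sqrt r this is at most \<open>q ^ k * q ^ l\<close>, as 2 (m + 1) exceeds k + l.
  The double sum is thus dominated by a product of two geometric series.\<close>

lemma M2_finite: "M2 < \<infinity>"
proof -
  define r where "r = b / (b + \<alpha>)"
  define q where "q = sqrt r"
  have r: "0 < r" "r < 1" using b_pos alpha_pos by (auto simp: r_def)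
  then have q: "0 < q" "q < 1" "q * q = r" by (auto simp: q_def)
  interpret W: prob_space W by (rule prob_space_W)
  interpret U: prob_space U by (rule prob_space_U)
  have bound: "(\<integral>\<^sup>+i. disc \<alpha> k i * disc \<alpha> l i \<partial>I) \<le> ennreal (q ^ k) * ennreal (q ^ l)" for k l
  proof -
    define m where "m = max k l"
    have "(\<integral>\<^sup>+i. disc \<alpha> k i * disc \<alpha> l i \<partial>I) \<le> (\<integral>\<^sup>+i. ennreal (exp (- \<alpha> * (\<Sum>j\<le>m. snd i j))) \<partial>I)"
      using AE_waiting_pos_I
    proof (intro nn_integral_mono_AE, eventually_elim)
      case (elim i)
      have nn: "birth_age i k \<ge> 0" for k
        using elim by (auto simp: birth_age_def less_imp_le intro!: sum_nonneg)
      have le: "disc \<alpha> k i \<le> ennreal (exp (- \<alpha> * birth_age i k))" for k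
        by (simp add: disc_def)
      have "ennreal (exp (- \<alpha> * birth_age i k)) \<le> 1" for k
        using nn[of k] alpha_pos by (simp add: ennreal_le_1)
      then have le1: "disc \<alpha> k i \<le> 1" for k
        using le order_trans by blast
      have "m = k \<or> m = l" by (auto simp: m_def)
      then have "disc \<alpha> k i * disc \<alpha> l i \<le> ennreal (exp (- \<alpha> * birth_age i m))"
        using mult_mono[OF le[of k] le1[of l]] mult_mono[OF le1[of k] le[of l]] by auto
      then show ?case by (simp add: birth_age_def)
    qed
    also have "\<dots> = (\<integral>\<^sup>+t. \<integral>\<^sup>+w. ennreal (exp (- \<alpha> * (\<Sum>j\<le>m. snd (t, w) j))) \<partial>W \<partial>U)"
    proof (rule nn_integral_individual)
      show "(\<lambda>i. ennreal (exp (- \<alpha> * (\<Sum>j\<le>m. snd i j)))) \<in> borel_measurable (U \<Otimes>\<^sub>M W)"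
        unfolding individual_law_eq[symmetric] by measurable
    qed
    also have "\<dots> = ennreal (r ^ Suc m)"
      by (simp only: snd_conv nn_integral_exp_waiting[OF alpha_pos] nn_integral_const U.emeasure_space_1 r_def mult_1_right)
    also have "\<dots> \<le> ennreal (q ^ (k + l))"
    proof (rule ennreal_leI)
      have "r ^ Suc m = q ^ (2 * Suc m)"
        using q by (simp only: power_mult power2_eq_square)
      also have "\<dots> \<le> q ^ (k + l)"
        using q by (intro power_decreasing) (auto simp: m_def)
      finally show "r ^ Suc m \<le> q ^ (k + l)" .
    qed
    finally show ?thesis using q by (simp add: power_add flip: ennreal_mult')
  qed
  have geo: "(\<Sum>k. ennreal (q ^ k)) = ennreal (1 / (1 - q))"
    using q by (subst suminf_ennreal2) (auto simp: suminf_geometric summable_geometric)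
  have "M2 \<le> (\<Sum>k. \<Sum>l. ennreal (q ^ k) * ennreal (q ^ l))"
    unfolding M2_def by (intro suminf_le bound) auto
  also have "\<dots> = ennreal (1 / (1 - q)) * ennreal (1 / (1 - q))"
    by (simp add: ennreal_suminf_cmult ennreal_suminf_multc geo)
  also have "\<dots> < \<infinity>" by (simp add: ennreal_mult_less_top)
  finally show ?thesis .
qed

end

section \<open>Second moments over pairs with a common ancestor\<close>

lemma gsum_delta:
  assumes "length u = g"
  shows "gsum g (\<lambda>v. if u = v then f v else 0) = f u"
proof -
  have "gsum g (\<lambda>v. if u = v then f v else 0) = (\<integral>\<^sup>+v. f v * indicator {u} v \<partial>count_space {u. length u = g})"
    unfolding gsum_def by (intro nn_integral_cong) (auto simp: indicator_def)
  also have "\<dots> = f u"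
    using assms by (subst nn_integral_indicator_singleton) auto
  finally show ?thesis .
qed

text \<open>Ancestors are suffixes: \<open>u\<close> and \<open>v\<close> have a common ancestor in generation \<open>J\<close>.\<close>

definition meet_at :: "nat \<Rightarrow> nat list \<Rightarrow> nat list \<Rightarrow> bool" where
  "meet_at J u v \<longleftrightarrow> (\<exists>w. length w = J \<and> suffix w u \<and> suffix w v)"

lemma meet_at_commute: "meet_at J u v = meet_at J v u"
  unfolding meet_at_def by blast

lemma meet_at_Cons: "J \<le> length u \<Longrightarrow> meet_at J (k # u) v = meet_at J u v"
  unfolding meet_at_def suffix_Cons by (metis Suc_n_not_le_n length_Cons)

lemma meet_at_same_length: "length u = J \<Longrightarrow> length v = J \<Longrightarrow> meet_at J u v \<longleftrightarrow> u = v"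
  unfolding meet_at_def by (metis suffix_def append_eq_append_conv append_Nil suffix_order.refl)

lemma meet_at_le: "meet_at J u v \<Longrightarrow> J \<le> length u \<and> J \<le> length v"
  unfolding meet_at_def by (metis suffix_length_le)

context cmj
begin

definition pair_wt :: "label \<Rightarrow> label \<Rightarrow> ennreal" where
  "pair_wt u v = (\<integral>\<^sup>+x. wt \<alpha> u x * wt \<alpha> v x \<partial>P)"

text \<open>Taking \<open>J\<close> = 0 gives the unrestricted second moment, since the root is
  common to all.\<close>

definition pair_sum :: "nat \<Rightarrow> nat \<Rightarrow> nat \<Rightarrow> ennreal" where
  "pair_sum J g h = gsum g (\<lambda>u. gsum h (\<lambda>v. if meet_at J u v then pair_wt u v else 0))"

lemma pair_wt_commute: "pair_wt u v = pair_wt v u"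
  by (simp add: pair_wt_def mult.commute)

lemma pair_sum_commute: "pair_sum J g h = pair_sum J h g"
  unfolding pair_sum_def
  by (subst gsum_swap) (intro gsum_cong if_cong meet_at_commute pair_wt_commute refl)

lemma pair_wt_same: "pair_wt u u = (\<integral>\<^sup>+x. wt (2 * \<alpha>) u x \<partial>P)"
  unfolding pair_wt_def wt_def
  by (intro nn_integral_cong) (auto simp: ennreal_mult'[symmetric] mult_exp_exp)

text \<open>The length condition keeps \<open>u\<close> from being a proper ancestor of
  \<open>v\<close>, so the data of \<open>u\<close> are independent of both weights.\<close>

lemma pair_wt_Cons_left:
  assumes "length v \<le> length u"
  shows "pair_wt (k # u) v = pair_wt u v * (\<integral>\<^sup>+i. disc \<alpha> k i \<partial>I)"
proof -
  have "\<not> strict_suffix u v" using assms by (auto dest: strict_suffix_length)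
  then have "(\<integral>\<^sup>+x. (wt \<alpha> u x * wt \<alpha> v x) * disc \<alpha> k (x u) \<partial>P) = pair_wt u v * (\<integral>\<^sup>+i. disc \<alpha> k i \<partial>I)"
    unfolding pair_wt_def
    by (intro nn_integral_mult_individual) (auto simp: wt_update)
  then show ?thesis unfolding pair_wt_def wt_Cons by (simp add: ac_simps)
qed

lemma pair_wt_Cons_Cons:
  assumes "length u = length v" "u \<noteq> v"
  shows "pair_wt (k # u) (l # v) = pair_wt u v * (\<integral>\<^sup>+i. disc \<alpha> k i \<partial>I) * (\<integral>\<^sup>+i. disc \<alpha> l i \<partial>I)"
proof -
  have *: "\<not> strict_suffix u v" "\<not> strict_suffix v u" using assms by (auto dest: strict_suffix_length)
  have "pair_wt (k # u) (l # v)
      = (\<integral>\<^sup>+x. (wt \<alpha> u x * wt \<alpha> v x * disc \<alpha> k (x u)) * disc \<alpha> l (x v) \<partial>P)"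
    unfolding pair_wt_def wt_Cons by (simp add: ac_simps)
  also have "\<dots> = (\<integral>\<^sup>+x. wt \<alpha> u x * wt \<alpha> v x * disc \<alpha> k (x u) \<partial>P) * (\<integral>\<^sup>+i. disc \<alpha> l i \<partial>I)"
    using * assms by (intro nn_integral_mult_individual) (auto simp: wt_update)
  also have "(\<integral>\<^sup>+x. wt \<alpha> u x * wt \<alpha> v x * disc \<alpha> k (x u) \<partial>P) = pair_wt u v * (\<integral>\<^sup>+i. disc \<alpha> k i \<partial>I)"
    unfolding pair_wt_def
    using * by (intro nn_integral_mult_individual) (auto simp: wt_update)
  finally show ?thesis .
qed

text \<open>Siblings share the data of their mother, so their discounts do not factorise: this is
  where the terms of \<open>M2\<close> enter. The mother is weighted twice, hence the exponent 2
  \<alpha>.\<close>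

lemma pair_wt_siblings:
  "pair_wt (k # u) (l # u) = (\<integral>\<^sup>+x. wt (2 * \<alpha>) u x \<partial>P) * (\<integral>\<^sup>+i. disc \<alpha> k i * disc \<alpha> l i \<partial>I)"
proof -
  have "pair_wt (k # u) (l # u)
      = (\<integral>\<^sup>+x. (wt \<alpha> u x * wt \<alpha> u x) * (disc \<alpha> k (x u) * disc \<alpha> l (x u)) \<partial>P)"
    unfolding pair_wt_def wt_Cons by (simp add: ac_simps)
  also have "\<dots> = pair_wt u u * (\<integral>\<^sup>+i. disc \<alpha> k i * disc \<alpha> l i \<partial>I)"
    unfolding pair_wt_def by (intro nn_integral_mult_individual) (auto simp: wt_update)
  finally show ?thesis by (simp add: pair_wt_same)
qed

lemma suminf_disc_alpha: "(\<Sum>k. \<integral>\<^sup>+i. disc \<alpha> k i \<partial>I) = 1"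
  using suminf_disc[OF alpha_pos] by (simp add: mu_alpha)

text \<open>Lengthening the longer line is free because the mean discounted offspring at \<alpha> is
  1.\<close>

lemma pair_sum_Suc_left:
  assumes "h \<le> g" "J \<le> g"
  shows "pair_sum J (Suc g) h = pair_sum J g h"
proof -
  have "pair_sum J (Suc g) h
      = gsum g (\<lambda>u. gsum h (\<lambda>v. \<Sum>k. if meet_at J (k # u) v then pair_wt (k # u) v else 0))"
    unfolding pair_sum_def gsum_Suc gsum_suminf ..
  also have "\<dots> = pair_sum J g h"
    unfolding pair_sum_def
  proof (intro gsum_cong)
    fix u v :: label assume "length u = g" "length v = h"
    then show "(\<Sum>k. if meet_at J (k # u) v then pair_wt (k # u) v else 0)
        = (if meet_at J u v then pair_wt u v else 0)"
      using assms
      by (simp add: meet_at_Cons pair_wt_Cons_left ennreal_suminf_cmult suminf_disc_alpha)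
  qed
  finally show ?thesis .
qed

text \<open>Pairs with distinct mothers reproduce the previous sum, and pairs with the same mother
  contribute \<open>M2\<close> times a first moment with exponent 2 \<alpha>. It is an inequality
  because the diagonal terms of the previous sum are kept in the bound.\<close>

lemma pair_sum_Suc_Suc:
  assumes "J \<le> g"
  shows "pair_sum J (Suc g) (Suc g) \<le> pair_sum J g g + M2 * ennreal (mu (2 * \<alpha>) ^ g)"
proof -
  let ?D = "\<lambda>u. \<integral>\<^sup>+x. wt (2 * \<alpha>) u x \<partial>P"
  have "pair_sum J (Suc g) (Suc g) = gsum g (\<lambda>u. gsum g (\<lambda>v.
      \<Sum>l k. if meet_at J (k # u) (l # v) then pair_wt (k # u) (l # v) else 0))"
    unfolding pair_sum_def gsum_Suc gsum_suminf ..
  also have "\<dots> \<le> gsum g (\<lambda>u. gsum g (\<lambda>v. (if meet_at J u v then pair_wt u v else 0)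
      + (if u = v then ?D v * M2 else 0)))"
  proof (intro gsum_mono)
    fix u v :: label assume len: "length u = g" "length v = g"
    have m: "meet_at J (k # u) (l # v) = meet_at J u v" for k l
      using len assms by (metis meet_at_Cons meet_at_commute)
    show "(\<Sum>l k. if meet_at J (k # u) (l # v) then pair_wt (k # u) (l # v) else 0)
        \<le> (if meet_at J u v then pair_wt u v else 0) + (if u = v then ?D v * M2 else 0)"
    proof (cases "u = v")
      case True
      have "(\<Sum>l k. pair_wt (k # v) (l # v)) = (\<Sum>l k. pair_wt (l # v) (k # v))"
        by (intro suminf_cong pair_wt_commute)
      also have "\<dots> = ?D v * M2"
        by (simp add: pair_wt_siblings ennreal_suminf_cmult M2_def)
      finally have "(\<Sum>l k. pair_wt (k # v) (l # v)) = ?D v * M2" .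
      then show ?thesis unfolding m unfolding True by simp
    next
      case False
      have "(\<Sum>l k. pair_wt (k # u) (l # v)) = pair_wt u v"
        using len False
        by (simp add: pair_wt_Cons_Cons ennreal_suminf_cmult ennreal_suminf_multc suminf_disc_alpha)
      with False show ?thesis unfolding m by simp
    qed
  qed
  also have "\<dots> = pair_sum J g g + gsum g (\<lambda>u. ?D u * M2)"
    unfolding gsum_add pair_sum_def by (intro arg_cong2[where f = "(+)"] refl gsum_cong gsum_delta)
  also have "gsum g (\<lambda>u. ?D u * M2) = M2 * ennreal (mu (2 * \<alpha>) ^ g)"
    using alpha_pos gsum_wt_mu[of "2 * \<alpha>" g] by (simp only: gsum_multc mult.commute[of M2])
  finally show ?thesis .
qed

lemma pair_sum_start: "pair_sum J J J = ennreal (mu (2 * \<alpha>) ^ J)"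
proof -
  have "pair_sum J J J = gsum J (\<lambda>u. gsum J (\<lambda>v. if u = v then pair_wt u v else 0))"
    unfolding pair_sum_def by (intro gsum_cong) (simp add: meet_at_same_length)
  also have "\<dots> = gsum J (\<lambda>u. pair_wt u u)"
    by (intro gsum_cong gsum_delta)
  finally show ?thesis using alpha_pos by (simp add: pair_wt_same gsum_wt_mu)
qed

text \<open>The start value plus the geometric series of the increments in
  \<open>pair_sum_Suc_Suc\<close>, relative to \<open>mu (2 * \<alpha>) ^ J\<close>.\<close>

definition C2 :: real where "C2 = 1 + enn2real M2 / (1 - mu (2 * \<alpha>))"

lemma C2_ge_1: "C2 \<ge> 1"
  using mu_2_alpha_less_1 by (simp add: C2_def)

text \<open>Both lines grow together from generation \<open>J\<close> to the smaller of
  \<open>g\<close> and \<open>h\<close>, at the price of a geometric series beginning at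
  \<open>mu (2 * \<alpha>) ^ J\<close>; the longer line is then extended for free. If
  \<open>J\<close> exceeds \<open>g\<close> or \<open>h\<close>, no pair qualifies.\<close>

lemma pair_sum_bound: "pair_sum J g h \<le> ennreal (C2 * mu (2 * \<alpha>) ^ J)"
proof -
  let ?r = "mu (2 * \<alpha>)"
  define m where "m = enn2real M2"
  have r: "0 < ?r" "?r < 1" using mu_pos[of "2 * \<alpha>"] alpha_pos mu_2_alpha_less_1 by simp_all
  have m: "M2 = ennreal m" "m \<ge> 0" using M2_finite by (auto simp: m_def)
  have diag: "pair_sum J (J + n) (J + n) \<le> ennreal (?r ^ J + m * (\<Sum>i<n. ?r ^ (J + i)))" for n
  proof (induction n)
    case 0
    show ?case by (simp add: pair_sum_start)
  next
    case (Suc n)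
    have "pair_sum J (J + Suc n) (J + Suc n) \<le> pair_sum J (J + n) (J + n) + M2 * ennreal (?r ^ (J + n))"
      using pair_sum_Suc_Suc[of J "J + n"] by simp
    also have "\<dots> \<le> ennreal (?r ^ J + m * (\<Sum>i<n. ?r ^ (J + i))) + ennreal (m * ?r ^ (J + n))"
    proof (intro add_mono Suc)
      show "M2 * ennreal (?r ^ (J + n)) \<le> ennreal (m * ?r ^ (J + n))"
        unfolding m(1) using ennreal_mult[of m "?r ^ (J + n)"] m(2) r by simp
    qed
    also have "\<dots> = ennreal (?r ^ J + m * (\<Sum>i<Suc n. ?r ^ (J + i)))"
    proof -
      have "0 \<le> ?r ^ J + m * (\<Sum>i<n. ?r ^ (J + i))" "0 \<le> m * ?r ^ (J + n)"
        using r m(2) by (simp_all add: sum_nonneg)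
      then show ?thesis by (simp add: distrib_left add.assoc flip: ennreal_plus)
    qed
    finally show ?case .
  qed
  have diag': "pair_sum J g g \<le> ennreal (C2 * ?r ^ J)" if "J \<le> g" for g
  proof -
    from le_Suc_ex[OF that] obtain n where n: "g = J + n" ..
    have "(\<Sum>i<n. ?r ^ (J + i)) = ?r ^ J * (\<Sum>i<n. ?r ^ i)"
      by (simp add: power_add sum_distrib_left)
    moreover have "(\<Sum>i<n. ?r ^ i) \<le> 1 / (1 - ?r)"
      using r by (simp add: sum_gp_strict divide_right_mono)
    ultimately have "(\<Sum>i<n. ?r ^ (J + i)) \<le> ?r ^ J * (1 / (1 - ?r))"
      using r mult_left_mono[of "\<Sum>i<n. ?r ^ i" "1 / (1 - ?r)" "?r ^ J"] by simp
    then have "?r ^ J + m * (\<Sum>i<n. ?r ^ (J + i)) \<le> ?r ^ J + m * (?r ^ J * (1 / (1 - ?r)))"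
      using m(2) by (intro add_left_mono mult_left_mono)
    also have "\<dots> = C2 * ?r ^ J" by (simp add: C2_def m_def distrib_right)
    finally show ?thesis using diag[of n] n by (meson ennreal_leI order_trans)
  qed
  have le: "pair_sum J g h \<le> ennreal (C2 * ?r ^ J)" if "J \<le> h" "h \<le> g" for g h
    using that(2)
  proof (induction g rule: dec_induct)
    case base
    then show ?case using diag' that by simp
  next
    case (step n)
    then show ?case using that by (simp add: pair_sum_Suc_left)
  qed
  show ?thesis
  proof (cases "J \<le> g \<and> J \<le> h")
    case True
    then show ?thesis
      using le[of h g] le[of g h] pair_sum_commute[of J g h] by (cases "h \<le> g") auto
  next
    case False
    then have "pair_sum J g h = gsum g (\<lambda>u. gsum h (\<lambda>v. 0))"
      unfolding pair_sum_def by (intro gsum_cong if_not_P) (metis meet_at_le)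
    then show ?thesis by (simp add: gsum_def)
  qed
qed

section \<open>Exponential tilting and the heights in the population\<close>

abbreviation \<beta> :: real where "\<beta> \<equiv> dPsi / \<alpha>"

lemma beta_pos: "\<beta> > 0"
  using dPsi_pos alpha_pos by simp

text \<open>The function mu (\<alpha> + d) exp (d \<beta> (1 - \<epsilon>)) is 1 at d = 0 with
  derivative - \<beta> \<epsilon> < 0, and so is mu (\<alpha> - d) exp (- d \<beta> (1 +
  \<epsilon>)). Both are therefore below 1 for small d > 0: the slack \<epsilon> absorbs the error
  of the linear approximation.\<close>

lemma chernoff_delta:
  assumes "\<epsilon> > 0"
  obtains \<delta> where "\<delta> > 0" "\<delta> < \<alpha>" "mu (\<alpha> + \<delta>) \<le> exp (- \<delta> * \<beta> * (1 - \<epsilon>))"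
    "mu (\<alpha> - \<delta>) \<le> exp (\<delta> * \<beta> * (1 + \<epsilon>))"
proof -
  define B where "B = \<beta>"
  have mu': "(mu has_real_derivative - B) (at \<alpha>)"
    unfolding B_def by (rule mu_has_derivative)
  have d1: "((\<lambda>d. mu (\<alpha> + d) * exp (d * (B * (1 - \<epsilon>)))) has_real_derivative - (B * \<epsilon>)) (at 0)"
  proof -
    have "((\<lambda>d. mu (\<alpha> + d)) has_real_derivative - B * 1) (at 0)"
      using DERIV_chain2[of mu "- B" "\<lambda>d. \<alpha> + d" 0 1 UNIV] mu'
        DERIV_add[OF DERIV_const DERIV_ident, of \<alpha> 0 UNIV]
      by simp
    then show ?thesis
      by (auto intro!: derivative_eq_intros simp: mu_alpha algebra_simps)
  qed
  have d2: "((\<lambda>d. mu (\<alpha> - d) * exp (d * (- B * (1 + \<epsilon>)))) has_real_derivative - (B * \<epsilon>)) (at 0)"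
  proof -
    have "((\<lambda>d. mu (\<alpha> - d)) has_real_derivative - B * (- 1)) (at 0)"
      using DERIV_chain2[of mu "- B" "\<lambda>d. \<alpha> - d" 0 "- 1" UNIV] mu'
        DERIV_diff[OF DERIV_const DERIV_ident, of \<alpha> 0 UNIV]
      by simp
    then show ?thesis
      by (auto intro!: derivative_eq_intros simp: mu_alpha algebra_simps)
  qed
  have neg: "- (B * \<epsilon>) < 0" using mult_pos_pos[OF beta_pos assms] by (simp add: B_def)
  obtain e1 where e1: "e1 > 0" "\<And>h. 0 < h \<Longrightarrow> h < e1 \<Longrightarrow> mu (\<alpha> + h) * exp (h * (B * (1 - \<epsilon>))) < 1"
    using DERIV_neg_dec_right[OF d1 neg] by (auto simp: mu_alpha)
  obtain e2 where e2: "e2 > 0" "\<And>h. 0 < h \<Longrightarrow> h < e2 \<Longrightarrow> mu (\<alpha> - h) * exp (h * (- B * (1 + \<epsilon>))) < 1"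
    using DERIV_neg_dec_right[OF d2 neg] by (auto simp: mu_alpha)
  define \<delta> where "\<delta> = min (min e1 e2) \<alpha> / 2"
  have \<delta>: "\<delta> > 0" "\<delta> < e1" "\<delta> < e2" "\<delta> < \<alpha>" using e1(1) e2(1) alpha_pos by (auto simp: \<delta>_def)
  have "mu (\<alpha> + \<delta>) \<le> exp (- (\<delta> * (B * (1 - \<epsilon>))))"
    using e1(2)[of \<delta>] \<delta> by (subst exp_minus) (simp add: inverse_eq_divide pos_le_divide_eq)
  moreover have "mu (\<alpha> - \<delta>) \<le> exp (- (\<delta> * (- B * (1 + \<epsilon>))))"
    using e2(2)[of \<delta>] \<delta> by (subst exp_minus) (simp add: inverse_eq_divide pos_le_divide_eq)
  ultimately show thesis using \<delta> by (intro that[of \<delta>]) (simp_all add: B_def[symmetric] algebra_simps)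
qed

end

lemma gsum_cmult: "gsum g (\<lambda>u. c * f u) = c * gsum g f"
  unfolding gsum_def by (intro nn_integral_cmult) simp_all

lemma eventually_linear_ge:
  fixes c d :: real
  assumes "c > 0"
  shows "eventually (\<lambda>L. c * L \<ge> d) at_top"
  using eventually_ge_at_top[of "d / c"]
  by eventually_elim (use assms in \<open>simp add: pos_divide_le_eq mult.commute\<close>)

context cmj
begin

lemma mem_born: "u \<in> born x (ereal t) \<longleftrightarrow> exists_ind x u \<and> birth_time x u \<le> t"
  by (simp add: born_def)

lemma measurable_mem_born[measurable]: "Measurable.pred P (\<lambda>x. u \<in> born x (ereal t))"
  unfolding mem_born by measurable

text \<open>Exponential Markov inequality: a birth time s \<le> t gives 1 \<le> exp (\<theta> (t -
  s)).\<close>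

lemma indicator_born_le_wt:
  assumes "\<theta> \<ge> 0"
  shows "indicator (born x (ereal t)) u \<le> ennreal (exp (\<theta> * t)) * wt \<theta> u x"
proof (cases "u \<in> born x (ereal t)")
  case True
  then have "1 \<le> exp (\<theta> * t) * exp (- \<theta> * birth_time x u)"
    using assms by (simp add: mem_born mult_exp_exp mult_left_mono)
  then show ?thesis using True
    by (simp add: wt_def mem_born ennreal_mult'[symmetric] flip: ennreal_1)
qed simp

lemma expected_born_le:
  assumes "\<theta> > 0"
  shows "gsum k (\<lambda>u. emeasure P {x \<in> space P. u \<in> born x (ereal t)}) \<le> ennreal (exp (\<theta> * t) * mu \<theta> ^ k)"
proof -
  have "emeasure P {x \<in> space P. u \<in> born x (ereal t)} \<le> ennreal (exp (\<theta> * t)) * (\<integral>\<^sup>+x. wt \<theta> u x \<partial>P)" for u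
  proof -
    have "emeasure P {x \<in> space P. u \<in> born x (ereal t)} = (\<integral>\<^sup>+x. indicator {x \<in> space P. u \<in> born x (ereal t)} x \<partial>P)"
      by (rule nn_integral_indicator[symmetric]) measurable
    also have "\<dots> \<le> (\<integral>\<^sup>+x. ennreal (exp (\<theta> * t)) * wt \<theta> u x \<partial>P)"
    proof (rule nn_integral_mono)
      fix x
      show "indicator {x \<in> space P. u \<in> born x (ereal t)} x \<le> ennreal (exp (\<theta> * t)) * wt \<theta> u x"
        using indicator_born_le_wt[of \<theta> x t u] assms by (auto simp: indicator_def)
    qed
    also have "\<dots> = ennreal (exp (\<theta> * t)) * (\<integral>\<^sup>+x. wt \<theta> u x \<partial>P)"
      by (rule nn_integral_cmult) measurable
    finally show ?thesis .
  qed
  then have "gsum k (\<lambda>u. emeasure P {x \<in> space P. u \<in> born x (ereal t)})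
      \<le> gsum k (\<lambda>u. ennreal (exp (\<theta> * t)) * (\<integral>\<^sup>+x. wt \<theta> u x \<partial>P))"
    by (intro gsum_mono)
  also have "\<dots> = ennreal (exp (\<theta> * t)) * ennreal (mu \<theta> ^ k)"
    by (simp only: gsum_cmult gsum_wt_mu[OF assms])
  also have "\<dots> = ennreal (exp (\<theta> * t) * mu \<theta> ^ k)"
    by (rule ennreal_mult'[symmetric]) simp
  finally show ?thesis .
qed

lemma expected_born_pairs_le:
  "gsum g (\<lambda>u. gsum h (\<lambda>v. if meet_at J u v
      then emeasure P {x \<in> space P. u \<in> born x (ereal t) \<and> v \<in> born x (ereal t)} else 0))
    \<le> ennreal (exp (2 * \<alpha> * t) * (C2 * mu (2 * \<alpha>) ^ J))"
proof -
  let ?e = "ennreal (exp (\<alpha> * t))"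
  have "emeasure P {x \<in> space P. u \<in> born x (ereal t) \<and> v \<in> born x (ereal t)} \<le> ?e * ?e * pair_wt u v" for u v
  proof -
    have "emeasure P {x \<in> space P. u \<in> born x (ereal t) \<and> v \<in> born x (ereal t)}
        = (\<integral>\<^sup>+x. indicator {x \<in> space P. u \<in> born x (ereal t) \<and> v \<in> born x (ereal t)} x \<partial>P)"
      by (rule nn_integral_indicator[symmetric]) measurable
    also have "\<dots> \<le> (\<integral>\<^sup>+x. (?e * ?e) * (wt \<alpha> u x * wt \<alpha> v x) \<partial>P)"
    proof (rule nn_integral_mono)
      fix x
      have "indicator {x \<in> space P. u \<in> born x (ereal t) \<and> v \<in> born x (ereal t)} x
          \<le> indicator (born x (ereal t)) u * (indicator (born x (ereal t)) v :: ennreal)"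
        by (auto simp: indicator_def)
      also have "\<dots> \<le> (?e * wt \<alpha> u x) * (?e * wt \<alpha> v x)"
        using alpha_pos by (intro mult_mono indicator_born_le_wt) auto
      finally show "indicator {x \<in> space P. u \<in> born x (ereal t) \<and> v \<in> born x (ereal t)} x
          \<le> (?e * ?e) * (wt \<alpha> u x * wt \<alpha> v x)"
        by (simp only: ac_simps)
    qed
    also have "\<dots> = ?e * ?e * pair_wt u v"
      unfolding pair_wt_def by (rule nn_integral_cmult) measurable
    finally show ?thesis .
  qed
  then have "gsum g (\<lambda>u. gsum h (\<lambda>v. if meet_at J u v
      then emeasure P {x \<in> space P. u \<in> born x (ereal t) \<and> v \<in> born x (ereal t)} else 0))
    \<le> gsum g (\<lambda>u. gsum h (\<lambda>v. ?e * ?e * (if meet_at J u v then pair_wt u v else 0)))"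
    by (intro gsum_mono) auto
  also have "\<dots> = ?e * ?e * pair_sum J g h"
    unfolding pair_sum_def gsum_cmult ..
  also have "\<dots> \<le> ?e * ?e * ennreal (C2 * mu (2 * \<alpha>) ^ J)"
    by (intro mult_left_mono pair_sum_bound) simp
  also have "?e * ?e = ennreal (exp (2 * \<alpha> * t))"
    by (simp add: mult_exp_exp flip: ennreal_mult')
  also have "ennreal (exp (2 * \<alpha> * t)) * ennreal (C2 * mu (2 * \<alpha>) ^ J) = ennreal (exp (2 * \<alpha> * t) * (C2 * mu (2 * \<alpha>) ^ J))"
    by (rule ennreal_mult'[symmetric]) simp
  finally show ?thesis .
qed

lemma suminf_geometric_ennreal:
  fixes q c :: real
  assumes "0 \<le> q" "q < 1" "0 \<le> c"
  shows "(\<Sum>k. ennreal (c * q ^ k)) = ennreal (c * (1 / (1 - q)))"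
proof -
  have "(\<lambda>k. c * q ^ k) sums (c * (1 / (1 - q)))"
    using assms by (intro sums_mult geometric_sums) simp
  then show ?thesis
    using assms by (subst suminf_ennreal2) (auto simp: sums_iff)
qed

text \<open>A height off by \<epsilon> L gains \<delta> B \<epsilon> L = 4 \<gamma> L in the
  exponent after tilting by \<delta>. The enlarged time takes at most \<gamma> L of this and the
  slack \<open>e\<close> takes 2 \<gamma> L, so \<gamma> L is left. A factor \<open>q ^ k\<close> is
  set aside to make the sum over generations converge.\<close>

lemma expected_bad_heights_le:
  assumes \<epsilon>: "\<epsilon> > 0"
  obtains \<eta>0 \<gamma> C where "\<eta>0 > 0" "\<gamma> > 0" "C > 0"
    "\<And>L. L \<ge> 0 \<Longrightarrow> (\<Sum>k. if \<bar>real k - L / dPsi\<bar> > \<epsilon> * L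
        then gsum k (\<lambda>u. emeasure P {x \<in> space P. u \<in> born x (ereal ((1 + \<eta>0) * L / \<alpha>))}) else 0)
      \<le> ennreal (C * exp ((1 - \<gamma>) * L))"
proof -
  define B where "B = \<beta>"
  have B: "B > 0" unfolding B_def by (rule beta_pos)
  have a: "1 / dPsi = 1 / (\<alpha> * B)" using alpha_pos by (simp add: B_def)
  \<comment> \<open>Twice the slack, at the height where \<open>\<epsilon> * L\<close> is exceeded,
    should cost half of the gain. It is paid twice: once for the error in the bound on
    \<open>mu\<close>, once for the factor \<open>q ^ k\<close>.\<close>
  define e where "e = B * \<epsilon> / (4 * (1 / \<alpha> + B * \<epsilon>))"
  have den: "1 / \<alpha> + B * \<epsilon> > 0" using B \<epsilon> alpha_pos by (simp add: add_pos_pos)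
  have "e > 0" "4 * (e * D) = B * \<epsilon>" if "D > 0" "e = B * \<epsilon> / (4 * D)" for D
    using B \<epsilon> that by (simp_all add: that(2))
  from this[OF den e_def] have e: "e > 0" "4 * (e * (1 / \<alpha> + B * \<epsilon>)) = B * \<epsilon>" .
  obtain \<delta> where \<delta>: "\<delta> > 0" "\<delta> < \<alpha>" and mu1: "mu (\<alpha> + \<delta>) \<le> exp (- \<delta> * B * (1 - e))"
    and mu2: "mu (\<alpha> - \<delta>) \<le> exp (\<delta> * B * (1 + e))"
    using chernoff_delta[OF e(1)] unfolding B_def by metis
  define \<gamma> where "\<gamma> = \<delta> * B * \<epsilon> / 4"
  \<comment> \<open>Under the exponent \<open>\<alpha> + \<delta>\<close> the additional time
    \<open>\<eta> * L / \<alpha>\<close> costs exactly \<open>\<gamma> * L\<close>.\<close>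
  define \<eta> where "\<eta> = \<gamma> / (1 + \<delta> / \<alpha>)"
  define q where "q = exp (- \<delta> * B * e)"
  have \<gamma>: "\<gamma> > 0" using \<delta> B \<epsilon> by (simp add: \<gamma>_def)
  have d1: "1 + \<delta> / \<alpha> > 0" using \<delta> alpha_pos by (simp add: add_pos_pos)
  have \<eta>: "\<eta> > 0" "\<eta> * (1 + \<delta> / \<alpha>) = \<gamma>" using \<gamma> d1 by (auto simp: \<eta>_def)
  have q: "0 < q" "q < 1" using \<delta> B e by (auto simp: q_def)
  have eB: "\<delta> * (4 * (e * (1 / \<alpha> + B * \<epsilon>))) = \<delta> * (B * \<epsilon>)" using e(2) by simp
  have key: "(if \<bar>real k - L / dPsi\<bar> > \<epsilon> * L
        then gsum k (\<lambda>u. emeasure P {x \<in> space P. u \<in> born x (ereal ((1 + \<eta>) * L / \<alpha>))}) else 0)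
      \<le> ennreal (exp ((1 - \<gamma>) * L) * q ^ k)" if L: "L \<ge> 0" for L k
  proof (cases "\<bar>real k - L / dPsi\<bar> > \<epsilon> * L")
    case False
    then show ?thesis by simp
  next
    case True
    let ?t = "(1 + \<eta>) * L / \<alpha>"
    have aL: "L / dPsi = L / (\<alpha> * B)" using alpha_pos by (simp add: B_def)
    define A E where "A = \<delta> * B * real k" and "E = \<delta> * B * e * real k"
    have AE: "real k * (- \<delta> * B * (1 - e)) = E - A" "real k * (- \<delta> * B * e) = - E" "real k * (\<delta> * B * (1 + e)) = A + E"
      by (simp_all add: A_def E_def algebra_simps)
    have eB': "2 * (\<delta> * (e * (1 / \<alpha> + B * \<epsilon>))) = 2 * \<gamma>" "\<delta> * B * \<epsilon> = 4 * \<gamma>"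
      using eB by (simp_all add: \<gamma>_def)
    from True consider (high) "real k > L / (\<alpha> * B) + \<epsilon> * L" | (low) "real k < L / (\<alpha> * B) - \<epsilon> * L"
      unfolding aL by linarith
    \<comment> \<open>For large \<open>k\<close> the exponent is raised, since the power of
      \<open>mu\<close> then decays faster; for small \<open>k\<close> it is lowered, since the
      factor exp (\<theta> t) shrinks while the power of \<open>mu\<close> has not grown enough to
      compensate.\<close>
    then have "\<exists>\<theta>>0. exp (\<theta> * ?t) * mu \<theta> ^ k \<le> exp ((1 - \<gamma>) * L) * q ^ k"
    proof cases
      case high
      have "mu (\<alpha> + \<delta>) ^ k \<le> exp (- \<delta> * B * (1 - e)) ^ k"
        using mu1 mu_pos[of "\<alpha> + \<delta>"] alpha_pos \<delta> by (intro power_mono) auto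
      then have "exp ((\<alpha> + \<delta>) * ?t) * mu (\<alpha> + \<delta>) ^ k \<le> exp ((\<alpha> + \<delta>) * ?t + real k * (- \<delta> * B * (1 - e)))"
        unfolding exp_add exp_of_nat_mult by (rule mult_left_mono) simp
      also have "\<dots> \<le> exp ((1 - \<gamma>) * L + real k * (- \<delta> * B * e))"
      proof -
        have "1 - 2 * e > 0"
        proof -
          have "4 * (e * (B * \<epsilon>)) < B * \<epsilon>" 
            using e alpha_pos by (smt (verit, best) distrib_left divide_pos_pos mult_pos_pos)
          then have "4 * e < 1" using B \<epsilon> by (simp add: mult.assoc[symmetric])
          then show ?thesis by simp
        qed
        then have "\<delta> * B * (1 - 2 * e) * (L / (\<alpha> * B) + \<epsilon> * L) \<le> \<delta> * B * (1 - 2 * e) * real k"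
          using high \<delta> B by (intro mult_left_mono) auto
        moreover have "\<delta> * B * (1 - 2 * e) * real k = A - 2 * E"
          by (simp add: A_def E_def algebra_simps)
        moreover have "(\<alpha> + \<delta>) * ?t = L + (\<delta> / \<alpha>) * L + (\<eta> * (1 + \<delta> / \<alpha>)) * L"
          using alpha_pos by (simp add: field_simps)
        moreover have "\<delta> * B * (1 - 2 * e) * (L / (\<alpha> * B) + \<epsilon> * L)
            = (\<delta> / \<alpha>) * L + (\<delta> * B * \<epsilon>) * L - 2 * (\<delta> * (e * (1 / \<alpha> + B * \<epsilon>))) * L"
          using alpha_pos B by (simp add: field_simps)
        ultimately have h: "(\<delta> / \<alpha>) * L + 2 * (\<gamma> * L) \<le> A - 2 * E"
            and t: "(\<alpha> + \<delta>) * ?t = L + (\<delta> / \<alpha>) * L + \<gamma> * L"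
          unfolding \<eta>(2) eB' by linarith+
        from h have "L + (\<delta> / \<alpha>) * L + \<gamma> * L + (E - A) \<le> (1 - \<gamma>) * L + - E"
          unfolding left_diff_distrib by linarith
        then show ?thesis unfolding AE t by (simp only: exp_le_cancel_iff)
      qed
      also have "\<dots> = exp ((1 - \<gamma>) * L) * q ^ k"
        by (simp only: exp_add exp_of_nat_mult q_def)
      finally show ?thesis using alpha_pos \<delta> by (intro exI[of _ "\<alpha> + \<delta>"]) auto
    next
      case low
      have "mu (\<alpha> - \<delta>) ^ k \<le> exp (\<delta> * B * (1 + e)) ^ k"
        using mu2 mu_pos[of "\<alpha> - \<delta>"] alpha_pos \<delta> by (intro power_mono) auto
      then have "exp ((\<alpha> - \<delta>) * ?t) * mu (\<alpha> - \<delta>) ^ k \<le> exp ((\<alpha> - \<delta>) * ?t + real k * (\<delta> * B * (1 + e)))"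
        unfolding exp_add exp_of_nat_mult by (rule mult_left_mono) simp
      also have "\<dots> \<le> exp ((1 - \<gamma>) * L + real k * (- \<delta> * B * e))"
      proof -
        have "\<delta> * B * (1 + 2 * e) * real k \<le> \<delta> * B * (1 + 2 * e) * (L / (\<alpha> * B) - \<epsilon> * L)"
          using low \<delta> B e by (intro mult_left_mono) auto
        moreover have "\<delta> * B * (1 + 2 * e) * real k = A + 2 * E"
          by (simp add: A_def E_def algebra_simps)
        moreover have "(\<alpha> - \<delta>) * ?t = L - (\<delta> / \<alpha>) * L + (\<eta> * (1 + \<delta> / \<alpha>)) * L - 2 * \<eta> * (\<delta> / \<alpha>) * L"
          using alpha_pos by (simp add: field_simps)
        moreover have "2 * \<eta> * (\<delta> / \<alpha>) * L \<ge> 0" using \<eta> \<delta> alpha_pos L by simp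
        moreover have "\<delta> * B * (1 + 2 * e) * (L / (\<alpha> * B) - \<epsilon> * L)
            = (\<delta> / \<alpha>) * L - (\<delta> * B * \<epsilon>) * L + 2 * (\<delta> * (e * (1 / \<alpha> + B * \<epsilon>))) * L - 4 * (\<delta> * e * B * \<epsilon> * L)"
          using alpha_pos B by (simp add: field_simps)
        moreover have "\<delta> * e * B * \<epsilon> * L \<ge> 0" using \<delta> e B \<epsilon> L by simp
        ultimately have h: "A + 2 * E \<le> (\<delta> / \<alpha>) * L - 2 * (\<gamma> * L)"
            and t: "(\<alpha> - \<delta>) * ?t \<le> L - (\<delta> / \<alpha>) * L + \<gamma> * L"
          unfolding \<eta>(2) eB' by linarith+
        from h t have "(\<alpha> - \<delta>) * ?t + (A + E) \<le> (1 - \<gamma>) * L + - E"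
          unfolding left_diff_distrib by linarith
        then show ?thesis unfolding AE by (simp only: exp_le_cancel_iff)
      qed
      also have "\<dots> = exp ((1 - \<gamma>) * L) * q ^ k"
        by (simp only: exp_add exp_of_nat_mult q_def)
      finally show ?thesis using alpha_pos \<delta> by (intro exI[of _ "\<alpha> - \<delta>"]) auto
    qed
    then obtain \<theta> where "\<theta> > 0" "exp (\<theta> * ?t) * mu \<theta> ^ k \<le> exp ((1 - \<gamma>) * L) * q ^ k" by blast
    from order_trans[OF expected_born_le[OF this(1)] ennreal_leI[OF this(2)]]
    show ?thesis unfolding if_P[OF True] .
  qed
  show thesis
  proof (rule that)
    show "\<eta> > 0" "\<gamma> > 0" "1 / (1 - q) > 0" using \<eta> \<gamma> q by auto
    fix L :: real assume "L \<ge> 0"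
    then have "(\<Sum>k. if \<bar>real k - L / dPsi\<bar> > \<epsilon> * L
        then gsum k (\<lambda>u. emeasure P {x \<in> space P. u \<in> born x (ereal ((1 + \<eta>) * L / \<alpha>))}) else 0)
      \<le> (\<Sum>k. ennreal (exp ((1 - \<gamma>) * L) * q ^ k))"
      by (intro suminf_le key) auto
    also have "\<dots> = ennreal (1 / (1 - q) * exp ((1 - \<gamma>) * L))"
      using q by (subst suminf_geometric_ennreal) (auto simp: mult.commute)
    finally show "(\<Sum>k. if \<bar>real k - L / dPsi\<bar> > \<epsilon> * L
        then gsum k (\<lambda>u. emeasure P {x \<in> space P. u \<in> born x (ereal ((1 + \<eta>) * L / \<alpha>))}) else 0)
      \<le> ennreal (1 / (1 - q) * exp ((1 - \<gamma>) * L))" .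
  qed
qed

end

section \<open>A lower bound for the population by second moments\<close>

text \<open>A Paley-Zygmund bound obtained by integrating one pointwise inequality: a value y is at
  most 1/4 below the threshold, and at most y^2 / (4 C) + C above it by the arithmetic-geometric
  mean inequality. Integration gives 3/4 \<le> 1/4 + 1/4 + C * prob.\<close>

lemma (in prob_space) second_moment_lower_bound:
  fixes Y :: "'a \<Rightarrow> ennreal" and C :: real
  assumes [measurable]: "Y \<in> borel_measurable M" and C: "C \<ge> 1"
    and m1: "(\<integral>\<^sup>+x. Y x \<partial>M) \<ge> ennreal (3 / 4)" and m2: "(\<integral>\<^sup>+x. Y x * Y x \<partial>M) \<le> ennreal C"
  shows "prob {x \<in> space M. Y x \<ge> ennreal (1 / 4)} \<ge> 1 / (4 * C)"
proof -
  let ?A = "{x \<in> space M. Y x \<ge> ennreal (1 / 4)}"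
  have A: "?A \<in> sets M" by measurable
  have point: "Y x \<le> ennreal (1 / 4) + ennreal (1 / (4 * C)) * (Y x * Y x) + ennreal C * indicator ?A x" if "x \<in> space M" for x
  proof (cases "Y x")
    case (real y)
    show ?thesis
    proof (cases "y \<ge> 1 / 4")
      case True
      then have ind: "indicator ?A x = (1 :: ennreal)"
        using that real by (auto simp: indicator_def intro!: ennreal_leI)
      have "0 \<le> (y - 2 * C)\<^sup>2" by simp
      then have "4 * C * y \<le> y * y + 4 * C * C" by (simp add: power2_eq_square algebra_simps)
      then have "y \<le> 1 / (4 * C) * (y * y) + C" using C by (simp add: field_simps)
      then have "ennreal y \<le> ennreal (1 / 4 + 1 / (4 * C) * (y * y) + C)" by (intro ennreal_leI) simp
      also have "ennreal (1 / 4 + 1 / (4 * C) * (y * y) + C) = ennreal (1 / 4) + ennreal (1 / (4 * C)) * (ennreal y * ennreal y) + ennreal C"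
      proof -
        have "ennreal (1 / (4 * C) * (y * y)) = ennreal (1 / (4 * C)) * (ennreal y * ennreal y)"
          using ennreal_mult[of "1 / (4 * C)" "y * y"] ennreal_mult[of y y] C real by simp
        moreover have "0 \<le> 1 / (4 * C) * (y * y)" using C real by simp
        moreover have "ennreal (1 / 4 + z + C) = ennreal (1 / 4) + ennreal z + ennreal C" if "z \<ge> 0" for z
          using that C ennreal_plus[of "1 / 4" z] ennreal_plus[of "1 / 4 + z" C] by simp
        ultimately show ?thesis by (simp only:)
      qed
      finally show ?thesis using real ind by simp
    next
      case False
      then have "ennreal y \<le> ennreal (1 / 4)" by (intro ennreal_leI) simp
      then show ?thesis using real by (simp add: add_increasing2 add.assoc)
    qed
  next
    case top
    then show ?thesis using C by (simp add: ennreal_mult_eq_top_iff ennreal_mult_top)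
  qed
  have "ennreal (3 / 4) \<le> (\<integral>\<^sup>+x. ennreal (1 / 4) + ennreal (1 / (4 * C)) * (Y x * Y x) + ennreal C * indicator ?A x \<partial>M)"
    using m1 by (rule order_trans) (intro nn_integral_mono point)
  also have "\<dots> = ennreal (1 / 4) + ennreal (1 / (4 * C)) * (\<integral>\<^sup>+x. Y x * Y x \<partial>M) + ennreal C * emeasure M ?A"
    by (simp add: nn_integral_add nn_integral_cmult emeasure_space_1)
  also have "\<dots> \<le> ennreal (1 / 4) + ennreal (1 / (4 * C)) * ennreal C + ennreal C * emeasure M ?A"
    by (intro add_mono mult_left_mono m2) auto
  also have "\<dots> = ennreal (1 / 4 + 1 / 4 + C * prob ?A)"
  proof -
    have "ennreal (1 / (4 * C)) * ennreal C = ennreal (1 / 4)"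
      using C by (simp flip: ennreal_mult')
    moreover have "ennreal C * emeasure M ?A = ennreal (C * prob ?A)"
      using C by (simp add: emeasure_eq_measure ennreal_mult')
    moreover have "ennreal (1 / 4 + 1 / 4 + C * prob ?A) = ennreal (1 / 4 + 1 / 4) + ennreal (C * prob ?A)"
      by (rule ennreal_plus) (use C in auto)
    moreover have "ennreal (1 / 4 + 1 / 4) = ennreal (1 / 4) + ennreal (1 / 4)"
      by (rule ennreal_plus) auto
    ultimately show ?thesis by simp
  qed
  finally have "3 / 4 \<le> 1 / 4 + 1 / 4 + C * prob ?A"
    using C by (subst (asm) ennreal_le_iff) auto
  then show ?thesis using C by (simp add: field_simps)
qed

context cmj
begin

lemma measurable_population[measurable]:
  "(\<lambda>x. emeasure (count_space UNIV) (born x (ereal t))) \<in> borel_measurable P"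
proof -
  interpret A: sigma_finite_measure "count_space (UNIV :: label set)"
    by (rule sigma_finite_measure_count_space_countable) simp
  have "case_prod (\<lambda>x u. indicator (born x (ereal t)) u :: ennreal) \<in> borel_measurable (P \<Otimes>\<^sub>M count_space UNIV)"
    using measurable_pair_swap[OF measurable_pair_measure_countable1[of UNIV "\<lambda>(u, x). indicator (born x (ereal t)) u" P "borel :: ennreal measure"]]
    by (simp add: indicator_def)
  from A.borel_measurable_nn_integral[OF this]
  show ?thesis by simp
qed

text \<open>The bound \<open>q\<close> precedes \<eta>: it is 1 / (4 C2), from a second moment that
  does not involve \<eta>. At exponent \<alpha> the weights of generation g are carried by birth
  times near B g, and discarding the others costs an exponentially small mean. In the truncated sum
  each weight is at most exp (- \<alpha> (B - e) g), so a value of at least 1/4 forces at least exp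
  (\<alpha> (B - e) g) / 4 individuals born by time (B + e) g.\<close>

lemma prob_population_large:
  obtains q where "q > 0"
    "\<And>\<eta>. \<eta> > 0 \<Longrightarrow> eventually (\<lambda>L. P.prob {x \<in> space P.
        emeasure (count_space UNIV) (born x (ereal ((1 + \<eta>) * L / \<alpha>))) \<ge> ennreal (exp L)} \<ge> q) at_top"
proof (rule that)
  show "1 / (4 * C2) > 0" using C2_ge_1 by simp
next
  fix \<eta> :: real assume \<eta>: "\<eta> > 0"
  define B where "B = \<beta>"
  have B: "B > 0" unfolding B_def by (rule beta_pos)
  \<comment> \<open>The margins \<open>c1\<close> and \<open>c2\<close> below rest on
    \<open>e * (1 + \<eta> / 2) < B * \<eta> / 4\<close>.\<close>
  define e where "e = B * \<eta> / (8 * (1 + \<eta>))"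
  have e: "e > 0" using B \<eta> by (simp add: e_def)
  have eB: "e * (1 + \<eta>) = B * \<eta> / 8" using \<eta> by (simp add: e_def field_simps)
  have e2: "e * (1 + \<eta> / 2) < B * \<eta> / 4" "e * (1 + \<eta> / 2) > 0"
  proof -
    have "e * (1 + \<eta> / 2) \<le> e * (1 + \<eta>)" using e \<eta> by (intro mult_left_mono) auto
    also have "\<dots> < B * \<eta> / 4" unfolding eB using mult_pos_pos[OF B \<eta>] by simp
    finally show "e * (1 + \<eta> / 2) < B * \<eta> / 4" .
    show "e * (1 + \<eta> / 2) > 0" using e \<eta> by simp
  qed
  \<comment> \<open>Half of the deviation \<open>e\<close> pays for the error in the bounds on
    \<open>mu\<close>; the other half is the decay rate in \<open>rem\<close>.\<close>
  define e' where "e' = e / (2 * B)"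
  have e': "e' > 0" "B * e' = e / 2" using e B by (auto simp: e'_def)
  obtain \<delta> where \<delta>: "\<delta> > 0" "\<delta> < \<alpha>" and mu1: "mu (\<alpha> + \<delta>) \<le> exp (- \<delta> * B * (1 - e'))"
    and mu2: "mu (\<alpha> - \<delta>) \<le> exp (\<delta> * B * (1 + e'))"
    using chernoff_delta[OF e'(1)] unfolding B_def by metis
  define good where "good g u x \<longleftrightarrow> (B - e) * real g \<le> birth_time x u \<and> birth_time x u \<le> (B + e) * real g" for g u x
  have [measurable]: "Measurable.pred P (good g u)" for g u unfolding good_def by measurable
  define Y where "Y g x = gsum g (\<lambda>u. if good g u x then wt \<alpha> u x else 0)" for g x
  have Y[measurable]: "Y g \<in> borel_measurable P" for g
    unfolding Y_def by (intro borel_measurable_gsum) measurable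
  define rem where "rem g = exp (- (\<delta> * e / 2) * real g)" for g :: nat
  have Y1: "(\<integral>\<^sup>+x. Y g x \<partial>P) + ennreal (rem g) + ennreal (rem g) \<ge> 1" for g
  proof -
    let ?low = "\<lambda>u x. ennreal (exp (\<delta> * (B - e) * real g)) * wt (\<alpha> + \<delta>) u x"
    let ?high = "\<lambda>u x. ennreal (exp (- \<delta> * (B + e) * real g)) * wt (\<alpha> - \<delta>) u x"
    \<comment> \<open>For a birth that is too early the factor separating \<open>?low\<close> from
      the weight is at least 1, and likewise \<open>?high\<close> for a birth that is too
      late.\<close>
    have "wt \<alpha> u x \<le> (if good g u x then wt \<alpha> u x else 0) + ?low u x + ?high u x" for u x
    proof (cases "good g u x \<or> \<not> exists_ind x u")
      case True
      then show ?thesis by (auto simp: wt_def add.assoc)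
    next
      case False
      let ?s = "birth_time x u"
      from False consider "?s < (B - e) * real g" | "?s > (B + e) * real g"
        by (auto simp: good_def)
      then show ?thesis
      proof cases
        case 1
        have "\<delta> * ?s \<le> \<delta> * ((B - e) * real g)" using 1 \<delta> by (intro mult_left_mono) auto
        then have "exp (- \<alpha> * ?s) \<le> exp (\<delta> * (B - e) * real g) * exp (- (\<alpha> + \<delta>) * ?s)"
          by (simp add: mult_exp_exp algebra_simps)
        then have "wt \<alpha> u x \<le> ?low u x"
          using False by (simp add: wt_def flip: ennreal_mult')
        then show ?thesis by (meson add_increasing add_increasing2 zero_le)
      next
        case 2
        have "\<delta> * ((B + e) * real g) \<le> \<delta> * ?s" using 2 \<delta> by (intro mult_left_mono) auto
        then have "exp (- \<alpha> * ?s) \<le> exp (- \<delta> * (B + e) * real g) * exp (- (\<alpha> - \<delta>) * ?s)"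
          by (simp add: mult_exp_exp algebra_simps)
        then have "wt \<alpha> u x \<le> ?high u x"
          using False by (simp add: wt_def flip: ennreal_mult')
        then show ?thesis by (meson add_increasing zero_le)
      qed
    qed
    then have "(\<integral>\<^sup>+x. gsum g (\<lambda>u. wt \<alpha> u x) \<partial>P)
        \<le> (\<integral>\<^sup>+x. gsum g (\<lambda>u. (if good g u x then wt \<alpha> u x else 0) + ?low u x + ?high u x) \<partial>P)"
      by (intro nn_integral_mono gsum_mono)
    also have "\<dots> = (\<integral>\<^sup>+x. Y g x \<partial>P) + (\<integral>\<^sup>+x. gsum g (\<lambda>u. ?low u x) \<partial>P) + (\<integral>\<^sup>+x. gsum g (\<lambda>u. ?high u x) \<partial>P)"
    proof -
      have "(\<lambda>x. gsum g (\<lambda>u. ?low u x)) \<in> borel_measurable P"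
        by (intro borel_measurable_gsum) measurable
      moreover have "(\<lambda>x. gsum g (\<lambda>u. ?high u x)) \<in> borel_measurable P"
        by (intro borel_measurable_gsum) measurable
      ultimately show ?thesis
        unfolding gsum_add Y_def[symmetric] using Y[of g] by (simp add: nn_integral_add)
    qed
    also have "(\<integral>\<^sup>+x. gsum g (\<lambda>u. ?low u x) \<partial>P) \<le> ennreal (rem g)"
    proof -
      have "(\<integral>\<^sup>+x. gsum g (\<lambda>u. ?low u x) \<partial>P) = gsum g (\<lambda>u. \<integral>\<^sup>+x. ?low u x \<partial>P)"
        by (intro nn_integral_gsum) (auto intro: P.sigma_finite_measure_axioms)
      also have "\<dots> = gsum g (\<lambda>u. ennreal (exp (\<delta> * (B - e) * real g)) * (\<integral>\<^sup>+x. wt (\<alpha> + \<delta>) u x \<partial>P))"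
        by (intro gsum_cong nn_integral_cmult) measurable
      also have "\<dots> = ennreal (exp (\<delta> * (B - e) * real g)) * ennreal (mu (\<alpha> + \<delta>) ^ g)"
        using \<delta> alpha_pos gsum_wt_mu[of "\<alpha> + \<delta>" g] by (simp only: gsum_cmult)
      also have "\<dots> \<le> ennreal (exp (\<delta> * (B - e) * real g)) * ennreal (exp (- \<delta> * B * (1 - e')) ^ g)"
        using mu1 mu_pos[of "\<alpha> + \<delta>"] \<delta> alpha_pos
        by (intro mult_left_mono ennreal_leI power_mono) auto
      also have "\<dots> = ennreal (rem g)"
      proof -
        have "\<delta> * (B - e) * real g + real g * (- \<delta> * B * (1 - e')) = - (\<delta> * e / 2) * real g"
        proof -
          have "\<delta> * (B - e) * real g + real g * (- \<delta> * B * (1 - e')) = \<delta> * real g * (B * e' - e)"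
            by (simp add: algebra_simps)
          then show ?thesis using e'(2) by simp
        qed
        then show ?thesis unfolding rem_def by (simp only: mult_exp_exp exp_of_nat_mult[symmetric] ennreal_mult'[symmetric] exp_ge_zero)
      qed
      finally show ?thesis .
    qed
    also have "(\<integral>\<^sup>+x. gsum g (\<lambda>u. ?high u x) \<partial>P) \<le> ennreal (rem g)"
    proof -
      have "(\<integral>\<^sup>+x. gsum g (\<lambda>u. ?high u x) \<partial>P) = gsum g (\<lambda>u. \<integral>\<^sup>+x. ?high u x \<partial>P)"
        by (intro nn_integral_gsum) (auto intro: P.sigma_finite_measure_axioms)
      also have "\<dots> = gsum g (\<lambda>u. ennreal (exp (- \<delta> * (B + e) * real g)) * (\<integral>\<^sup>+x. wt (\<alpha> - \<delta>) u x \<partial>P))"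
        by (intro gsum_cong nn_integral_cmult) measurable
      also have "\<dots> = ennreal (exp (- \<delta> * (B + e) * real g)) * ennreal (mu (\<alpha> - \<delta>) ^ g)"
        using \<delta> alpha_pos gsum_wt_mu[of "\<alpha> - \<delta>" g] by (simp only: gsum_cmult)
      also have "\<dots> \<le> ennreal (exp (- \<delta> * (B + e) * real g)) * ennreal (exp (\<delta> * B * (1 + e')) ^ g)"
        using mu2 mu_pos[of "\<alpha> - \<delta>"] \<delta> alpha_pos
        by (intro mult_left_mono ennreal_leI power_mono) auto
      also have "\<dots> = ennreal (rem g)"
      proof -
        have "- \<delta> * (B + e) * real g + real g * (\<delta> * B * (1 + e')) = - (\<delta> * e / 2) * real g"
        proof -
          have "- \<delta> * (B + e) * real g + real g * (\<delta> * B * (1 + e')) = \<delta> * real g * (B * e' - e)"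
            by (simp add: algebra_simps)
          then show ?thesis using e'(2) by simp
        qed
        then show ?thesis unfolding rem_def by (simp only: mult_exp_exp exp_of_nat_mult[symmetric] ennreal_mult'[symmetric] exp_ge_zero)
      qed
      finally show ?thesis .
    qed
    also have "(\<integral>\<^sup>+x. gsum g (\<lambda>u. wt \<alpha> u x) \<partial>P) = 1"
      using gsum_wt_mu[OF alpha_pos, of g]
      by (subst nn_integral_gsum) (auto intro: P.sigma_finite_measure_axioms simp: mu_alpha)
    finally show ?thesis by (simp add: add_left_mono)
  qed
  have Y2: "(\<integral>\<^sup>+x. Y g x * Y g x \<partial>P) \<le> ennreal C2" for g
  proof -
    let ?S = "\<lambda>x. gsum g (\<lambda>u. wt \<alpha> u x)"
    have "Y g x \<le> ?S x" for x unfolding Y_def by (intro gsum_mono) auto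
    then have "(\<integral>\<^sup>+x. Y g x * Y g x \<partial>P) \<le> (\<integral>\<^sup>+x. ?S x * ?S x \<partial>P)"
      by (intro nn_integral_mono mult_mono) auto
    also have "\<dots> = (\<integral>\<^sup>+x. gsum g (\<lambda>u. gsum g (\<lambda>v. wt \<alpha> u x * wt \<alpha> v x)) \<partial>P)"
      by (simp only: gsum_cmult gsum_multc)
    also have "\<dots> = gsum g (\<lambda>u. gsum g (\<lambda>v. pair_wt u v))"
      unfolding pair_wt_def
      by (subst nn_integral_gsum, (auto intro!: borel_measurable_gsum P.sigma_finite_measure_axioms)[2])+ simp
    also have "\<dots> = pair_sum 0 g g"
      unfolding pair_sum_def by (simp add: meet_at_def)
    also have "\<dots> \<le> ennreal C2" using pair_sum_bound[of 0 g g] by simp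
    finally show ?thesis .
  qed
  have count: "emeasure (count_space UNIV) (born x (ereal ((B + e) * real g))) \<ge> ennreal (exp (\<alpha> * (B - e) * real g) / 4)"
    if "Y g x \<ge> ennreal (1 / 4)" for x g
  proof -
    let ?N = "emeasure (count_space UNIV) (born x (ereal ((B + e) * real g)))"
    have "Y g x \<le> gsum g (\<lambda>u. ennreal (exp (- \<alpha> * ((B - e) * real g))) * indicator (born x (ereal ((B + e) * real g))) u)"
      unfolding Y_def
    proof (intro gsum_mono)
      fix u
      show "(if good g u x then wt \<alpha> u x else 0) \<le> ennreal (exp (- \<alpha> * ((B - e) * real g))) * indicator (born x (ereal ((B + e) * real g))) u"
        using alpha_pos by (auto simp: good_def wt_def mem_born indicator_def intro!: ennreal_leI mult_left_mono)
    qed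
    also have "\<dots> = ennreal (exp (- \<alpha> * ((B - e) * real g))) * gsum g (indicator (born x (ereal ((B + e) * real g))))"
      by (rule gsum_cmult)
    also have "gsum g (indicator (born x (ereal ((B + e) * real g)))) \<le> ?N"
    proof -
      have "gsum g (indicator (born x (ereal ((B + e) * real g))))
          = (\<integral>\<^sup>+u. indicator (born x (ereal ((B + e) * real g))) u * indicator {u. length u = g} u \<partial>count_space UNIV)"
        unfolding gsum_def by (rule nn_integral_count_space_indicator) simp
      also have "\<dots> \<le> (\<integral>\<^sup>+u. indicator (born x (ereal ((B + e) * real g))) u \<partial>count_space UNIV)"
        by (intro nn_integral_mono) (simp add: indicator_def)
      also have "\<dots> = ?N" by (rule nn_integral_indicator) simp
      finally show ?thesis .
    qed
    finally have "ennreal (1 / 4) \<le> ennreal (exp (- \<alpha> * ((B - e) * real g))) * ?N"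
      using that by (meson mult_left_mono order_trans zero_le)
    then have "ennreal (exp (\<alpha> * ((B - e) * real g))) * ennreal (1 / 4)
        \<le> ennreal (exp (\<alpha> * ((B - e) * real g))) * (ennreal (exp (- \<alpha> * ((B - e) * real g))) * ?N)"
      by (rule mult_left_mono) simp
    also have "\<dots> = ?N"
      by (simp add: mult.assoc[symmetric] mult_exp_exp flip: ennreal_mult')
    finally show ?thesis by (simp add: mult.assoc flip: ennreal_mult')
  qed
  \<comment> \<open>The halfway factor \<open>1 + \<eta> / 2\<close> leaves room on both sides:
    generation \<open>\<kappa> * L\<close> is late enough to guarantee more than exp L individuals
    (\<open>c1\<close>), and early enough for their births to precede the allowed time
    (\<open>c2\<close>).\<close>
  define \<kappa> where "\<kappa> = (1 + \<eta> / 2) / (\<alpha> * B)"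
  define g where "g L = nat \<lceil>\<kappa> * L\<rceil>" for L
  have kap: "\<kappa> > 0" using B \<eta> alpha_pos by (simp add: \<kappa>_def)
  have g: "\<kappa> * L \<le> real (g L)" "real (g L) \<le> \<kappa> * L + 1" if "L \<ge> 0" for L
  proof -
    have "\<kappa> * L \<ge> 0" using kap that by simp
    then have "real (g L) = of_int \<lceil>\<kappa> * L\<rceil>" by (simp add: g_def)
    then show "\<kappa> * L \<le> real (g L)" "real (g L) \<le> \<kappa> * L + 1" by linarith+
  qed
  have Be: "B - e > 0"
  proof -
    have "B * \<eta> > 0" using B \<eta> by simp
    then have "e * (1 + \<eta>) < B * (1 + \<eta>)" using B eB by (simp add: distrib_left)
    then show ?thesis using \<eta> by simp
  qed
  have c1: "\<alpha> * (B - e) * \<kappa> - 1 > 0"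
  proof -
    have "\<alpha> * (B - e) * \<kappa> = (B * (1 + \<eta> / 2) - e * (1 + \<eta> / 2)) / B"
      using alpha_pos B by (simp add: \<kappa>_def field_simps)
    also have "\<dots> > (B * (1 + \<eta> / 2) - B * \<eta> / 4) / B"
      using e2 B by (intro divide_strict_right_mono) auto
    also have "(B * (1 + \<eta> / 2) - B * \<eta> / 4) / B = 1 + \<eta> / 4" using B by (simp add: field_simps)
    finally show ?thesis using \<eta> by simp
  qed
  have c2: "(1 + \<eta>) / \<alpha> - (B + e) * \<kappa> > 0"
  proof -
    have "(B + e) * \<kappa> = (B * (1 + \<eta> / 2) + e * (1 + \<eta> / 2)) / B / \<alpha>"
      using alpha_pos B by (simp add: \<kappa>_def field_simps)
    also have "\<dots> < (B * (1 + \<eta> / 2) + B * \<eta> / 4) / B / \<alpha>"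
      using e2 B alpha_pos by (intro divide_strict_right_mono) auto
    also have "(B * (1 + \<eta> / 2) + B * \<eta> / 4) / B = 1 + 3 * \<eta> / 4" using B by (simp add: field_simps)
    also have "(1 + 3 * \<eta> / 4) / \<alpha> \<le> (1 + \<eta>) / \<alpha>" using \<eta> alpha_pos by (intro divide_right_mono) auto
    finally show ?thesis by simp
  qed
  have c3: "\<delta> * e / 2 * \<kappa> > 0" using \<delta> e kap by simp
  show "eventually (\<lambda>L. P.prob {x \<in> space P.
        emeasure (count_space UNIV) (born x (ereal ((1 + \<eta>) * L / \<alpha>))) \<ge> ennreal (exp L)} \<ge> 1 / (4 * C2)) at_top"
    using eventually_ge_at_top[of 0] eventually_linear_ge[OF c1, of "ln 4"]
      eventually_linear_ge[OF c2, of "B + e"] eventually_linear_ge[OF c3, of "ln 8"]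
  proof eventually_elim
    case (elim L)
    let ?g = "g L"
    have t: "(B + e) * real ?g \<le> (1 + \<eta>) * L / \<alpha>"
    proof -
      have "(B + e) * real ?g \<le> (B + e) * (\<kappa> * L + 1)"
        using g[OF elim(1)] B e by (intro mult_left_mono) auto
      then show ?thesis using elim(3) by (simp add: algebra_simps)
    qed
    have n: "exp L \<le> exp (\<alpha> * (B - e) * real ?g) / 4"
    proof -
      have "\<alpha> * (B - e) * (\<kappa> * L) \<le> \<alpha> * (B - e) * real ?g"
        using g[OF elim(1)] Be alpha_pos by (intro mult_left_mono) auto
      then have "exp (L + ln 4) \<le> exp (\<alpha> * (B - e) * real ?g)"
        using elim(2) by (simp add: algebra_simps)
      then show ?thesis by (simp add: exp_add)
    qed
    have "rem ?g \<le> 1 / 8"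
    proof -
      have "\<delta> * e / 2 * (\<kappa> * L) \<le> \<delta> * e / 2 * real ?g"
        using g[OF elim(1)] \<delta> e by (intro mult_left_mono) auto
      then have "rem ?g \<le> exp (- ln 8)" using elim(4) by (simp add: rem_def mult.assoc)
      then show ?thesis by (simp add: exp_minus)
    qed
    then have "1 \<le> (\<integral>\<^sup>+x. Y ?g x \<partial>P) + ennreal (1 / 8) + ennreal (1 / 8)"
      using Y1[of ?g] by (meson add_mono ennreal_leI order_refl order_trans)
    then have m1: "(\<integral>\<^sup>+x. Y ?g x \<partial>P) \<ge> ennreal (3 / 4)"
    proof (cases "\<integral>\<^sup>+x. Y ?g x \<partial>P")
      case (real r)
      have nonneg: "0 \<le> r" "0 \<le> r + 1 / 8" "(0::real) \<le> 1 / 8" using real by auto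
      have nonneg: "0 \<le> r" "0 \<le> r + 1 / 8" "(0::real) \<le> 1 / 8"
        "ennreal (r + 1 / 8 + 1 / 8) = ennreal (r + 1 / 8) + ennreal (1 / 8)"
        "ennreal (r + 1 / 8) = ennreal r + ennreal (1 / 8)"
        using nonneg ennreal_plus[OF nonneg(2,3)] ennreal_plus[OF nonneg(1,3)] by auto
      from real \<open>1 \<le> (\<integral>\<^sup>+x. Y ?g x \<partial>P) + ennreal (1 / 8) + ennreal (1 / 8)\<close>
      have "ennreal 1 \<le> ennreal (r + 1 / 8 + 1 / 8)"
        unfolding nonneg(4,5) by simp
      then have "3 / 4 \<le> r" using real by (subst (asm) ennreal_le_iff) auto
      then show ?thesis using real by (simp add: ennreal_leI)
    qed simp
    have "1 / (4 * C2) \<le> P.prob {x \<in> space P. Y ?g x \<ge> ennreal (1 / 4)}"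
      by (rule P.second_moment_lower_bound[OF Y C2_ge_1 m1 Y2])
    also have "\<dots> \<le> P.prob {x \<in> space P. emeasure (count_space UNIV) (born x (ereal ((1 + \<eta>) * L / \<alpha>))) \<ge> ennreal (exp L)}"
    proof (rule P.finite_measure_mono)
      show "{x \<in> space P. ennreal (1 / 4) \<le> Y ?g x}
        \<subseteq> {x \<in> space P. ennreal (exp L) \<le> emeasure (count_space UNIV) (born x (ereal ((1 + \<eta>) * L / \<alpha>)))}"
      proof safe
        fix x assume "ennreal (1 / 4) \<le> Y ?g x"
        have "ennreal (exp L) \<le> ennreal (exp (\<alpha> * (B - e) * real ?g) / 4)" by (intro ennreal_leI n)
        also have "\<dots> \<le> emeasure (count_space UNIV) (born x (ereal ((B + e) * real ?g)))"
          by (rule count) fact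
        also have "\<dots> \<le> emeasure (count_space UNIV) (born x (ereal ((1 + \<eta>) * L / \<alpha>)))"
          using t by (intro emeasure_mono) (auto simp: mem_born)
        finally show "ennreal (exp L) \<le> emeasure (count_space UNIV) (born x (ereal ((1 + \<eta>) * L / \<alpha>)))" .
      qed
    qed measurable
    finally show ?case .
  qed
qed

end

subsection \<open>Growth on survival\<close>

text \<open>Law of total probability along countably many disjoint cells: a bound on each
  conditional probability passes to the union. The cells will be the possible values of a
  generation, or of the vertex set of the stopped tree.\<close>

lemma emeasure_disjoint_UN_le:
  assumes S: "countable S" and A: "\<And>i. i \<in> S \<Longrightarrow> A i \<in> sets M" and E: "\<And>i. i \<in> S \<Longrightarrow> E i \<in> sets M"
    and sub: "\<And>i. i \<in> S \<Longrightarrow> E i \<subseteq> A i"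
    and disj: "disjoint_family_on A S"
    and le: "\<And>i. i \<in> S \<Longrightarrow> emeasure M (E i) \<le> c * emeasure M (A i)"
  shows "emeasure M (\<Union>i\<in>S. E i) \<le> c * emeasure M (\<Union>i\<in>S. A i)"
proof -
  have "disjoint_family_on E S" using disj sub by (fastforce simp: disjoint_family_on_def)
  then have "emeasure M (\<Union>i\<in>S. E i) = (\<integral>\<^sup>+i. emeasure M (E i) \<partial>count_space S)"
    using S E by (intro emeasure_UN_countable) auto
  also have "\<dots> \<le> (\<integral>\<^sup>+i. c * emeasure M (A i) \<partial>count_space S)"
    by (intro nn_integral_mono le) simp
  also have "\<dots> = c * (\<integral>\<^sup>+i. emeasure M (A i) \<partial>count_space S)"
    by (rule nn_integral_cmult) simp
  also have "(\<integral>\<^sup>+i. emeasure M (A i) \<partial>count_space S) = emeasure M (\<Union>i\<in>S. A i)"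
    using S A disj by (intro emeasure_UN_countable[symmetric]) auto
  finally show ?thesis .
qed

lemma emeasure_disjoint_UN_ge:
  assumes S: "countable S" and A: "\<And>i. i \<in> S \<Longrightarrow> A i \<in> sets M" and E: "\<And>i. i \<in> S \<Longrightarrow> E i \<in> sets M"
    and sub: "\<And>i. i \<in> S \<Longrightarrow> E i \<subseteq> A i"
    and disj: "disjoint_family_on A S"
    and ge: "\<And>i. i \<in> S \<Longrightarrow> c * emeasure M (A i) \<le> emeasure M (E i)"
  shows "c * emeasure M (\<Union>i\<in>S. A i) \<le> emeasure M (\<Union>i\<in>S. E i)"
proof -
  have "c * emeasure M (\<Union>i\<in>S. A i) = c * (\<integral>\<^sup>+i. emeasure M (A i) \<partial>count_space S)"
    using S A disj by (subst emeasure_UN_countable) auto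
  also have "\<dots> = (\<integral>\<^sup>+i. c * emeasure M (A i) \<partial>count_space S)"
    by (rule nn_integral_cmult[symmetric]) simp
  also have "\<dots> \<le> (\<integral>\<^sup>+i. emeasure M (E i) \<partial>count_space S)"
    by (intro nn_integral_mono ge) simp
  also have "\<dots> = emeasure M (\<Union>i\<in>S. E i)"
  proof -
    have "disjoint_family_on E S" using disj sub by (fastforce simp: disjoint_family_on_def)
    then show ?thesis using S E by (intro emeasure_UN_countable[symmetric]) auto
  qed
  finally show ?thesis .
qed

section \<open>Subtrees, the branching property and extinction\<close>

definition gen :: "(label \<Rightarrow> individual) \<Rightarrow> nat \<Rightarrow> label set" where
  "gen x g = {u. length u = g \<and> exists_ind x u}"

text \<open>Labels run back to the ancestor, so the descendants of \<open>w\<close> are the labels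
  \<open>u @ w\<close>; this is the process started by \<open>w\<close>, with \<open>w\<close> as
  the new root.\<close>

definition subtree :: "label \<Rightarrow> (label \<Rightarrow> individual) \<Rightarrow> label \<Rightarrow> individual" where
  "subtree w x = (\<lambda>u. x (u @ w))"

lemma exists_ind_append: "exists_ind x (u @ w) \<longleftrightarrow> exists_ind (subtree w x) u \<and> exists_ind x w"
  by (induction u) (auto simp: subtree_def)

lemma birth_time_append: "birth_time x (u @ w) = birth_time (subtree w x) u + birth_time x w"
  by (induction u) (auto simp: subtree_def)

lemma emeasure_born_subtree:
  assumes "exists_ind x w" "birth_time x w \<le> s"
  shows "emeasure (count_space UNIV) (born (subtree w x) (ereal t)) \<le> emeasure (count_space UNIV) (born x (ereal (t + s)))"
proof -
  have "inj_on (\<lambda>u. u @ w) A" for A by (auto simp: inj_on_def)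
  then have "emeasure (count_space UNIV) (born (subtree w x) (ereal t))
      = emeasure (count_space UNIV) ((\<lambda>u. u @ w) ` born (subtree w x) (ereal t))"
    by (simp add: emeasure_count_space card_image finite_image_iff)
  also have "\<dots> \<le> emeasure (count_space UNIV) (born x (ereal (t + s)))"
    using assms by (intro emeasure_mono) (auto simp: born_def exists_ind_append birth_time_append)
  finally show ?thesis .
qed

lemma gen_Suc_empty:
  "gen x (Suc g) = {} \<longleftrightarrow> (\<forall>w\<in>gen x g. \<forall>k. \<not> ennreal (birth_age (x w) k) < lifetime (x w))"
proof -
  have "gen x (Suc g) = {k # w | k w. w \<in> gen x g \<and> ennreal (birth_age (x w) k) < lifetime (x w)}"
    by (auto simp: gen_def length_Suc_conv)
  then show ?thesis by auto
qed

lemma gen_empty_mono: "g \<le> h \<Longrightarrow> gen x g = {} \<Longrightarrow> gen x h = {}"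
  by (induction h rule: dec_induct) (auto simp: gen_Suc_empty)

text \<open>Serves two situations: \<open>u\<close> empty, for labels of earlier generations, and
  \<open>l\<close> in the generation of \<open>w\<close>, for the subtree of another member. In both
  the second disjunct fails, so the graft below \<open>w\<close> changes nothing.\<close>

lemma graft_append_apply:
  assumes "length l \<le> length w" "l \<noteq> w"
  shows "graft (\<lambda>u. u @ w) y x (u @ l) = x (u @ l) \<or> (length l < length w \<and> u \<noteq> [])"
proof (cases "length l < length w \<and> u \<noteq> []")
  case False
  have "u @ l \<noteq> v @ w" for v
  proof
    assume eq: "u @ l = v @ w"
    from False assms consider "length l = length w" | "u = []" "length l < length w" by linarith
    then show False
    proof cases
      case 1 with eq assms show False by simp
    next
      case 2 then have "length l = length v + length w" using eq by (metis append_Nil length_append)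
      with 2 show False by simp
    qed
  qed
  then show ?thesis by (auto simp: graft_def)
qed simp

context cmj
begin

lemma space_P: "space P = (\<Pi>\<^sub>E u\<in>UNIV. space I)"
  by (simp add: process_law_def space_PiM)

lemma measurable_subtree[measurable]: "subtree w \<in> P \<rightarrow>\<^sub>M P"
  unfolding process_law_def subtree_def[abs_def]
  by (rule measurable_PiM_single') (auto simp: space_PiM PiE_iff)

text \<open>Induction on \<open>V\<close>: grafting a fresh process below \<open>w\<close> affects
  neither \<open>A\<close>, which is decided by the data of earlier generations, nor the subtrees of
  the other members of \<open>V\<close>. \<open>prob_PiM_graft\<close> then splits off one
  factor.\<close>

lemma prob_subtrees:
  assumes V: "finite V" "\<And>w. w \<in> V \<Longrightarrow> length w = g"
    and A: "A \<in> sets P" and D: "D \<in> sets P"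
    and local: "\<And>x y. x \<in> space P \<Longrightarrow> y \<in> space P \<Longrightarrow> (\<And>l. length l < g \<Longrightarrow> x l = y l) \<Longrightarrow> x \<in> A \<longleftrightarrow> y \<in> A"
  shows "P.prob {x \<in> A. \<forall>w\<in>V. subtree w x \<in> D} = P.prob A * P.prob D ^ card V"
  using V
proof (induction V rule: finite_induct)
  case empty
  then show ?case by simp
next
  case (insert w V)
  let ?A = "{x \<in> A. \<forall>w\<in>V. subtree w x \<in> D}"
  have A': "?A \<in> sets P"
  proof -
    have "?A = {x \<in> space P. x \<in> A \<and> (\<forall>w\<in>V. subtree w x \<in> D)}"
      using sets.sets_into_space[OF A] by auto
    moreover have "{x \<in> space P. x \<in> A \<and> (\<forall>w\<in>V. subtree w x \<in> D)} \<in> sets P"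
      using A D insert(1) by measurable
    ultimately show ?thesis by simp
  qed
  have len: "length w = g" "\<And>w'. w' \<in> V \<Longrightarrow> length w' = g" using insert by auto
  have indep: "graft (\<lambda>u. u @ w) y x \<in> ?A \<longleftrightarrow> x \<in> ?A" if "x \<in> space P" "y \<in> space P" for x y
  proof -
    have "graft (\<lambda>u. u @ w) y x \<in> A \<longleftrightarrow> x \<in> A"
    proof (rule local)
      show "graft (\<lambda>u. u @ w) y x \<in> space P"
        using that by (auto simp: space_P graft_def PiE_iff)
      show "graft (\<lambda>u. u @ w) y x l = x l" if "length l < g" for l
        using graft_append_apply[of l w y x "[]"] that len by auto
    qed fact
    moreover have "subtree w' (graft (\<lambda>u. u @ w) y x) = subtree w' x" if "w' \<in> V" for w'
      using graft_append_apply[of w' w y x] that len insert(2) by (auto simp: subtree_def fun_eq_iff)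
    ultimately show ?thesis by auto
  qed
  have "P.prob {x \<in> ?A. (\<lambda>u. x (u @ w)) \<in> D} = P.prob ?A * P.prob D"
    using A' D indep unfolding process_law_def
    by (intro prob_PiM_graft[OF prob_space_I]) (auto simp: inj_on_def)
  moreover have "{x \<in> ?A. (\<lambda>u. x (u @ w)) \<in> D} = {x \<in> A. \<forall>w\<in>insert w V. subtree w x \<in> D}"
    by (auto simp: subtree_def)
  ultimately show ?case using insert by (simp add: mult.assoc mult.commute)
qed

lemma measurable_gen_eq[measurable]: "Measurable.pred P (\<lambda>x. gen x g = V)"
proof -
  have "gen x g = V \<longleftrightarrow> (\<forall>u. (length u = g \<and> exists_ind x u) \<longleftrightarrow> u \<in> V)" for x
    by (auto simp: gen_def)
  then show ?thesis by simp
qed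

lemma gen_local:
  assumes "\<And>l. length l < g \<Longrightarrow> x l = y l"
  shows "gen x g = gen y g"
proof -
  have "exists_ind x u = exists_ind y u" if "length u = g" for u
    using that assms strict_suffix_length by (intro exists_birth_cong) blast
  then show ?thesis by (auto simp: gen_def)
qed

lemma prob_gen_subtrees:
  assumes "finite V" "\<And>w. w \<in> V \<Longrightarrow> length w = g" and D: "D \<in> sets P"
  shows "P.prob {x \<in> space P. gen x g = V \<and> (\<forall>w\<in>V. subtree w x \<in> D)}
    = P.prob {x \<in> space P. gen x g = V} * P.prob D ^ card V"
proof -
  have "P.prob {x \<in> {x \<in> space P. gen x g = V}. \<forall>w\<in>V. subtree w x \<in> D}
    = P.prob {x \<in> space P. gen x g = V} * P.prob D ^ card V"
  proof (intro prob_subtrees assms)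
    show "{x \<in> space P. gen x g = V} \<in> sets P" by measurable
    fix x y assume "x \<in> space P" "y \<in> space P" "\<And>l. length l < g \<Longrightarrow> x l = y l"
    then show "x \<in> {x \<in> space P. gen x g = V} \<longleftrightarrow> y \<in> {x \<in> space P. gen x g = V}"
      using gen_local[of g x y] by simp
  qed (use assms in auto)
  moreover have "{x \<in> {x \<in> space P. gen x g = V}. \<forall>w\<in>V. subtree w x \<in> D}
      = {x \<in> space P. gen x g = V \<and> (\<forall>w\<in>V. subtree w x \<in> D)}" by auto
  ultimately show ?thesis by simp
qed

text \<open>At exponent 0 the weights are indicators, so the expected size of a generation is a
  power of the finite mean number of children.\<close>

lemma AE_finite_gen: "AE x in P. \<forall>g. finite (gen x g)"
proof -
  have "AE x in P. finite (gen x g)" for g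
  proof -
    have "(\<Sum>k. \<integral>\<^sup>+i. disc 0 k i \<partial>I) ^ g < \<infinity>"
      using suminf_disc_0 by (cases "\<Sum>k. \<integral>\<^sup>+i. disc 0 k i \<partial>I") (auto simp: ennreal_power)
    then have "(\<integral>\<^sup>+x. gsum g (\<lambda>u. wt 0 u x) \<partial>P) < \<infinity>"
      using gsum_wt[of g 0]
      by (subst nn_integral_gsum) (auto intro: P.sigma_finite_measure_axioms)
    then have "AE x in P. gsum g (\<lambda>u. wt 0 u x) \<noteq> \<infinity>"
      by (intro nn_integral_PInf_AE borel_measurable_gsum) auto
    then show ?thesis
    proof eventually_elim
      case (elim x)
      have "gsum g (\<lambda>u. wt 0 u x) = gsum g (indicator (gen x g))"
        by (intro gsum_cong) (auto simp: wt_def gen_def indicator_def)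
      also have "\<dots> = emeasure (count_space {u. length u = g}) (gen x g)"
        unfolding gsum_def by (rule nn_integral_indicator) (auto simp: gen_def)
      also have "\<dots> = (if finite (gen x g) then of_nat (card (gen x g)) else \<infinity>)"
        by (rule emeasure_count_space) (auto simp: gen_def)
      finally show ?case using elim by (auto split: if_splits)
    qed
  qed
  then show ?thesis by (simp add: AE_all_countable)
qed

text \<open>Translates survival, stated through \<open>Z\<close>, into a statement on generations:
  once a generation is empty so are the later ones, and finitely many finite generations make up a
  finite population.\<close>

lemma AE_infinite_imp_gen_nonempty:
  "AE x in P. infinite (born x \<infinity>) \<longrightarrow> (\<forall>g. gen x g \<noteq> {})"
  using AE_finite_gen
proof eventually_elim
  case (elim x)
  show ?case
  proof (rule impI, rule ccontr)
    assume inf: "infinite (born x \<infinity>)" and "\<not> (\<forall>g. gen x g \<noteq> {})"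
    then obtain g where "gen x g = {}" by auto
    then have "born x \<infinity> \<subseteq> (\<Union>h<g. gen x h)"
      using gen_empty_mono[of g _ x] by (auto simp: born_def gen_def) (metis (mono_tags, lifting) empty_Collect_eq linorder_not_less)
    with elim have "finite (born x \<infinity>)" by (meson finite_UN_I finite_lessThan finite_subset)
    with inf show False by simp
  qed
qed

definition childless :: "(label \<Rightarrow> individual) set" where
  "childless = {x \<in> space P. \<forall>k. \<not> ennreal (birth_age (x []) k) < lifetime (x [])}"

lemma childless_sets[measurable]: "childless \<in> sets P"
  unfolding childless_def by measurable

text \<open>Otherwise the initial waiting time would almost surely be below the lifetime. By Fubini
  an exponential variable would then almost surely be below some fixed finite \<open>t\<close>,
  although its density is positive beyond \<open>t\<close>.\<close>

lemma prob_childless_pos: "P.prob childless > 0"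
proof (rule ccontr)
  assume "\<not> P.prob childless > 0"
  then have "P.prob childless = 0" using measure_nonneg[of P childless] by linarith
  then have "childless \<in> null_sets P" by (simp add: null_sets_def P.emeasure_eq_measure)
  then have "AE x in P. x \<notin> childless" by (rule AE_not_in)
  with AE_waiting_pos AE_space have "AE x in P. ennreal (snd (x []) 0) < lifetime (x [])"
  proof eventually_elim
    case (elim x)
    then obtain k where k: "ennreal (birth_age (x []) k) < lifetime (x [])" by (auto simp: childless_def)
    have "snd (x []) 0 \<le> birth_age (x []) k"
      unfolding birth_age_def using elim(1) by (intro member_le_sum) (auto intro: less_imp_le)
    with k show ?case by (meson ennreal_leI le_less_trans)
  qed
  then have "AE i in distr P I (\<lambda>x. x []). ennreal (snd i 0) < lifetime i"
    by (subst AE_distr_iff) measurable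
  moreover have "distr P I (\<lambda>x. x []) = I"
    unfolding process_law_def
    using distr_PiM_component[of UNIV "\<lambda>_. I" "[]"] prob_space_I by simp
  ultimately have "AE i in I. ennreal (snd i 0) < lifetime i" by (simp only:)
  then have *: "AE i in U \<Otimes>\<^sub>M W. ennreal (snd i 0) < lifetime i"
    unfolding individual_law_eq .
  interpret U: prob_space U by (rule prob_space_U)
  interpret W: prob_space W by (rule prob_space_W)
  interpret UW: pair_prob_space U W ..
  from UW.AE_pair[OF *] have "AE t in U. AE w in W. ennreal (w 0) < t" by (simp add: lifetime_def)
  moreover have "AE t in U. t \<noteq> \<infinity>"
    using AE_finite by (intro AE_uniform_measureI) (auto elim: eventually_mono)
  ultimately have "AE t in U. t \<noteq> \<infinity> \<and> (AE w in W. ennreal (w 0) < t)" by eventually_elim simp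
  moreover have "\<not> (AE t in U. False)" by simp
  ultimately obtain t where t: "t \<noteq> \<infinity>" "AE w in W. ennreal (w 0) < t"
    by (metis (mono_tags, lifting) eventually_mono)
  let ?D = "density lborel (exponential_density b)"
  have "AE y in distr W ?D (\<lambda>w. w 0). ennreal y < t"
    using t(2) by (subst AE_distr_iff) measurable
  moreover have "distr W ?D (\<lambda>w. w 0) = ?D"
    using distr_PiM_component[of UNIV "\<lambda>_. ?D" "0::nat"] prob_space_exponential_density[OF b_pos] by simp
  ultimately have "AE y in ?D. ennreal y < t" by (simp only:)
  then have "AE y in lborel. 0 < ennreal (exponential_density b y) \<longrightarrow> ennreal y < t"
    by (subst (asm) AE_density) auto
  then have "AE y in lborel. y \<notin> {enn2real t ..}"
  proof eventually_elim
    case (elim y)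
    show ?case
    proof
      assume "y \<in> {enn2real t..}"
      then have y: "enn2real t \<le> y" "0 \<le> y" using order_trans[OF enn2real_nonneg[of t]] by auto
      then have "ennreal y < t" using elim b_pos by (simp add: erlang_density_def)
      then have "ennreal y < ennreal (enn2real t)" using t(1) by (simp add: less_top)
      with y show False by (simp add: ennreal_less_iff)
    qed
  qed
  then have "emeasure lborel {enn2real t ..} = 0"
    by (subst (asm) AE_iff_measurable[OF _ refl]) (auto simp: atLeast_def)
  moreover have "emeasure lborel {enn2real t .. enn2real t + 1} \<le> emeasure lborel {enn2real t ..}"
    by (intro emeasure_mono) auto
  ultimately show False by simp
qed

text \<open>Each visit to a population size between 1 and \<open>K\<close> is followed by extinction with
  probability at least \<open>p\<^sub>0\<^sup>K\<close>, where \<open>p\<^sub>0 > 0\<close> is the probability of having no children,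
  and extinction happens at most once.\<close>

lemma prob_small_gen_tendsto_0:
  "(\<lambda>g. P.prob {x \<in> space P. gen x g \<noteq> {} \<and> finite (gen x g) \<and> card (gen x g) \<le> K}) \<longlonglongrightarrow> 0"
proof -
  let ?S = "\<lambda>g. {V :: label set. finite V \<and> V \<subseteq> {u. length u = g} \<and> V \<noteq> {} \<and> card V \<le> K}"
  let ?A = "\<lambda>g V. {x \<in> space P. gen x g = V}"
  let ?E = "\<lambda>g V. {x \<in> space P. gen x g = V \<and> (\<forall>w\<in>V. subtree w x \<in> childless)}"
  define p0 where "p0 = P.prob childless"
  have p0: "0 < p0" "p0 \<le> 1" using prob_childless_pos by (auto simp: p0_def)
  have cS: "countable (?S g)" for g
    by (rule countable_subset[OF _ countable_Collect_finite]) auto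
  define D where "D g = (\<Union>V\<in>?S g. ?E g V)" for g
  have Esets: "?E g V \<in> sets P" if "finite V" for g V
    using that by measurable
  have Dsets: "D g \<in> sets P" for g
    unfolding D_def using cS Esets by (intro sets.countable_UN') auto
  have D: "D g \<subseteq> {x \<in> space P. gen x g \<noteq> {} \<and> gen x (Suc g) = {}}" for g
    by (auto simp: D_def gen_Suc_empty childless_def subtree_def)
  have "disjoint_family D"
  proof -
    have "D g \<inter> D h = {}" if "g < h" for g h
      using D[of g] D[of h] gen_empty_mono[of "Suc g" h] that by fastforce
    then show ?thesis
      unfolding disjoint_family_on_def by (metis Int_commute linorder_neqE_nat)
  qed
  then have "(\<lambda>g. P.prob (D g)) sums P.prob (\<Union>g. D g)"
    using Dsets by (intro P.finite_measure_UNION) auto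
  then have lim: "(\<lambda>g. P.prob (D g)) \<longlonglongrightarrow> 0"
    by (intro summable_LIMSEQ_zero) (rule sums_summable)
  have le: "P.prob {x \<in> space P. gen x g \<noteq> {} \<and> finite (gen x g) \<and> card (gen x g) \<le> K} \<le> P.prob (D g) / p0 ^ K" for g
  proof -
    have eq: "{x \<in> space P. gen x g \<noteq> {} \<and> finite (gen x g) \<and> card (gen x g) \<le> K} = (\<Union>V\<in>?S g. ?A g V)"
      by (auto simp: gen_def)
    have "ennreal (p0 ^ K) * emeasure P (\<Union>V\<in>?S g. ?A g V) \<le> emeasure P (D g)"
      unfolding D_def
    proof (rule emeasure_disjoint_UN_ge[OF cS])
      show "disjoint_family_on (?A g) (?S g)" by (auto simp: disjoint_family_on_def)
      show "?A g V \<in> sets P" for V by measurable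
      show "?E g V \<in> sets P" if "V \<in> ?S g" for V using that by (intro Esets) auto
      show "?E g V \<subseteq> ?A g V" for V by auto
      fix V assume V: "V \<in> ?S g"
      have "p0 ^ K * P.prob (?A g V) \<le> p0 ^ card V * P.prob (?A g V)"
        using V p0 by (intro mult_right_mono power_decreasing) auto
      also have "\<dots> = P.prob (?E g V)"
        using V by (subst prob_gen_subtrees) (auto simp: p0_def mult.commute)
      finally show "ennreal (p0 ^ K) * emeasure P (?A g V) \<le> emeasure P (?E g V)"
        using p0 by (simp add: P.emeasure_eq_measure ennreal_leI flip: ennreal_mult')
    qed
    then have "p0 ^ K * P.prob (\<Union>V\<in>?S g. ?A g V) \<le> P.prob (D g)"
      using p0 by (simp add: P.emeasure_eq_measure flip: ennreal_mult')
    then show ?thesis unfolding eq using p0 by (simp add: pos_le_divide_eq mult.commute)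
  qed
  show ?thesis
  proof (rule tendsto_sandwich[OF _ _ tendsto_const])
    show "(\<lambda>g. P.prob (D g) / p0 ^ K) \<longlonglongrightarrow> 0" using tendsto_divide[OF lim tendsto_const[of "p0 ^ K"]] p0 by simp
  qed (use le in auto)
qed

text \<open>The events decrease in \<open>s\<close>, and their intersection is null because the
  generation is almost surely finite.\<close>

lemma prob_late_gen_tendsto_0:
  "(\<lambda>s. P.prob {x \<in> space P. \<exists>w\<in>gen x g. birth_time x w > real s}) \<longlonglongrightarrow> 0"
proof -
  let ?B = "\<lambda>s. {x \<in> space P. \<exists>w\<in>gen x g. birth_time x w > real s}"
  have eq: "?B s = {x \<in> space P. \<exists>w. length w = g \<and> exists_ind x w \<and> birth_time x w > real s}" for s
    by (auto simp: gen_def)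
  have B: "?B s \<in> sets P" for s unfolding eq by measurable
  have "(\<lambda>s. P.prob (?B s)) \<longlonglongrightarrow> P.prob (\<Inter>s. ?B s)"
  proof (rule P.finite_Lim_measure_decseq)
    show "decseq ?B"
    proof (rule decseq_SucI)
      fix s
      show "?B (Suc s) \<subseteq> ?B s"
      proof safe
        fix x w assume "w \<in> gen x g" "real (Suc s) < birth_time x w"
        then show "\<exists>w\<in>gen x g. real s < birth_time x w" by (intro bexI[of _ w]) auto
      qed
    qed
  qed (use B in auto)
  moreover have "AE x in P. x \<notin> (\<Inter>s. ?B s)"
    using AE_finite_gen
  proof eventually_elim
    case (elim x)
    then have fin: "finite (gen x g)" by simp
    obtain s :: nat where "real s > Max (insert 0 (birth_time x ` gen x g))"
      using reals_Archimedean2 by blast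
    then have "\<forall>w\<in>gen x g. birth_time x w < real s" using fin by auto
    then have "x \<notin> ?B s" by force
    then show ?case by blast
  qed
  then have "P.prob (\<Inter>s. ?B s) = 0"
    using B by (intro P.prob_eq_0[THEN iffD2]) (auto intro!: sets.countable_INT)
  ultimately show ?thesis by simp
qed

section \<open>From positive probability to probability 1 on survival\<close>

text \<open>With \<open>L\<close> = ln n and \<open>x\<close> generic, the complement of this event
  gives \<open>tau x n\<close> the upper bound (1 + \<eta>) L / \<alpha>.\<close>

definition slow :: "real \<Rightarrow> real \<Rightarrow> (label \<Rightarrow> individual) set" where
  "slow \<eta> L = {x \<in> space P.
    \<not> emeasure (count_space UNIV) (born x (ereal ((1 + \<eta>) * L / \<alpha>))) \<ge> ennreal (exp L)}"

lemma slow_sets[measurable]: "slow \<eta> L \<in> sets P"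
  unfolding slow_def by measurable

text \<open>The choices are made in the order \<open>K\<close>, \<open>g\<close>, \<open>s\<close>,
  \<open>L\<close>. More than \<open>K\<close> independent subtrees all fail with probability at
  most \<open>(1 - q) ^ K\<close>; generation \<open>g\<close> is rarely nonempty with at most
  \<open>K\<close> members; its members are rarely born after time \<open>s\<close>; and for large
  \<open>L\<close> the delay \<open>s\<close> fits between the times with \<eta> / 2 and with
  \<eta>.\<close>

lemma prob_surviving_slow_tendsto_0:
  assumes \<eta>: "\<eta> > 0"
  shows "((\<lambda>L. P.prob {x \<in> slow \<eta> L. \<forall>g. gen x g \<noteq> {}}) \<longlongrightarrow> 0) at_top"
proof (rule tendstoI)
  fix \<epsilon> :: real assume \<epsilon>: "\<epsilon> > 0"
  obtain q where q: "q > 0"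
    and large: "\<And>\<eta>. \<eta> > 0 \<Longrightarrow> eventually (\<lambda>L. P.prob {x \<in> space P.
        emeasure (count_space UNIV) (born x (ereal ((1 + \<eta>) * L / \<alpha>))) \<ge> ennreal (exp L)} \<ge> q) at_top"
    using prob_population_large by blast
  have "eventually (\<lambda>L. q \<le> 1) (at_top :: real filter)"
    using large[OF \<eta>] by eventually_elim (meson P.prob_le_1 order_trans)
  then have q1: "q \<le> 1" by simp
  obtain K where K: "(1 - q) ^ K < \<epsilon> / 4"
    using real_arch_pow_inv[of "\<epsilon> / 4" "1 - q"] q \<epsilon> by auto
  have "eventually (\<lambda>g. P.prob {x \<in> space P. gen x g \<noteq> {} \<and> finite (gen x g) \<and> card (gen x g) \<le> K} < \<epsilon> / 4) sequentially"
    using order_tendstoD(2)[OF prob_small_gen_tendsto_0, of "\<epsilon> / 4" K] \<epsilon> by simp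
  then obtain g where g: "P.prob {x \<in> space P. gen x g \<noteq> {} \<and> finite (gen x g) \<and> card (gen x g) \<le> K} < \<epsilon> / 4"
    by (auto simp: eventually_sequentially)
  have "eventually (\<lambda>s. P.prob {x \<in> space P. \<exists>w\<in>gen x g. birth_time x w > real s} < \<epsilon> / 4) sequentially"
    using order_tendstoD(2)[OF prob_late_gen_tendsto_0, of "\<epsilon> / 4" g] \<epsilon> by simp
  then obtain s where s: "P.prob {x \<in> space P. \<exists>w\<in>gen x g. birth_time x w > real s} < \<epsilon> / 4"
    by (auto simp: eventually_sequentially)
  have ce: "\<eta> / 2 / \<alpha> > 0" using \<eta> alpha_pos by simp
  show "eventually (\<lambda>L. dist (P.prob {x \<in> slow \<eta> L. \<forall>g. gen x g \<noteq> {}}) 0 < \<epsilon>) at_top"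
    using large[OF half_gt_zero[OF \<eta>]] eventually_linear_ge[OF ce, of "real s"]
  proof eventually_elim
    case (elim L)
    note late = elim(2)
    let ?F = "slow (\<eta> / 2) L"
    let ?G = "{x \<in> space P.
        emeasure (count_space UNIV) (born x (ereal ((1 + \<eta> / 2) * L / \<alpha>))) \<ge> ennreal (exp L)}"
    have "?F = space P - ?G" by (auto simp: slow_def)
    moreover have "?G \<in> sets P" by measurable
    ultimately have F: "P.prob ?F \<le> 1 - q"
      using elim(1) P.prob_compl[of ?G] by simp
    let ?S = "{V :: label set. finite V \<and> V \<subseteq> {u. length u = g} \<and> K < card V}"
    let ?A = "\<lambda>V. {x \<in> space P. gen x g = V}"
    let ?E = "\<lambda>V. {x \<in> space P. gen x g = V \<and> (\<forall>w\<in>V. subtree w x \<in> ?F)}"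
    let ?X1 = "{x \<in> space P. gen x g \<noteq> {} \<and> finite (gen x g) \<and> card (gen x g) \<le> K}"
    let ?X2 = "{x \<in> space P. \<exists>w\<in>gen x g. birth_time x w > real s}"
    let ?X3 = "\<Union>V\<in>?S. ?E V"
    have cS: "countable ?S"
      by (rule countable_subset[OF _ countable_Collect_finite]) auto
    have E: "?E V \<in> sets P" if "V \<in> ?S" for V using that by measurable
    have X1: "?X1 \<in> sets P"
    proof -
      have "?X1 = (\<Union>V\<in>{V. finite V \<and> V \<subseteq> {u. length u = g} \<and> V \<noteq> {} \<and> card V \<le> K}. ?A V)"
        by (auto simp: gen_def)
      moreover have "countable {V :: label set. finite V \<and> V \<subseteq> {u. length u = g} \<and> V \<noteq> {} \<and> card V \<le> K}"
        by (rule countable_subset[OF _ countable_Collect_finite]) auto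
      ultimately show ?thesis by (auto intro!: sets.countable_UN')
    qed
    have X2: "?X2 \<in> sets P"
    proof -
      have "?X2 = {x \<in> space P. \<exists>w. length w = g \<and> exists_ind x w \<and> birth_time x w > real s}"
        by (auto simp: gen_def)
      then show ?thesis by simp
    qed
    have X3: "?X3 \<in> sets P" using cS E by (intro sets.countable_UN') auto
    have "emeasure P ?X3 \<le> ennreal ((1 - q) ^ K) * emeasure P (\<Union>V\<in>?S. ?A V)"
    proof (rule emeasure_disjoint_UN_le[OF cS _ E])
      show "disjoint_family_on ?A ?S" by (auto simp: disjoint_family_on_def)
      show "?A V \<in> sets P" for V by measurable
      show "?E V \<subseteq> ?A V" for V by auto
      fix V assume V: "V \<in> ?S"
      then have "P.prob (?E V) = P.prob (?A V) * P.prob ?F ^ card V"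
        by (intro prob_gen_subtrees) auto
      also have "\<dots> \<le> P.prob (?A V) * (1 - q) ^ K"
      proof (rule mult_left_mono)
        have "P.prob ?F ^ card V \<le> (1 - q) ^ card V" using F by (intro power_mono) auto
        also have "\<dots> \<le> (1 - q) ^ K" using q q1 V by (intro power_decreasing) auto
        finally show "P.prob ?F ^ card V \<le> (1 - q) ^ K" .
      qed simp
      finally have "P.prob (?E V) \<le> (1 - q) ^ K * P.prob (?A V)" by (simp only: mult.commute)
      then show "emeasure P (?E V) \<le> ennreal ((1 - q) ^ K) * emeasure P (?A V)"
        using q1 by (simp add: P.emeasure_eq_measure ennreal_leI flip: ennreal_mult')
    qed
    also have "\<dots> \<le> ennreal ((1 - q) ^ K) * 1"
      by (intro mult_left_mono P.emeasure_le_1) simp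
    finally have X3le: "P.prob ?X3 \<le> (1 - q) ^ K" using q1 by (simp add: P.emeasure_eq_measure)
    \<comment> \<open>Generation \<open>g\<close> is small (\<open>?X1\<close>), or has a late
      member (\<open>?X2\<close>), or all its subtrees are slow (\<open>?X3\<close>): one fast
      subtree of an early member already makes the whole process fast.\<close>
    have "AE x in P. x \<in> {x \<in> slow \<eta> L. \<forall>g. gen x g \<noteq> {}} \<longrightarrow> x \<in> ?X1 \<union> ?X2 \<union> ?X3"
      using AE_finite_gen
    proof eventually_elim
      case (elim x)
      then have fin: "finite (gen x g)" by simp
      show ?case
      proof
        assume x: "x \<in> {x \<in> slow \<eta> L. \<forall>g. gen x g \<noteq> {}}"
        then have xP: "x \<in> space P" and ne: "gen x g \<noteq> {}" by (auto simp: slow_def)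
        show "x \<in> ?X1 \<union> ?X2 \<union> ?X3"
        proof (rule ccontr)
          assume not: "x \<notin> ?X1 \<union> ?X2 \<union> ?X3"
          then have not1: "x \<notin> ?X1" and not2: "x \<notin> ?X2" and not3: "x \<notin> ?X3" by simp_all
          have card: "K < card (gen x g)" using not1 fin xP ne by simp
          have early: "birth_time x w \<le> real s" if "w \<in> gen x g" for w
            using not2 xP that by (simp add: not_less)
          from card fin have "gen x g \<in> ?S" by (auto simp: gen_def)
          with not3 have "x \<notin> ?E (gen x g)" by blast
          then obtain w where w: "w \<in> gen x g" "subtree w x \<notin> ?F" using xP by blast
          have "subtree w x \<in> space P" using measurable_space[OF measurable_subtree xP] .
          with w(2) have "ennreal (exp L) \<le> emeasure (count_space UNIV) (born (subtree w x) (ereal ((1 + \<eta> / 2) * L / \<alpha>)))"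
            by (auto simp: slow_def)
          also have "\<dots> \<le> emeasure (count_space UNIV) (born x (ereal ((1 + \<eta> / 2) * L / \<alpha> + real s)))"
            using w(1) early by (intro emeasure_born_subtree) (auto simp: gen_def)
          also have "\<dots> \<le> emeasure (count_space UNIV) (born x (ereal ((1 + \<eta>) * L / \<alpha>)))"
          proof (intro emeasure_mono)
            have "(1 + \<eta> / 2) * L / \<alpha> + real s \<le> (1 + \<eta>) * L / \<alpha>"
            proof -
              have "(1 + \<eta>) * L / \<alpha> = (1 + \<eta> / 2) * L / \<alpha> + \<eta> / 2 / \<alpha> * L"
                by (simp add: distrib_right add_divide_distrib)
              then show ?thesis using late by linarith
            qed
            then show "born x (ereal ((1 + \<eta> / 2) * L / \<alpha> + real s)) \<subseteq> born x (ereal ((1 + \<eta>) * L / \<alpha>))"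
              by (auto simp: mem_born)
          qed simp
          finally show False using x by (auto simp: slow_def)
        qed
      qed
    qed
    then have "P.prob {x \<in> slow \<eta> L. \<forall>g. gen x g \<noteq> {}} \<le> P.prob (?X1 \<union> ?X2 \<union> ?X3)"
      using X1 X2 X3 by (intro P.finite_measure_mono_AE) auto
    also have "\<dots> \<le> P.prob ?X1 + P.prob ?X2 + P.prob ?X3"
      using X1 X2 X3 measure_Un_le[of "?X1 \<union> ?X2" P ?X3] measure_Un_le[of ?X1 P ?X2] by simp
    also have "\<dots> < \<epsilon>" using g s X3le K \<epsilon> by linarith
    finally show ?case by simp
  qed
qed

end

subsection \<open>The tree of the first individuals\<close>

text \<open>The maximum is removed until \<open>n\<close> elements are left; injectivity excludes
  ties.\<close>

lemma obtain_rank: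
  fixes f :: "'a \<Rightarrow> real"
  assumes "finite S" "inj_on f S" "1 \<le> n" "n \<le> card S"
  obtains u where "u \<in> S" "card {v \<in> S. f v \<le> f u} = n"
proof -
  have "\<exists>u\<in>S. card {v \<in> S. f v \<le> f u} = n"
    using assms
  proof (induction S rule: finite_psubset_induct)
    case (psubset S)
    then have "S \<noteq> {}" by auto
    then have "Max (f ` S) \<in> f ` S" using psubset(1) by (intro Max_in) auto
    then obtain m where "m \<in> S" "f m = Max (f ` S)" by auto
    then have m: "m \<in> S" "\<And>v. v \<in> S \<Longrightarrow> f v \<le> f m" using psubset(1) by auto
    show ?case
    proof (cases "n = card S")
      case True
      have "{v \<in> S. f v \<le> f m} = S" using m by auto
      with True show ?thesis by (intro bexI[OF _ m(1)]) (simp only:)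
    next
      case False
      have "\<exists>u\<in>S - {m}. card {v \<in> S - {m}. f v \<le> f u} = n"
      proof (rule psubset.IH)
        show "S - {m} \<subset> S" using m by auto
        show "inj_on f (S - {m})" using psubset(3) by (rule inj_on_subset) auto
        show "n \<le> card (S - {m})" using False psubset m by simp
      qed fact
      then obtain u where u: "u \<in> S" "u \<noteq> m" "card {v \<in> S - {m}. f v \<le> f u} = n" by auto
      have "f u < f m" using m(2)[OF u(1)] u m(1) psubset(3) by (metis inj_onD order_le_less)
      then have "{v \<in> S. f v \<le> f u} = {v \<in> S - {m}. f v \<le> f u}" by auto
      with u show ?thesis by metis
    qed
  qed
  then show thesis using that by blast
qed

text \<open>On survival, almost surely exactly one \<open>B\<close> of size \<open>n\<close> satisfies this (the vertex set of \<open>T(\<tau>\<^sub>n)\<close>),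
  so conditioning on the tree becomes a countable decomposition.\<close>

definition first_born :: "(label \<Rightarrow> individual) \<Rightarrow> label set \<Rightarrow> bool" where
  "first_born x B \<longleftrightarrow> (\<forall>u\<in>B. exists_ind x u) \<and>
    (\<forall>u\<in>B. \<forall>v. v \<notin> B \<longrightarrow> exists_ind x v \<longrightarrow> birth_time x u < birth_time x v)"

lemma first_born_unique:
  assumes "first_born x B" "first_born x B'" "finite B" "finite B'" "card B = card B'"
  shows "B = B'"
proof (rule ccontr)
  assume "B \<noteq> B'"
  then have "\<not> B \<subseteq> B'" "\<not> B' \<subseteq> B"
    using assms by (metis card_subset_eq)+
  then obtain u v where "u \<in> B" "u \<notin> B'" "v \<in> B'" "v \<notin> B" by auto
  then have "birth_time x u < birth_time x v" "birth_time x v < birth_time x u"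
    using assms(1,2) by (auto simp: first_born_def)
  then show False by simp
qed

text \<open>These properties hold almost surely (\<open>AE_generic\<close>). They make children
  younger than their mothers and let the population grow by one individual at a time, so that
  exactly \<open>n\<close> individuals are present when size \<open>n\<close> is reached.\<close>

definition generic :: "(label \<Rightarrow> individual) \<Rightarrow> bool" where
  "generic x \<longleftrightarrow> (\<forall>u j. snd (x u) j > 0) \<and> (\<forall>u v. u \<noteq> v \<longrightarrow> birth_time x u \<noteq> birth_time x v)
    \<and> (\<forall>t. finite (born x (ereal t)))"

lemma birth_age_pos: "generic x \<Longrightarrow> birth_age (x u) k > 0"
  unfolding generic_def birth_age_def by (intro sum_pos) auto

lemma birth_time_Cons_gt: "generic x \<Longrightarrow> birth_time x u < birth_time x (k # u)"
  using birth_age_pos[of x u k] by simp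

lemma birth_time_nonneg: "generic x \<Longrightarrow> birth_time x u \<ge> 0"
  by (induction u) (auto intro: less_imp_le[OF birth_age_pos] add_nonneg_nonneg)

lemma born_Cons: "generic x \<Longrightarrow> k # u \<in> born x t \<Longrightarrow> u \<in> born x t"
  using birth_time_Cons_gt[of x u k] by (auto simp: born_def dest: order_trans[rotated] intro: order_trans[of _ "ereal (birth_time x (k # u))"])

text \<open>\<open>tau x n\<close> is the birth time of the individual of rank \<open>n\<close>
  among those born by \<open>t\<close>: earlier fewer than \<open>n\<close> are present, and without
  ties exactly \<open>n\<close> at that moment.\<close>

lemma born_tau:
  assumes gx: "generic x" and n: "1 \<le> n"
    and large: "of_nat n \<le> emeasure (count_space UNIV) (born x (ereal t))"
  shows "card (born x (tau x n)) = n" "finite (born x (tau x n))" "born x (tau x n) \<subseteq> born x (ereal t)"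
    "first_born x (born x (tau x n))" "[] \<in> born x (tau x n)"
proof -
  let ?S = "born x (ereal t)"
  have fin: "finite ?S" using gx by (simp add: generic_def)
  have "n \<le> card ?S" using large fin by (simp add: emeasure_count_space)
  moreover have "inj_on (birth_time x) ?S" using gx by (auto simp: generic_def inj_on_def)
  ultimately obtain u where u: "u \<in> ?S" and card: "card {v \<in> ?S. birth_time x v \<le> birth_time x u} = n"
    using obtain_rank[OF fin _ n] by metis
  let ?s = "birth_time x u"
  have st: "?s \<le> t" and eu: "exists_ind x u" using u by (auto simp: born_def)
  then have B: "born x (ereal ?s) = {v \<in> ?S. birth_time x v \<le> ?s}" by (auto simp: born_def)
  then have cardB: "card (born x (ereal ?s)) = n" and finB: "finite (born x (ereal ?s))" using card fin by auto
  have "tau x n = ereal ?s"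
    unfolding tau_def
  proof (rule antisym)
    show "Inf {t. 0 \<le> t \<and> enat n \<le> Z x t} \<le> ereal ?s"
      using cardB finB birth_time_nonneg[OF gx, of u] by (intro Inf_lower) (simp add: Z_def)
    show "ereal ?s \<le> Inf {t. 0 \<le> t \<and> enat n \<le> Z x t}"
    proof (rule Inf_greatest, rule ccontr)
      fix t' assume t': "t' \<in> {t. 0 \<le> t \<and> enat n \<le> Z x t}" and "\<not> ereal ?s \<le> t'"
      then have less: "birth_time x v < ?s" if "ereal (birth_time x v) \<le> t'" for v
        using le_less_trans[OF that, of "ereal ?s"] by simp
      then have "born x t' \<subseteq> born x (ereal ?s)" "u \<notin> born x t'"
        by (auto simp: born_def intro: less_imp_le)
      moreover have "u \<in> born x (ereal ?s)" using eu by (simp add: born_def)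
      ultimately have "born x t' \<subset> born x (ereal ?s)" by auto
      then have "card (born x t') < n" "finite (born x t')"
        using psubset_card_mono[OF finB] finite_subset[OF psubset_imp_subset finB] cardB by simp_all
      with t' show False by (simp add: Z_def)
    qed
  qed
  then have tau: "born x (tau x n) = born x (ereal ?s)" by simp
  show "card (born x (tau x n)) = n" "finite (born x (tau x n))" unfolding tau by (fact cardB finB)+
  show "born x (tau x n) \<subseteq> born x (ereal t)" unfolding tau B by blast
  show "first_born x (born x (tau x n))" unfolding tau
    by (auto simp: first_born_def born_def not_le intro: le_less_trans)
  show "[] \<in> born x (tau x n)" unfolding tau using birth_time_nonneg[OF gx, of u] by (simp add: born_def)
qed

fun path_open :: "(edge \<Rightarrow> bool) \<Rightarrow> label \<Rightarrow> bool" where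
  "path_open \<kappa> [] \<longleftrightarrow> True"
| "path_open \<kappa> (k # u) \<longleftrightarrow> path_open \<kappa> u \<and> \<kappa> (u, k)"

text \<open>Openness of the line to the root is preserved along kept edges in both directions, so it
  holds throughout the component of the root. Conversely, ancestors of a born individual are born
  (\<open>born_Cons\<close>), so an open line runs inside the tree.\<close>

lemma cluster_root_eq:
  assumes gx: "generic x" and root: "[] \<in> born x t"
  shows "cluster x \<kappa> t [] = {w \<in> born x t. path_open \<kappa> w}"
proof -
  let ?R = "kept_adj x \<kappa> t \<union> (kept_adj x \<kappa> t)\<inverse>"
  have "path_open \<kappa> w" if "([], w) \<in> ?R\<^sup>*" for w
    using that
  proof (induction rule: rtrancl_induct)
    case (step y z)
    then show ?case by (auto simp: kept_adj_def)
  qed simp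
  moreover have "([], w) \<in> ?R\<^sup>*" if "w \<in> born x t" "path_open \<kappa> w" for w
    using that
  proof (induction w)
    case (Cons k u)
    have u: "u \<in> born x t" using born_Cons[OF gx Cons.prems(1)] .
    then have "(u, k # u) \<in> ?R" using Cons.prems by (auto simp: kept_adj_def tree_edges_def)
    moreover have "([], u) \<in> ?R\<^sup>*" using Cons u by simp
    ultimately show ?case by (metis rtrancl.rtrancl_into_rtrancl)
  qed simp
  ultimately show ?thesis by (auto simp: cluster_def)
qed

lemma nn_integral_labels: "(\<integral>\<^sup>+u. f u \<partial>count_space (UNIV :: label set)) = (\<Sum>k. gsum k f)"
proof -
  have "(\<integral>\<^sup>+u. f u \<partial>count_space (UNIV :: label set))
      = (\<integral>\<^sup>+u. (\<Sum>k. f u * indicator {u. length u = k} u) \<partial>count_space UNIV)"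
  proof (intro nn_integral_cong)
    fix u :: label
    have "(\<Sum>k. f u * indicator {u. length u = k} u) = (\<Sum>k\<in>{length u}. f u * indicator {u. length u = k} u)"
      by (intro suminf_finite) auto
    then show "f u = (\<Sum>k. f u * indicator {u. length u = k} u)" by simp
  qed
  also have "\<dots> = (\<Sum>k. \<integral>\<^sup>+u. f u * indicator {u. length u = k} u \<partial>count_space UNIV)"
    by (rule nn_integral_suminf) simp
  also have "\<dots> = (\<Sum>k. gsum k f)"
    unfolding gsum_def by (intro suminf_cong nn_integral_count_space_indicator[symmetric]) simp
  finally show ?thesis .
qed

context cmj
begin

section \<open>Almost sure properties of the family process\<close>

text \<open>The exponent 2 \<alpha> is taken because \<open>mu (2 * \<alpha>) < 1\<close> makes the
  expected generation sizes up to time \<open>t\<close> summable; at \<alpha> every generation would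
  have the same bound. Integer times suffice by monotonicity.\<close>

lemma AE_finite_born: "AE x in P. \<forall>t. finite (born x (ereal t))"
proof -
  have "AE x in P. finite (born x (ereal t))" for t
  proof -
    have meas: "{x \<in> space P. u \<in> born x (ereal t)} \<in> sets P" for u by measurable
    let ?r = "mu (2 * \<alpha>)" and ?c = "exp (2 * \<alpha> * t)"
    have r: "0 \<le> ?r" "?r < 1" using mu_pos[of "2 * \<alpha>"] alpha_pos mu_2_alpha_less_1 by simp_all
    have "(\<integral>\<^sup>+x. gsum k (indicator (born x (ereal t))) \<partial>P) = gsum k (\<lambda>u. emeasure P {x \<in> space P. u \<in> born x (ereal t)})" for k
    proof -
      have "(\<integral>\<^sup>+x. gsum k (indicator (born x (ereal t))) \<partial>P)
          = (\<integral>\<^sup>+x. gsum k (\<lambda>u. indicator {x \<in> space P. u \<in> born x (ereal t)} x) \<partial>P)"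
        by (intro nn_integral_cong gsum_cong) (simp add: indicator_def)
      also have "\<dots> = gsum k (\<lambda>u. \<integral>\<^sup>+x. indicator {x \<in> space P. u \<in> born x (ereal t)} x \<partial>P)"
        using meas by (intro nn_integral_gsum) (auto intro: P.sigma_finite_measure_axioms)
      finally show ?thesis using meas by simp
    qed
    then have k: "(\<integral>\<^sup>+x. gsum k (indicator (born x (ereal t))) \<partial>P) \<le> ennreal (?c * ?r ^ k)" for k
      using expected_born_le[of "2 * \<alpha>" k t] alpha_pos by simp
    have gm: "(\<lambda>x. gsum k (indicator (born x (ereal t)))) \<in> borel_measurable P" for k
    proof -
      have "(\<lambda>x. gsum k (\<lambda>u. indicator (born x (ereal t)) u)) \<in> borel_measurable P"
        unfolding indicator_def by (intro borel_measurable_gsum) measurable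
      then show ?thesis by simp
    qed
    have "(\<integral>\<^sup>+x. emeasure (count_space UNIV) (born x (ereal t)) \<partial>P)
        = (\<integral>\<^sup>+x. (\<Sum>k. gsum k (indicator (born x (ereal t)))) \<partial>P)"
      by (intro nn_integral_cong) (simp flip: nn_integral_labels)
    also have "\<dots> = (\<Sum>k. \<integral>\<^sup>+x. gsum k (indicator (born x (ereal t))) \<partial>P)"
      by (intro nn_integral_suminf gm)
    also have "\<dots> \<le> (\<Sum>k. ennreal (?c * ?r ^ k))"
      by (intro suminf_le k) auto
    also have "\<dots> < \<infinity>" using r by (subst suminf_geometric_ennreal) auto
    finally have "AE x in P. emeasure (count_space UNIV) (born x (ereal t)) \<noteq> \<infinity>"
      by (intro nn_integral_PInf_AE) auto
    then show ?thesis by eventually_elim (auto simp: emeasure_count_space split: if_splits)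
  qed
  then have "AE x in P. \<forall>t::nat. finite (born x (ereal (real t)))" by (simp add: AE_all_countable)
  then show ?thesis
  proof eventually_elim
    case (elim x)
    show ?case
    proof
      fix t :: real
      obtain m :: nat where "t \<le> real m" using real_arch_simple by blast
      then have "born x (ereal t) \<subseteq> born x (ereal (real m))" by (auto simp: born_def)
      with elim show "finite (born x (ereal t))" using finite_subset by blast
    qed
  qed
qed

lemma prob_birth_age_eq_0: "emeasure I {i \<in> space I. birth_age i k = a} = 0"
proof -
  interpret U: prob_space U by (rule prob_space_U)
  have "emeasure I {i \<in> space I. birth_age i k = a} = (\<integral>\<^sup>+i. indicator {i \<in> space I. birth_age i k = a} i \<partial>I)"
    by (rule nn_integral_indicator[symmetric]) measurable
  also have "\<dots> = (\<integral>\<^sup>+i. indicator {a} (birth_age i k) \<partial>I)"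
    by (intro nn_integral_cong) (auto simp: indicator_def)
  also have "\<dots> = (\<integral>\<^sup>+t. \<integral>\<^sup>+w. indicator {a} (birth_age (t, w) k) \<partial>W \<partial>U)"
  proof (rule nn_integral_individual)
    show "(\<lambda>i. indicator {a} (birth_age i k)) \<in> borel_measurable (U \<Otimes>\<^sub>M W)"
      unfolding individual_law_eq[symmetric] by measurable
  qed
  also have "\<dots> = (\<integral>\<^sup>+t. 0 \<partial>U)"
  proof (rule nn_integral_cong)
    fix t
    have "(\<integral>\<^sup>+w. indicator {a} (\<Sum>j\<le>k. w j) \<partial>W)
        = (\<integral>\<^sup>+y. ennreal (erlang_density k b y) * indicator {a} y \<partial>lborel)"
      by (rule distributed_nn_integral[OF distributed_sum_PiM_exponential[OF b_pos], symmetric]) simp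
    also have "\<dots> = 0"
      using AE_lborel_singleton[of a] by (subst nn_integral_0_iff_AE) (auto elim: eventually_mono)
    finally show "(\<integral>\<^sup>+w. indicator {a} (birth_age (t, w) k) \<partial>W) = 0" by (simp add: birth_age_def)
  qed
  finally show ?thesis by simp
qed

text \<open>Let \<open>u\<close> be no shorter than \<open>v\<close>, with mother \<open>u0\<close>.
  Unless \<open>v\<close> is a sibling of \<open>u\<close>, the length condition keeps
  \<open>u0\<close> from being a proper ancestor of \<open>v\<close>; resampling the data of
  \<open>u0\<close> then gives the birth time of \<open>u\<close> a continuous law while that of
  \<open>v\<close> stays fixed. Siblings are separated by positive waiting times.\<close>

lemma AE_birth_times_distinct: "AE x in P. \<forall>u v. u \<noteq> v \<longrightarrow> birth_time x u \<noteq> birth_time x v"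
proof -
  have pair: "AE x in P. birth_time x u \<noteq> birth_time x v" if uv: "u \<noteq> v" "length v \<le> length u" for u v
  proof -
    obtain k u0 where u: "u = k # u0" using uv by (cases u) auto
    show ?thesis
    proof (cases "\<exists>l. v = l # u0")
      case True
      then obtain l where v: "v = l # u0" "k \<noteq> l" using uv u by auto
      show ?thesis
        using AE_waiting_pos
      proof eventually_elim
        case (elim x)
        have less: "birth_age (x u0) i < birth_age (x u0) j" if "i < j" for i j
          unfolding birth_age_def using elim that
          by (intro sum_strict_mono2[of _ _ j]) (auto intro: less_imp_le)
        show ?case using less[of k l] less[of l k] v(2) by (cases "k < l") (auto simp: u v)
      qed
    next
      case False
      have nv: "\<not> strict_suffix u0 v"
      proof
        assume "strict_suffix u0 v"
        then obtain w where w: "v = w @ u0" "w \<noteq> []" by (auto simp: strict_suffix_def suffix_def)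
        with uv(2) u have "length w = 1" by (cases w) auto
        with w False show False by (auto simp: length_Suc_conv)
      qed
      have nu: "\<not> strict_suffix u0 u0" by simp
      have "emeasure P {x \<in> space P. birth_time x u = birth_time x v}
          = (\<integral>\<^sup>+x. indicator {x \<in> space P. birth_time x u = birth_time x v} x \<partial>P)"
        by (rule nn_integral_indicator[symmetric]) measurable
      also have "\<dots> = (\<integral>\<^sup>+x. indicator {x. birth_time x u = birth_time x v} x \<partial>P)"
        by (intro nn_integral_cong) (auto simp: indicator_def)
      also have "\<dots> = (\<integral>\<^sup>+x. \<integral>\<^sup>+i. indicator {x. birth_time x u = birth_time x v} (x(u0 := i)) \<partial>I \<partial>P)"
        unfolding process_law_def
      proof (rule nn_integral_PiM_resample[OF prob_space_I])
        have [measurable]: "Measurable.pred P (\<lambda>x. birth_time x u = birth_time x v)"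
          unfolding pred_def by measurable
        have "(\<lambda>x. indicator {x. birth_time x u = birth_time x v} x :: ennreal) \<in> borel_measurable P"
          unfolding indicator_def by measurable
        then show "indicator {x. birth_time x u = birth_time x v} \<in> borel_measurable (\<Pi>\<^sub>M u\<in>UNIV. I)"
          by (simp add: process_law_def)
      qed
      also have "\<dots> = (\<integral>\<^sup>+x. emeasure I {i \<in> space I. birth_age i k = birth_time x v - birth_time x u0} \<partial>P)"
      proof (rule nn_integral_cong)
        fix x
        have "(\<integral>\<^sup>+i. indicator {x. birth_time x u = birth_time x v} (x(u0 := i)) \<partial>I)
            = (\<integral>\<^sup>+i. indicator {i \<in> space I. birth_age i k = birth_time x v - birth_time x u0} i \<partial>I)"
          by (intro nn_integral_cong)
             (auto simp: indicator_def u exists_birth_update[OF nv] exists_birth_update[OF nu])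
        also have "\<dots> = emeasure I {i \<in> space I. birth_age i k = birth_time x v - birth_time x u0}"
          by (rule nn_integral_indicator) measurable
        finally show "(\<integral>\<^sup>+i. indicator {x. birth_time x u = birth_time x v} (x(u0 := i)) \<partial>I)
            = emeasure I {i \<in> space I. birth_age i k = birth_time x v - birth_time x u0}" .
      qed
      also have "\<dots> = 0" by (simp add: prob_birth_age_eq_0)
      finally show ?thesis by (subst AE_iff_measurable[OF _ refl]) auto
    qed
  qed
  have "AE x in P. u \<noteq> v \<longrightarrow> birth_time x u \<noteq> birth_time x v" for u v
  proof (cases "u = v")
    case False
    show ?thesis
    proof (cases "length v \<le> length u")
      case True
      from pair[OF False this] show ?thesis by eventually_elim simp
    next
      case False': False
      have "AE x in P. birth_time x v \<noteq> birth_time x u" using False False' by (intro pair) auto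
      then show ?thesis by eventually_elim auto
    qed
  qed simp
  then show ?thesis by (simp add: AE_all_countable)
qed

lemma AE_generic: "AE x in P. generic x"
  using AE_waiting_pos AE_birth_times_distinct AE_finite_born
  by eventually_elim (simp add: generic_def)

lemma measurable_first_born[measurable]: "Measurable.pred P (\<lambda>x. first_born x B)"
  unfolding first_born_def Ball_def by measurable

end

subsection \<open>Percolation on a fixed tree\<close>

fun path_edges :: "label \<Rightarrow> edge set" where
  "path_edges [] = {}"
| "path_edges (k # u) = insert (u, k) (path_edges u)"

lemma path_edges_iff: "(w, k) \<in> path_edges u \<longleftrightarrow> suffix (k # w) u"
  by (induction u) (auto simp: suffix_Cons)

lemma finite_path_edges[simp]: "finite (path_edges u)"
  by (induction u) auto

lemma card_path_edges: "card (path_edges u) = length u"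
proof (induction u)
  case (Cons k u)
  have "(u, k) \<notin> path_edges u"
    unfolding path_edges_iff using suffix_length_le by fastforce
  with Cons show ?case by simp
qed simp

lemma path_open_iff: "path_open \<kappa> u \<longleftrightarrow> (\<forall>e\<in>path_edges u. \<kappa> e)"
  by (induction u) auto

text \<open>Along one ancestral line an edge is determined by the height of its parent end. A common
  edge whose parent end has height at least \<open>J\<close> would yield a common ancestor in
  generation \<open>J\<close>.\<close>

lemma card_path_edges_Int:
  assumes "\<not> meet_at J u v"
  shows "card (path_edges u \<inter> path_edges v) \<le> J"
proof -
  let ?E = "path_edges u \<inter> path_edges v"
  have "inj_on (\<lambda>e. length (fst e)) (path_edges u)"
  proof (rule inj_onI)
    fix e e' assume "e \<in> path_edges u" "e' \<in> path_edges u" and len: "length (fst e) = length (fst e')"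
    then have "suffix (snd e # fst e) u" "suffix (snd e' # fst e') u"
      by (metis path_edges_iff prod.collapse)+
    with len have "snd e # fst e = snd e' # fst e'"
      by (auto simp: suffix_def)
    then show "e = e'" by (simp add: prod_eq_iff)
  qed
  then have "card ?E = card ((\<lambda>e. length (fst e)) ` ?E)"
    by (intro card_image[symmetric]) (auto intro: inj_on_subset)
  also have "\<dots> \<le> card {..<J}"
  proof (intro card_mono)
    show "(\<lambda>e. length (fst e)) ` ?E \<subseteq> {..<J}"
    proof
      fix l assume "l \<in> (\<lambda>e. length (fst e)) ` ?E"
      then obtain w k where l: "l = length w" and "(w, k) \<in> path_edges u" "(w, k) \<in> path_edges v" by auto
      then have suf: "suffix w u" "suffix w v"
        unfolding path_edges_iff by (metis suffix_ConsD)+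
      show "l \<in> {..<J}"
      proof (rule ccontr)
        assume "l \<notin> {..<J}"
        then have J: "J \<le> length w" using l by simp
        define w' where "w' = drop (length w - J) w"
        have w': "length w' = J" "suffix w' w" using J by (auto simp: w'_def suffix_drop)
        have "suffix w' u" "suffix w' v" using suffix_order.trans[OF w'(2)] suf by auto
        with w'(1) have "meet_at J u v" unfolding meet_at_def by blast
        with assms show False by simp
      qed
    qed
  qed simp
  finally show ?thesis by simp
qed

lemma card_path_edges_Un:
  assumes "\<not> meet_at J u v"
  shows "length u + length v \<le> card (path_edges u \<union> path_edges v) + J"
  using card_Un_Int[of "path_edges u" "path_edges v"] card_path_edges_Int[OF assms]
  by (simp add: card_path_edges)

lemma prob_space_percolation: "prob_space (percolation_law p)"
  unfolding percolation_law_def by (intro prob_space_PiM prob_space_measure_pmf)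

lemma space_percolation[simp]: "space (percolation_law p) = UNIV"
  by (simp add: percolation_law_def space_PiM)

lemma measurable_edge: "(\<lambda>\<kappa>. \<kappa> e) \<in> percolation_law p \<rightarrow>\<^sub>M count_space UNIV"
proof -
  have "(\<lambda>\<kappa>. \<kappa> e) \<in> percolation_law p \<rightarrow>\<^sub>M measure_pmf (bernoulli_pmf p)"
    unfolding percolation_law_def by measurable
  then show ?thesis by simp
qed

lemma measurable_path_open[measurable]: "Measurable.pred (percolation_law p) (\<lambda>\<kappa>. path_open \<kappa> u)"
proof (induction u)
  case (Cons k u)
  note [measurable] = Cons measurable_edge[of "(u, k)" p]
  show ?case unfolding path_open.simps by measurable
qed simp

lemma prob_edges_open:
  assumes p: "0 \<le> p" "p \<le> 1" and J: "finite J"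
  shows "measure (percolation_law p) {\<kappa>. \<forall>e\<in>J. \<kappa> e} = p ^ card J"
proof -
  interpret product_prob_space "\<lambda>_ :: edge. measure_pmf (bernoulli_pmf p)" UNIV
    by (intro product_prob_spaceI prob_space_measure_pmf)
  have "emeasure (percolation_law p) {\<kappa>. \<forall>e\<in>J. \<kappa> e} = (\<Prod>e\<in>J. emeasure (measure_pmf (bernoulli_pmf p)) {True})"
    using emeasure_PiM_Collect[of J "\<lambda>_. {True}"] J
    by (simp add: percolation_law_def space_PiM)
  also have "\<dots> = ennreal (p ^ card J)"
    using p by (simp add: emeasure_pmf_single ennreal_power)
  finally show ?thesis using p by (simp add: measure_def)
qed

text \<open>The moment is taken about the target \<open>y * card B\<close>, not about the mean, so
  that bias and fluctuations are controlled at once. Two individuals are both connected to the root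
  exactly if all edges in the union of their lines are kept.\<close>

lemma percolation_second_moment:
  fixes y :: real
  assumes p: "0 \<le> p" "p \<le> 1" and B: "finite B"
  shows "(LINT \<kappa>|percolation_law p. (real (card {w \<in> B. path_open \<kappa> w}) - y * real (card B))\<^sup>2)
    = (\<Sum>u\<in>B. \<Sum>v\<in>B. p ^ card (path_edges u \<union> path_edges v) - y * p ^ length u - y * p ^ length v + y\<^sup>2)"
    and "integrable (percolation_law p) (\<lambda>\<kappa>. (real (card {w \<in> B. path_open \<kappa> w}) - y * real (card B))\<^sup>2)"
proof -
  interpret prob_space "percolation_law p" by (rule prob_space_percolation)
  let ?i = "\<lambda>w \<kappa>. of_bool (path_open \<kappa> w) :: real"
  have eq: "(real (card {w \<in> B. path_open \<kappa> w}) - y * real (card B))\<^sup>2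
      = (\<Sum>u\<in>B. \<Sum>v\<in>B. ?i u \<kappa> * ?i v \<kappa> - y * ?i u \<kappa> - y * ?i v \<kappa> + y\<^sup>2)" for \<kappa>
  proof -
    have "real (card {w \<in> B. path_open \<kappa> w}) - y * real (card B) = (\<Sum>w\<in>B. ?i w \<kappa> - y)"
      using B by (simp add: sum_subtractf Int_def of_bool_def sum.If_cases mult.commute)
    then have "(real (card {w \<in> B. path_open \<kappa> w}) - y * real (card B))\<^sup>2 = (\<Sum>u\<in>B. \<Sum>v\<in>B. (?i u \<kappa> - y) * (?i v \<kappa> - y))"
      by (simp only: power2_eq_square sum_product)
    then show ?thesis by (simp add: algebra_simps power2_eq_square)
  qed
  have int1: "integrable (percolation_law p) (?i u)" for u
    by (intro integrable_const_bound[where B = 1]) auto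
  have int2: "integrable (percolation_law p) (\<lambda>\<kappa>. ?i u \<kappa> * ?i v \<kappa>)" for u v
    by (intro integrable_const_bound[where B = 1]) auto
  have m: "{\<kappa>. path_open \<kappa> u} \<in> events" for u
    using measurable_path_open[where p = p and u = u] unfolding pred_def by simp
  have e2: "(LINT \<kappa>|percolation_law p. ?i u \<kappa> * ?i v \<kappa>) = p ^ card (path_edges u \<union> path_edges v)" for u v
  proof -
    have "(LINT \<kappa>|percolation_law p. ?i u \<kappa> * ?i v \<kappa>) = (LINT \<kappa>|percolation_law p. indicator {\<kappa>. \<forall>e\<in>path_edges u \<union> path_edges v. \<kappa> e} \<kappa>)"
      by (intro Bochner_Integration.integral_cong) (auto simp: path_open_iff indicator_def)
    also have "\<dots> = prob ({\<kappa>. \<forall>e\<in>path_edges u \<union> path_edges v. \<kappa> e} \<inter> space (percolation_law p))"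
      by (simp only: Bochner_Integration.integral_indicator)
    finally show ?thesis using p by (simp add: prob_edges_open)
  qed
  have e1: "(LINT \<kappa>|percolation_law p. ?i u \<kappa>) = p ^ length u" for u
    using e2[of u u] by (simp add: card_path_edges flip: of_bool_conj)
  show "(LINT \<kappa>|percolation_law p. (real (card {w \<in> B. path_open \<kappa> w}) - y * real (card B))\<^sup>2)
    = (\<Sum>u\<in>B. \<Sum>v\<in>B. p ^ card (path_edges u \<union> path_edges v) - y * p ^ length u - y * p ^ length v + y\<^sup>2)"
    unfolding eq using int1 int2 prob_space by (simp add: e1 e2)
  show "integrable (percolation_law p) (\<lambda>\<kappa>. (real (card {w \<in> B. path_open \<kappa> w}) - y * real (card B))\<^sup>2)"
    unfolding eq using int1 int2 by (intro Bochner_Integration.integrable_sum Bochner_Integration.integrable_add Bochner_Integration.integrable_diff) auto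
qed

lemma sum_indicator_subset:
  assumes "finite A" "Q \<subseteq> A"
  shows "(\<Sum>z\<in>A. indicator Q z) = real (card Q)"
proof -
  have "(\<Sum>z\<in>A. indicator Q z) = (\<Sum>z\<in>Q. 1 :: real)"
    using assms by (intro sum.mono_neutral_cong_right) auto
  then show ?thesis by simp
qed

text \<open>Pairs enter the second clause only with both heights at most \<open>hi\<close>: the
  others are covered by the first clause, and the cap leaves few generations to sum over when pairs
  are counted in expectation.\<close>

definition typical :: "real \<Rightarrow> real \<Rightarrow> nat \<Rightarrow> real \<Rightarrow> label set \<Rightarrow> bool" where
  "typical lo hi J \<delta> B \<longleftrightarrow> real (card {u \<in> B. \<not> (lo \<le> real (length u) \<and> real (length u) \<le> hi)}) \<le> \<delta> * real (card B) \<and>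
    real (card {(u, v). u \<in> B \<and> v \<in> B \<and> real (length u) \<le> hi \<and> real (length v) \<le> hi \<and> meet_at J u v}) \<le> \<delta> * (real (card B))\<^sup>2"

text \<open>Chebyshev's inequality about \<open>y\<close>. The lines of a good pair have together at
  least 2 lo - J edges and each at most hi, which bounds its term by the expression in bars. Any
  other pair contributes at most 2; with n = \<open>card B\<close> there are at most 2 \<delta> n^2
  pairs with a bad height and \<delta> n^2 with a late common ancestor, whence 6 \<delta>.\<close>

lemma prob_cluster_deviation_le:
  fixes y :: real
  assumes p: "0 < p" "p < 1" and B: "finite B" "B \<noteq> {}" and tp: "typical lo hi J \<delta> B"
    and y: "0 \<le> y" "y \<le> 1" and \<epsilon>: "\<epsilon> > 0" and \<delta>: "\<delta> \<ge> 0"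
  shows "measure (percolation_law p) {\<kappa>. \<bar>real (card {w \<in> B. path_open \<kappa> w}) / real (card B) - y\<bar> > \<epsilon>}
    \<le> (\<bar>p powr (2 * lo - real J) - 2 * y * p powr hi + y\<^sup>2\<bar> + 6 * \<delta>) / \<epsilon>\<^sup>2"
proof -
  interpret prob_space "percolation_law p" by (rule prob_space_percolation)
  define n where "n = real (card B)"
  have n: "n > 0" using B by (simp add: n_def card_gt_0_iff)
  define r where "r = \<bar>p powr (2 * lo - real J) - 2 * y * p powr hi + y\<^sup>2\<bar>"
  let ?bad = "{u \<in> B. \<not> (lo \<le> real (length u) \<and> real (length u) \<le> hi)}"
  let ?pairs = "{(u, v). u \<in> B \<and> v \<in> B \<and> real (length u) \<le> hi \<and> real (length v) \<le> hi \<and> meet_at J u v}"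
  let ?t = "\<lambda>u v. p ^ card (path_edges u \<union> path_edges v) - y * p ^ length u - y * p ^ length v + y\<^sup>2"
  let ?X = "\<lambda>\<kappa>. real (card {w \<in> B. path_open \<kappa> w}) - y * real (card B)"
  have y2: "y\<^sup>2 \<le> 1" using y by (simp add: power_le_one)
  have le2: "?t u v \<le> 2" for u v
  proof -
    have "p ^ card (path_edges u \<union> path_edges v) \<le> 1" using p by (intro power_le_one) auto
    moreover have "0 \<le> y * p ^ length u" "0 \<le> y * p ^ length v" using y p by auto
    ultimately show ?thesis using y2 by linarith
  qed
  have term_le: "?t u v \<le> r + 2 * indicator ?bad u + 2 * indicator ?bad v + 2 * indicator ?pairs (u, v)" if uv: "u \<in> B" "v \<in> B" for u v
  proof (cases "u \<in> ?bad \<or> v \<in> ?bad \<or> (u, v) \<in> ?pairs")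
    case True
    then have "2 \<le> 2 * indicator ?bad u + 2 * indicator ?bad v + 2 * (indicator ?pairs (u, v) :: real)"
      by (auto simp: indicator_def)
    moreover have "r \<ge> 0" by (simp add: r_def)
    ultimately show ?thesis using le2[of u v] by linarith
  next
    case False
    then have h: "lo \<le> real (length u)" "real (length u) \<le> hi" "lo \<le> real (length v)" "real (length v) \<le> hi"
      and meet: "\<not> meet_at J u v" using uv by auto
    have "p ^ card (path_edges u \<union> path_edges v) = p powr real (card (path_edges u \<union> path_edges v))"
      using p by (simp add: powr_realpow)
    also have "\<dots> \<le> p powr (2 * lo - real J)"
      using p h card_path_edges_Un[OF meet] by (intro powr_mono') auto
    finally have 1: "p ^ card (path_edges u \<union> path_edges v) \<le> p powr (2 * lo - real J)" .
    have 2: "p powr hi \<le> p ^ length w" if "real (length w) \<le> hi" for w :: label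
      using that p by (subst powr_realpow[symmetric]) (auto intro!: powr_mono')
    have "y * p powr hi \<le> y * p ^ length u" "y * p powr hi \<le> y * p ^ length v"
      using y h by (auto intro!: mult_left_mono 2)
    with 1 have "?t u v \<le> r" unfolding r_def by linarith
    with False show ?thesis by simp
  qed
  have "(\<Sum>u\<in>B. \<Sum>v\<in>B. ?t u v) \<le> (\<Sum>u\<in>B. \<Sum>v\<in>B. r + 2 * indicator ?bad u + 2 * indicator ?bad v + 2 * indicator ?pairs (u, v))"
    by (intro sum_mono term_le)
  also have "\<dots> = n * n * r + 4 * n * real (card ?bad) + 2 * real (card ?pairs)"
  proof -
    have b: "(\<Sum>u\<in>B. indicator ?bad u) = real (card ?bad)"
      using B by (intro sum_indicator_subset) auto
    have "(\<Sum>u\<in>B. \<Sum>v\<in>B. indicator ?pairs (u, v)) = (\<Sum>z\<in>B \<times> B. indicator ?pairs z :: real)"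
      by (subst sum.cartesian_product) (intro sum.cong refl, auto split: prod.split)
    also have "\<dots> = real (card ?pairs)"
      using B by (intro sum_indicator_subset) auto
    finally have c: "(\<Sum>u\<in>B. \<Sum>v\<in>B. indicator ?pairs (u, v)) = real (card ?pairs)" .
    have "(\<Sum>u\<in>B. \<Sum>v\<in>B. r + 2 * indicator ?bad u + 2 * indicator ?bad v + 2 * indicator ?pairs (u, v))
        = n * n * r + 2 * n * (\<Sum>u\<in>B. indicator ?bad u) + 2 * n * (\<Sum>v\<in>B. indicator ?bad v)
          + 2 * (\<Sum>u\<in>B. \<Sum>v\<in>B. indicator ?pairs (u, v))"
      by (simp add: sum.distrib sum_distrib_left[symmetric] sum_distrib_right[symmetric] n_def algebra_simps)
    then show ?thesis unfolding b c by simp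
  qed
  also have "\<dots> \<le> n * n * r + 4 * n * (\<delta> * n) + 2 * (\<delta> * n\<^sup>2)"
    using tp n unfolding typical_def n_def[symmetric] by (intro add_mono mult_left_mono) auto
  also have "\<dots> = (r + 6 * \<delta>) * n\<^sup>2" by (simp add: power2_eq_square algebra_simps)
  finally have E: "(LINT \<kappa>|percolation_law p. (?X \<kappa>)\<^sup>2) \<le> (r + 6 * \<delta>) * n\<^sup>2"
    using percolation_second_moment(1)[of p B y] p B by simp
  have "{\<kappa>. \<bar>real (card {w \<in> B. path_open \<kappa> w}) / real (card B) - y\<bar> > \<epsilon>}
      \<subseteq> {\<kappa> \<in> space (percolation_law p). (\<epsilon> * n)\<^sup>2 \<le> (?X \<kappa>)\<^sup>2}"
  proof
    fix \<kappa> assume "\<kappa> \<in> {\<kappa>. \<bar>real (card {w \<in> B. path_open \<kappa> w}) / real (card B) - y\<bar> > \<epsilon>}"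
    moreover have "?X \<kappa> = (real (card {w \<in> B. path_open \<kappa> w}) / real (card B) - y) * n"
      using n by (simp add: n_def field_simps)
    ultimately have "\<epsilon> * n \<le> \<bar>?X \<kappa>\<bar>" using n by (simp add: abs_mult)
    then have "(\<epsilon> * n)\<^sup>2 \<le> (?X \<kappa>)\<^sup>2" using n \<epsilon> by (simp add: abs_le_square_iff[symmetric])
    then show "\<kappa> \<in> {\<kappa> \<in> space (percolation_law p). (\<epsilon> * n)\<^sup>2 \<le> (?X \<kappa>)\<^sup>2}" by simp
  qed
  moreover have card_m: "(\<lambda>\<kappa>. real (card {w \<in> B. path_open \<kappa> w})) \<in> borel_measurable (percolation_law p)"
  proof -
    have "real (card {w \<in> B. path_open \<kappa> w}) = (\<Sum>w\<in>B. of_bool (path_open \<kappa> w))" for \<kappa>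
      using B by (simp add: Int_def of_bool_def sum.If_cases)
    then show ?thesis by simp
  qed
  moreover have "{\<kappa> \<in> space (percolation_law p). (\<epsilon> * n)\<^sup>2 \<le> (?X \<kappa>)\<^sup>2} \<in> events"
    by (intro borel_measurable_le borel_measurable_const borel_measurable_power borel_measurable_diff card_m)
  ultimately have "prob {\<kappa>. \<bar>real (card {w \<in> B. path_open \<kappa> w}) / real (card B) - y\<bar> > \<epsilon>}
      \<le> prob {\<kappa> \<in> space (percolation_law p). (\<epsilon> * n)\<^sup>2 \<le> (?X \<kappa>)\<^sup>2}"
    by (intro finite_measure_mono)
  also have "\<dots> \<le> (LINT \<kappa>|percolation_law p. (?X \<kappa>)\<^sup>2) / (\<epsilon> * n)\<^sup>2"
    using percolation_second_moment(2)[of p B y] p B n \<epsilon> sets.top[of "percolation_law p"]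
    by (intro integral_Markov_inequality_measure[where A = "space (percolation_law p)"]) auto
  also have "\<dots> \<le> (r + 6 * \<delta>) * n\<^sup>2 / (\<epsilon> * n)\<^sup>2" by (intro divide_right_mono E) simp
  also have "\<dots> = (r + 6 * \<delta>) / \<epsilon>\<^sup>2" using n by (simp add: power_mult_distrib)
  finally show ?thesis by (simp add: r_def)
qed

subsection \<open>Typical trees\<close>

lemma expected_count:
  fixes R :: "'a \<Rightarrow> 'b :: countable \<Rightarrow> bool"
  assumes "sigma_finite_measure M" and R: "\<And>z. Measurable.pred M (\<lambda>x. R x z)"
  shows "(\<integral>\<^sup>+x. emeasure (count_space UNIV) {z. R x z} \<partial>M) = (\<integral>\<^sup>+z. emeasure M {x \<in> space M. R x z} \<partial>count_space UNIV)"
    and "(\<lambda>x. emeasure (count_space UNIV) {z. R x z}) \<in> borel_measurable M"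
proof -
  interpret M: sigma_finite_measure M by fact
  interpret A: sigma_finite_measure "count_space (UNIV :: 'b set)"
    by (rule sigma_finite_measure_count_space_countable) simp
  interpret AB: pair_sigma_finite "count_space (UNIV :: 'b set)" M ..
  have m: "(\<lambda>(z, x). indicator {z. R x z} z :: ennreal) \<in> borel_measurable (count_space UNIV \<Otimes>\<^sub>M M)"
    using R by (intro measurable_pair_measure_countable1) (auto simp: indicator_def)
  have "(\<integral>\<^sup>+x. emeasure (count_space UNIV) {z. R x z} \<partial>M) = (\<integral>\<^sup>+x. \<integral>\<^sup>+z. indicator {z. R x z} z \<partial>count_space UNIV \<partial>M)"
    by simp
  also have "\<dots> = (\<integral>\<^sup>+z. \<integral>\<^sup>+x. indicator {z. R x z} z \<partial>M \<partial>count_space UNIV)"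
    by (rule AB.Fubini'[OF m])
  also have "\<dots> = (\<integral>\<^sup>+z. emeasure M {x \<in> space M. R x z} \<partial>count_space UNIV)"
  proof (rule nn_integral_cong)
    fix z
    have "(\<integral>\<^sup>+x. indicator {z. R x z} z \<partial>M) = (\<integral>\<^sup>+x. indicator {x \<in> space M. R x z} x \<partial>M)"
      by (intro nn_integral_cong) (auto simp: indicator_def)
    also have "\<dots> = emeasure M {x \<in> space M. R x z}"
      using R by (intro nn_integral_indicator) measurable
    finally show "(\<integral>\<^sup>+x. indicator {z. R x z} z \<partial>M) = emeasure M {x \<in> space M. R x z}" .
  qed
  finally show "(\<integral>\<^sup>+x. emeasure (count_space UNIV) {z. R x z} \<partial>M) = (\<integral>\<^sup>+z. emeasure M {x \<in> space M. R x z} \<partial>count_space UNIV)" .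
  have "case_prod (\<lambda>x z. indicator {z. R x z} z :: ennreal) \<in> borel_measurable (M \<Otimes>\<^sub>M count_space UNIV)"
    using measurable_pair_swap[OF m] by simp
  from A.borel_measurable_nn_integral[OF this]
  show "(\<lambda>x. emeasure (count_space UNIV) {z. R x z}) \<in> borel_measurable M" by simp
qed

lemma (in prob_space) prob_ge_le_nn_integral:
  assumes u: "u \<in> borel_measurable M" and c: "c > 0" and le: "(\<integral>\<^sup>+x. u x \<partial>M) \<le> ennreal m" and m: "m \<ge> 0"
  shows "prob {x \<in> space M. ennreal c \<le> u x} \<le> m / c"
proof -
  let ?A = "{x \<in> space M. ennreal c \<le> u x}"
  have A: "?A \<in> events" using u by measurable
  have "ennreal c * emeasure M ?A = (\<integral>\<^sup>+x. ennreal c * indicator ?A x \<partial>M)"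
    using A by (simp add: nn_integral_cmult_indicator)
  also have "\<dots> \<le> (\<integral>\<^sup>+x. u x \<partial>M)"
    by (intro nn_integral_mono) (auto simp: indicator_def)
  also note le
  finally have "c * prob ?A \<le> m"
    using c m by (simp add: emeasure_eq_measure flip: ennreal_mult')
  then show ?thesis using c by (simp add: pos_le_divide_eq mult.commute)
qed

context cmj
begin

text \<open>Counted in the whole population at a deterministic time, where expectations are
  available, and not among the individuals of the stopped tree.\<close>

definition bad_heights :: "real \<Rightarrow> real \<Rightarrow> real \<Rightarrow> (label \<Rightarrow> individual) \<Rightarrow> label set" where
  "bad_heights \<epsilon> \<eta> L x = {u. u \<in> born x (ereal ((1 + \<eta>) * L / \<alpha>)) \<and> \<bar>real (length u) - L / dPsi\<bar> > \<epsilon> * L}"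

definition bad_pairs :: "real \<Rightarrow> real \<Rightarrow> real \<Rightarrow> (label \<Rightarrow> individual) \<Rightarrow> (label \<times> label) set" where
  "bad_pairs \<epsilon> \<eta> L x = {z. fst z \<in> born x (ereal ((1 + \<eta>) * L / \<alpha>)) \<and> snd z \<in> born x (ereal ((1 + \<eta>) * L / \<alpha>)) \<and>
    real (length (fst z)) \<le> L / dPsi + \<epsilon> * L \<and> real (length (snd z)) \<le> L / dPsi + \<epsilon> * L \<and>
    meet_at (nat \<lceil>\<epsilon> * L\<rceil>) (fst z) (snd z)}"

lemma measurable_bad_heights[measurable]:
  "(\<lambda>x. emeasure (count_space UNIV) (bad_heights \<epsilon> \<eta> L x)) \<in> borel_measurable P"
  unfolding bad_heights_def by (rule expected_count(2)) (auto intro: P.sigma_finite_measure_axioms)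

lemma measurable_bad_pairs[measurable]:
  "(\<lambda>x. emeasure (count_space UNIV) (bad_pairs \<epsilon> \<eta> L x)) \<in> borel_measurable P"
  unfolding bad_pairs_def by (rule expected_count(2)) (auto intro: P.sigma_finite_measure_axioms)

text \<open>Markov's inequality: the mean is of order exp ((1 - \<gamma>) L) against a threshold of
  order exp L. The claim is for all \<eta> up to a bound, by monotonicity in \<eta>, so that a
  common value can later be used for heights and pairs.\<close>

lemma prob_bad_heights_tendsto_0:
  assumes \<epsilon>: "\<epsilon> > 0" and \<delta>: "\<delta> > 0"
  obtains \<eta>0 where "\<eta>0 > 0" "\<And>\<eta>. \<eta> \<le> \<eta>0 \<Longrightarrow>
    ((\<lambda>L. P.prob {x \<in> space P. ennreal (\<delta> * exp L) \<le> emeasure (count_space UNIV) (bad_heights \<epsilon> \<eta> L x)}) \<longlongrightarrow> 0) at_top"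
proof -
  obtain \<eta>0 \<gamma> C where \<eta>0: "\<eta>0 > 0" and \<gamma>: "\<gamma> > 0" and C: "C > 0"
    and le: "\<And>L. L \<ge> 0 \<Longrightarrow> (\<Sum>k. if \<bar>real k - L / dPsi\<bar> > \<epsilon> * L
        then gsum k (\<lambda>u. emeasure P {x \<in> space P. u \<in> born x (ereal ((1 + \<eta>0) * L / \<alpha>))}) else 0)
      \<le> ennreal (C * exp ((1 - \<gamma>) * L))"
    by (rule expected_bad_heights_le[OF \<epsilon>]) (rule that)
  show thesis
  proof (rule that[OF \<eta>0])
    fix \<eta> assume \<eta>: "\<eta> \<le> \<eta>0"
    let ?p = "\<lambda>\<eta> L. P.prob {x \<in> space P. ennreal (\<delta> * exp L) \<le> emeasure (count_space UNIV) (bad_heights \<epsilon> \<eta> L x)}"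
    have bound: "?p \<eta> L \<le> C / \<delta> * exp (- \<gamma> * L)" if L: "L \<ge> 0" for L
    proof -
      have "bad_heights \<epsilon> \<eta> L x \<subseteq> bad_heights \<epsilon> \<eta>0 L x" for x
      proof -
        have "(1 + \<eta>) * L / \<alpha> \<le> (1 + \<eta>0) * L / \<alpha>"
          using \<eta> L alpha_pos by (intro divide_right_mono mult_right_mono) auto
        then have "born x (ereal ((1 + \<eta>) * L / \<alpha>)) \<subseteq> born x (ereal ((1 + \<eta>0) * L / \<alpha>))"
          unfolding mem_born subset_eq by (metis mem_born order_trans)
        then show ?thesis unfolding bad_heights_def by blast
      qed
      then have "emeasure (count_space UNIV) (bad_heights \<epsilon> \<eta> L x) \<le> emeasure (count_space UNIV) (bad_heights \<epsilon> \<eta>0 L x)" for x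
        by (intro emeasure_mono) auto
      then have "?p \<eta> L \<le> ?p \<eta>0 L"
        by (intro P.finite_measure_mono) (auto intro: order_trans)
      also have "\<dots> \<le> (C * exp ((1 - \<gamma>) * L)) / (\<delta> * exp L)"
      proof (rule P.prob_ge_le_nn_integral)
        have "(\<integral>\<^sup>+x. emeasure (count_space UNIV) (bad_heights \<epsilon> \<eta>0 L x) \<partial>P)
            = (\<integral>\<^sup>+u. emeasure P {x \<in> space P. u \<in> born x (ereal ((1 + \<eta>0) * L / \<alpha>)) \<and> \<bar>real (length u) - L / dPsi\<bar> > \<epsilon> * L} \<partial>count_space UNIV)"
          unfolding bad_heights_def by (rule expected_count(1)) (auto intro: P.sigma_finite_measure_axioms)
        also have "\<dots> = (\<Sum>k. if \<bar>real k - L / dPsi\<bar> > \<epsilon> * L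
            then gsum k (\<lambda>u. emeasure P {x \<in> space P. u \<in> born x (ereal ((1 + \<eta>0) * L / \<alpha>))}) else 0)"
          unfolding nn_integral_labels
        proof (intro suminf_cong)
          fix k
          show "gsum k (\<lambda>u. emeasure P {x \<in> space P. u \<in> born x (ereal ((1 + \<eta>0) * L / \<alpha>)) \<and> \<bar>real (length u) - L / dPsi\<bar> > \<epsilon> * L})
            = (if \<bar>real k - L / dPsi\<bar> > \<epsilon> * L
            then gsum k (\<lambda>u. emeasure P {x \<in> space P. u \<in> born x (ereal ((1 + \<eta>0) * L / \<alpha>))}) else 0)"
          proof (cases "\<bar>real k - L / dPsi\<bar> > \<epsilon> * L")
            case True
            then show ?thesis by (simp cong: gsum_cong)
          next
            case False
            then have "gsum k (\<lambda>u. emeasure P {x \<in> space P. u \<in> born x (ereal ((1 + \<eta>0) * L / \<alpha>)) \<and> \<bar>real (length u) - L / dPsi\<bar> > \<epsilon> * L}) = gsum k (\<lambda>u. 0)"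
              by (intro gsum_cong) simp
            with False show ?thesis by (simp add: gsum_def)
          qed
        qed
        finally show "(\<integral>\<^sup>+x. emeasure (count_space UNIV) (bad_heights \<epsilon> \<eta>0 L x) \<partial>P) \<le> ennreal (C * exp ((1 - \<gamma>) * L))"
          using le[OF L] by simp
      qed (use \<delta> C in auto)
      also have "\<dots> = C / \<delta> * exp (- \<gamma> * L)"
      proof -
        have "exp ((1 - \<gamma>) * L) = exp L * exp (- \<gamma> * L)" by (simp add: mult_exp_exp algebra_simps)
        then show ?thesis using \<delta> by simp
      qed
      finally show ?thesis .
    qed
    have lim: "((\<lambda>L. C / \<delta> * exp (- \<gamma> * L)) \<longlongrightarrow> 0) at_top"
      using \<gamma> by real_asymp
    show "((\<lambda>L. ?p \<eta> L) \<longlongrightarrow> 0) at_top"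
    proof (rule tendsto_sandwich[OF _ _ tendsto_const lim])
      show "eventually (\<lambda>L. ?p \<eta> L \<le> C / \<delta> * exp (- \<gamma> * L)) at_top"
        using eventually_ge_at_top[of 0] by eventually_elim (rule bound)
    qed simp
  qed
qed

text \<open>Each member of a pair has at most d L + 1 possible heights, and every pair of
  generations contributes at most C2 exp (2 (1 + \<eta>) L) times the power
  \<open>\<rho> ^ J\<close> with J \<ge> \<epsilon> L. The exponential decay of that power beats the
  polynomial number of generation pairs and the enlarged time.\<close>

lemma prob_bad_pairs_tendsto_0:
  assumes \<epsilon>: "\<epsilon> > 0" and \<delta>: "\<delta> > 0"
  obtains \<eta>0 where "\<eta>0 > 0" "\<And>\<eta>. \<eta> \<le> \<eta>0 \<Longrightarrow>
    ((\<lambda>L. P.prob {x \<in> space P. ennreal (\<delta> * exp (2 * L)) \<le> emeasure (count_space UNIV) (bad_pairs \<epsilon> \<eta> L x)}) \<longlongrightarrow> 0) at_top"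
proof -
  define \<rho> where "\<rho> = mu (2 * \<alpha>)"
  have \<rho>: "0 < \<rho>" "\<rho> < 1" using mu_pos[of "2 * \<alpha>"] alpha_pos mu_2_alpha_less_1 by (simp_all add: \<rho>_def)
  define \<kappa> where "\<kappa> = - ln \<rho>"
  have \<kappa>: "\<kappa> > 0" using \<rho> by (simp add: \<kappa>_def)
  \<comment> \<open>The enlarged time costs 2 \<eta> L, which is then at most half of the decay
    \<open>\<epsilon> * \<kappa> * L\<close>.\<close>
  define \<eta>0 where "\<eta>0 = \<epsilon> * \<kappa> / 4"
  define d where "d = 1 / dPsi + \<epsilon>"
  have d: "d > 0" using \<epsilon> dPsi_pos by (simp add: d_def add_pos_pos)
  show thesis
  proof (rule that)
    show "\<eta>0 > 0" using \<epsilon> \<kappa> by (simp add: \<eta>0_def)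
    fix \<eta> assume \<eta>: "\<eta> \<le> \<eta>0"
    let ?p = "\<lambda>L. P.prob {x \<in> space P. ennreal (\<delta> * exp (2 * L)) \<le> emeasure (count_space UNIV) (bad_pairs \<epsilon> \<eta> L x)}"
    have bound: "?p L \<le> (d * L + 1)\<^sup>2 * C2 / \<delta> * exp (- (\<epsilon> * \<kappa> / 2) * L)" if L: "L \<ge> 0" for L
    proof -
      define J where "J = nat \<lceil>\<epsilon> * L\<rceil>"
      define t where "t = (1 + \<eta>) * L / \<alpha>"
      define c where "c = exp (2 * \<alpha> * t) * (C2 * \<rho> ^ J)"
      have c: "c \<ge> 0" using C2_ge_1 \<rho> by (simp add: c_def)
      have dL: "L / dPsi + \<epsilon> * L = d * L" by (simp add: d_def algebra_simps)
      let ?N = "{k. real k \<le> d * L}"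
      have N: "finite ?N" "real (card ?N) \<le> d * L + 1"
      proof -
        have sub: "?N \<subseteq> {..nat \<lfloor>d * L\<rfloor>}" by (auto simp: le_nat_floor)
        then show "finite ?N" by (rule finite_subset) simp
        have "card ?N \<le> card {..nat \<lfloor>d * L\<rfloor>}" by (intro card_mono sub) simp
        also have "real (card {..nat \<lfloor>d * L\<rfloor>}) \<le> d * L + 1" using d L by simp
        finally show "real (card ?N) \<le> d * L + 1" by simp
      qed
      have sumN: "(\<Sum>k. if real k \<le> d * L then f else 0) = of_nat (card ?N) * (f :: ennreal)" for f
      proof -
        have "(\<Sum>k. if real k \<le> d * L then f else 0) = (\<Sum>k\<in>?N. if real k \<le> d * L then f else 0)"
          by (rule suminf_finite[OF N(1)]) auto
        also have "\<dots> = (\<Sum>k\<in>?N. f)" by (intro sum.cong) auto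
        finally show ?thesis by simp
      qed
      let ?R = "\<lambda>u v. emeasure P {x \<in> space P. u \<in> born x (ereal t) \<and> v \<in> born x (ereal t) \<and>
          real (length u) \<le> d * L \<and> real (length v) \<le> d * L \<and> meet_at J u v}"
      have "(\<integral>\<^sup>+x. emeasure (count_space UNIV) (bad_pairs \<epsilon> \<eta> L x) \<partial>P)
          = (\<integral>\<^sup>+z. ?R (fst z) (snd z) \<partial>count_space UNIV)"
        unfolding bad_pairs_def dL J_def[symmetric] t_def[symmetric]
        by (rule expected_count(1)) (auto intro: P.sigma_finite_measure_axioms)
      also have "\<dots> = (\<integral>\<^sup>+u. \<integral>\<^sup>+v. ?R u v \<partial>count_space UNIV \<partial>count_space UNIV)"
        by (subst nn_integral_fst_count_space[symmetric]) simp
      also have "\<dots> = (\<Sum>g. gsum g (\<lambda>u. \<Sum>h. gsum h (\<lambda>v. ?R u v)))"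
        unfolding nn_integral_labels ..
      also have "\<dots> = (\<Sum>g h. gsum g (\<lambda>u. gsum h (\<lambda>v. ?R u v)))"
        unfolding gsum_suminf ..
      also have "\<dots> \<le> (\<Sum>g h. if real g \<le> d * L then if real h \<le> d * L then ennreal c else 0 else 0)"
      proof (intro suminf_le)
        fix g h
        show "gsum g (\<lambda>u. gsum h (\<lambda>v. ?R u v)) \<le> (if real g \<le> d * L then if real h \<le> d * L then ennreal c else 0 else 0)"
        proof (cases "real g \<le> d * L \<and> real h \<le> d * L")
          case True
          have "gsum g (\<lambda>u. gsum h (\<lambda>v. ?R u v)) \<le> gsum g (\<lambda>u. gsum h (\<lambda>v. if meet_at J u v
              then emeasure P {x \<in> space P. u \<in> born x (ereal t) \<and> v \<in> born x (ereal t)} else 0))"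
            by (intro gsum_mono) (auto intro!: emeasure_mono)
          also have "\<dots> \<le> ennreal c" unfolding c_def \<rho>_def by (rule expected_born_pairs_le)
          finally show ?thesis using True by simp
        next
          case False
          then have "gsum g (\<lambda>u. gsum h (\<lambda>v. ?R u v)) = gsum g (\<lambda>u. gsum h (\<lambda>v. 0))"
            by (intro gsum_cong) auto
          then show ?thesis by (simp add: gsum_def)
        qed
      qed auto
      also have "\<dots> = (\<Sum>g. if real g \<le> d * L then of_nat (card ?N) * ennreal c else 0)"
        by (intro suminf_cong) (simp add: sumN)
      also have "\<dots> = ennreal (real (card ?N) * (real (card ?N) * c))"
        unfolding sumN using c by (simp add: ennreal_mult ennreal_of_nat_eq_real_of_nat)
      finally have E: "(\<integral>\<^sup>+x. emeasure (count_space UNIV) (bad_pairs \<epsilon> \<eta> L x) \<partial>P) \<le> ennreal (real (card ?N) * (real (card ?N) * c))" .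
      have "?p L \<le> (real (card ?N) * (real (card ?N) * c)) / (\<delta> * exp (2 * L))"
        using \<delta> c by (intro P.prob_ge_le_nn_integral E) auto
      also have "\<dots> \<le> ((d * L + 1) * ((d * L + 1) * (C2 * exp (2 * L + - (\<epsilon> * \<kappa> / 2) * L)))) / (\<delta> * exp (2 * L))"
      proof (intro divide_right_mono mult_mono N(2))
        have "real J \<ge> \<epsilon> * L" unfolding J_def by linarith
        then have "real J * - \<kappa> \<le> \<epsilon> * L * - \<kappa>" using \<kappa> by simp
        have "\<rho> ^ J = exp (real J * - \<kappa>)"
          using \<rho> by (simp add: \<kappa>_def exp_of_nat_mult)
        moreover have "2 * \<alpha> * t = 2 * (1 + \<eta>) * L" using alpha_pos by (simp add: t_def)
        ultimately have "c = C2 * exp (2 * (1 + \<eta>) * L + real J * - \<kappa>)"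
          by (simp only: c_def exp_add mult.left_commute)
        also have "\<dots> \<le> C2 * exp (2 * L + - (\<epsilon> * \<kappa> / 2) * L)"
        proof (intro mult_left_mono)
          have "2 * \<eta> * L \<le> 2 * \<eta>0 * L" using \<eta> L by (intro mult_right_mono) auto
          also have "2 * \<eta>0 * L = (\<epsilon> * \<kappa> / 2) * L" by (simp add: \<eta>0_def)
          finally have "2 * (1 + \<eta>) * L + real J * - \<kappa> \<le> 2 * L + (\<epsilon> * \<kappa> / 2) * L + \<epsilon> * L * - \<kappa>"
            using \<open>real J * - \<kappa> \<le> \<epsilon> * L * - \<kappa>\<close> by (simp add: algebra_simps)
          then show "exp (2 * (1 + \<eta>) * L + real J * - \<kappa>) \<le> exp (2 * L + - (\<epsilon> * \<kappa> / 2) * L)"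
            by (simp add: algebra_simps)
        qed (use C2_ge_1 in simp)
        finally show "c \<le> C2 * exp (2 * L + - (\<epsilon> * \<kappa> / 2) * L)" .
      qed (use d L c \<delta> C2_ge_1 in auto)
      also have "\<dots> = (d * L + 1)\<^sup>2 * C2 / \<delta> * exp (- (\<epsilon> * \<kappa> / 2) * L)"
      proof -
        have "(a * (a * (C2 * (E * F)))) / (\<delta> * E) = (a * a) * C2 / \<delta> * F" if "E > 0" for a E F
          using that \<delta> by simp
        then show ?thesis unfolding exp_add power2_eq_square by this simp
      qed
      finally show ?thesis .
    qed
    define e where "e = \<epsilon> * \<kappa> / 2"
    have "e > 0" using \<epsilon> \<kappa> by (simp add: e_def)
    then have "((\<lambda>L. (d * L + 1)\<^sup>2 * exp (- e * L)) \<longlongrightarrow> 0) at_top"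
      using d by real_asymp
    from tendsto_mult[OF this tendsto_const[of "C2 / \<delta>"]]
    have lim: "((\<lambda>L. (d * L + 1)\<^sup>2 * C2 / \<delta> * exp (- (\<epsilon> * \<kappa> / 2) * L)) \<longlongrightarrow> 0) at_top"
      by (simp add: e_def mult_ac)
    show "((\<lambda>L. ?p L) \<longlongrightarrow> 0) at_top"
    proof (rule tendsto_sandwich[OF _ _ tendsto_const lim])
      show "eventually (\<lambda>L. ?p L \<le> (d * L + 1)\<^sup>2 * C2 / \<delta> * exp (- (\<epsilon> * \<kappa> / 2) * L)) at_top"
        using eventually_ge_at_top[of 0] by eventually_elim (rule bound)
    qed simp
  qed
qed

text \<open>The stopped tree lies inside the population at the deterministic time, so it inherits
  the bounds \<delta> n and \<delta> n^2 on the bad sets; these are proportions because it has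
  exactly n vertices.\<close>

lemma typical_first_individuals:
  assumes gx: "generic x" and n: "n \<ge> 1" and L: "L = ln (real n)" and x: "x \<in> space P" "x \<notin> slow \<eta> L"
    and h: "\<not> ennreal (\<delta> * exp L) \<le> emeasure (count_space UNIV) (bad_heights \<epsilon> \<eta> L x)"
    and pr: "\<not> ennreal (\<delta> * exp (2 * L)) \<le> emeasure (count_space UNIV) (bad_pairs \<epsilon> \<eta> L x)"
    and \<delta>: "\<delta> > 0"
  shows "card (born x (tau x n)) = n" "finite (born x (tau x n))" "first_born x (born x (tau x n))"
    "[] \<in> born x (tau x n)"
    "typical (L / dPsi - \<epsilon> * L) (L / dPsi + \<epsilon> * L) (nat \<lceil>\<epsilon> * L\<rceil>) \<delta> (born x (tau x n))"
proof -
  let ?t = "(1 + \<eta>) * L / \<alpha>"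
  have eL: "exp L = real n" "exp (2 * L) = (real n)\<^sup>2"
    using n by (simp_all add: L exp_double)
  have "of_nat n \<le> emeasure (count_space UNIV) (born x (ereal ?t))"
    using x by (simp add: slow_def eL ennreal_of_nat_eq_real_of_nat)
  note B = born_tau[OF gx n this]
  let ?B = "born x (tau x n)"
  show "card ?B = n" "finite ?B" "first_born x ?B" "[] \<in> ?B" by (fact B)+
  have fin: "finite (born x (ereal ?t))" using gx by (simp add: generic_def)
  have H: "finite (bad_heights \<epsilon> \<eta> L x)" by (rule finite_subset[OF _ fin]) (auto simp: bad_heights_def)
  have PR: "finite (bad_pairs \<epsilon> \<eta> L x)"
    by (rule finite_subset[OF _ finite_cartesian_product[OF fin fin]]) (auto simp: bad_pairs_def)
  have 1: "real (card (bad_heights \<epsilon> \<eta> L x)) \<le> \<delta> * real n"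
    using h H \<delta> by (simp add: emeasure_count_space eL ennreal_of_nat_eq_real_of_nat not_le ennreal_less_iff)
  have 2: "real (card (bad_pairs \<epsilon> \<eta> L x)) \<le> \<delta> * (real n)\<^sup>2"
    using pr PR \<delta> by (simp add: emeasure_count_space eL ennreal_of_nat_eq_real_of_nat not_le ennreal_less_iff)
  have "card {u \<in> ?B. \<not> (L / dPsi - \<epsilon> * L \<le> real (length u) \<and> real (length u) \<le> L / dPsi + \<epsilon> * L)} \<le> card (bad_heights \<epsilon> \<eta> L x)"
    using B(3) by (intro card_mono H) (auto simp: bad_heights_def)
  moreover have "card {(u, v). u \<in> ?B \<and> v \<in> ?B \<and> real (length u) \<le> L / dPsi + \<epsilon> * L \<and>
      real (length v) \<le> L / dPsi + \<epsilon> * L \<and> meet_at (nat \<lceil>\<epsilon> * L\<rceil>) u v} \<le> card (bad_pairs \<epsilon> \<eta> L x)"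
    using B(3) by (intro card_mono PR) (auto simp: bad_pairs_def)
  ultimately show "typical (L / dPsi - \<epsilon> * L) (L / dPsi + \<epsilon> * L) (nat \<lceil>\<epsilon> * L\<rceil>) \<delta> ?B"
    using 1 2 unfolding typical_def B(1) by linarith
qed

end

subsection \<open>Convergence of the root cluster\<close>

text \<open>As p tends to 1 and ln has derivative 1 there, ln p is equivalent to - (1 - p), that is
  to - c / ln n.\<close>

lemma ln_retention_asymp:
  fixes p :: "nat \<Rightarrow> real"
  assumes c: "c > 0" and p: "\<And>n. n \<ge> 1 \<Longrightarrow> 0 < p n \<and> p n < 1"
    and asymp: "(\<lambda>n. 1 - p n) \<sim>[sequentially] (\<lambda>n. c / ln (real n))"
  shows "(\<lambda>n. ln (real n) * ln (p n)) \<longlonglongrightarrow> - c"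
proof -
  have q: "(\<lambda>n. (1 - p n) / (c / ln (real n))) \<longlonglongrightarrow> 1"
  proof (rule asymp_equivD_strong[OF asymp])
    show "eventually (\<lambda>n. 1 - p n \<noteq> 0 \<or> c / ln (real n) \<noteq> 0) sequentially"
      using eventually_ge_at_top[of "1::nat"] by eventually_elim (use p in fastforce)
  qed
  from tendsto_mult[OF q tendsto_const[of c]]
  have L: "(\<lambda>n. ln (real n) * (1 - p n)) \<longlonglongrightarrow> c"
    using c by (simp add: mult.commute)
  have "(\<lambda>n. c / ln (real n)) \<longlonglongrightarrow> 0" by real_asymp
  from tendsto_mult[OF q this]
  have "(\<lambda>n. (1 - p n) / (c / ln (real n)) * (c / ln (real n))) \<longlonglongrightarrow> 0" by simp
  moreover have "eventually (\<lambda>n. (1 - p n) / (c / ln (real n)) * (c / ln (real n)) = 1 - p n) sequentially"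
    using eventually_gt_at_top[of "1::nat"] by eventually_elim (use c in simp)
  ultimately have "(\<lambda>n. 1 - p n) \<longlonglongrightarrow> 0" by (rule Lim_transform_eventually)
  from tendsto_diff[OF tendsto_const[of 1] this]
  have p1: "p \<longlonglongrightarrow> 1" by simp
  have "eventually (\<lambda>n. p n \<noteq> 1) sequentially"
    using eventually_ge_at_top[of "1::nat"] by eventually_elim (use p in fastforce)
  with p1 have pf: "filterlim p (at 1) sequentially" by (simp add: filterlim_at)
  have "(ln has_real_derivative 1) (at (1::real))"
    by (auto intro!: derivative_eq_intros)
  then have "((\<lambda>z. (ln z - ln 1) / (z - 1 :: real)) \<longlongrightarrow> 1) (at 1)"
    unfolding has_field_derivative_iff .
  from filterlim_compose[OF this pf]
  have "(\<lambda>n. ln (p n) / (p n - 1)) \<longlonglongrightarrow> 1" by simp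
  from tendsto_mult[OF L this]
  have "(\<lambda>n. ln (real n) * (1 - p n) * (ln (p n) / (p n - 1))) \<longlonglongrightarrow> c" by simp
  then have "(\<lambda>n. - (ln (real n) * (1 - p n) * (ln (p n) / (p n - 1)))) \<longlonglongrightarrow> - c" by (rule tendsto_minus)
  moreover have "eventually (\<lambda>n. - (ln (real n) * (1 - p n) * (ln (p n) / (p n - 1))) = ln (real n) * ln (p n)) sequentially"
    using eventually_ge_at_top[of "1::nat"]
  proof eventually_elim
    case (elim n)
    then have "p n - 1 \<noteq> 0" using p by fastforce
    moreover have "1 - p n = - (p n - 1)" by simp
    ultimately show ?case by (metis (no_types, lifting) minus_mult_left minus_mult_right minus_minus mult.assoc nonzero_mult_div_cancel_left times_divide_eq_right)
  qed
  ultimately show ?thesis by (rule Lim_transform_eventually)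
qed

text \<open>The power is the exponential of (z / ln n) (ln n * ln p), and both factors
  converge.\<close>

lemma retention_powr_tendsto:
  fixes p z :: "nat \<Rightarrow> real"
  assumes lim: "(\<lambda>n. ln (real n) * ln (p n)) \<longlonglongrightarrow> - c" and p: "\<And>n. n \<ge> 1 \<Longrightarrow> 0 < p n \<and> p n < 1"
    and z: "(\<lambda>n. z n / ln (real n)) \<longlonglongrightarrow> d"
  shows "(\<lambda>n. p n powr z n) \<longlonglongrightarrow> exp (- c * d)"
proof -
  have "(\<lambda>n. exp ((z n / ln (real n)) * (ln (real n) * ln (p n)))) \<longlonglongrightarrow> exp (d * - c)"
    by (intro tendsto_exp tendsto_mult z lim)
  moreover have "eventually (\<lambda>n. exp ((z n / ln (real n)) * (ln (real n) * ln (p n))) = p n powr z n) sequentially"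
    using eventually_gt_at_top[of "1::nat"]
  proof eventually_elim
    case (elim n)
    then show ?case using p[of n] by (simp add: powr_def)
  qed
  ultimately have "(\<lambda>n. p n powr z n) \<longlonglongrightarrow> exp (d * - c)" by (rule Lim_transform_eventually)
  then show ?thesis by (simp add: mult.commute)
qed

lemma ceiling_div_tendsto:
  assumes "\<epsilon> > 0"
  shows "(\<lambda>n. real (nat \<lceil>\<epsilon> * ln (real n)\<rceil>) / ln (real n)) \<longlonglongrightarrow> \<epsilon>"
proof (rule tendsto_sandwich[of "\<lambda>_. \<epsilon>" _ sequentially "\<lambda>n. \<epsilon> + 1 / ln (real n)"])
  show "(\<lambda>n. \<epsilon> + 1 / ln (real n)) \<longlonglongrightarrow> \<epsilon>" by real_asymp
  have bound: "\<epsilon> * ln (real n) \<le> real (nat \<lceil>\<epsilon> * ln (real n)\<rceil>) \<and> real (nat \<lceil>\<epsilon> * ln (real n)\<rceil>) \<le> \<epsilon> * ln (real n) + 1" if "n > 1" for n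
  proof -
    have "\<epsilon> * ln (real n) \<ge> 0" using that assms by simp
    then have "real (nat \<lceil>\<epsilon> * ln (real n)\<rceil>) = of_int \<lceil>\<epsilon> * ln (real n)\<rceil>" by simp
    then show ?thesis by linarith
  qed
  show "eventually (\<lambda>n. \<epsilon> \<le> real (nat \<lceil>\<epsilon> * ln (real n)\<rceil>) / ln (real n)) sequentially"
    using eventually_gt_at_top[of "1::nat"]
    by eventually_elim (use bound in \<open>simp add: pos_le_divide_eq\<close>)
  show "eventually (\<lambda>n. real (nat \<lceil>\<epsilon> * ln (real n)\<rceil>) / ln (real n) \<le> \<epsilon> + 1 / ln (real n)) sequentially"
    using eventually_gt_at_top[of "1::nat"]
  proof eventually_elim
    case (elim n)
    then have "ln (real n) > 0" by simp
    then have "(\<epsilon> + 1 / ln (real n)) * ln (real n) = \<epsilon> * ln (real n) + 1" by (simp add: field_simps)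
    with bound[OF elim] \<open>ln (real n) > 0\<close> show ?case by (simp add: pos_divide_le_eq)
  qed
qed simp

context cmj
begin

definition regular :: "(label \<Rightarrow> individual) \<Rightarrow> bool" where
  "regular x \<longleftrightarrow> generic x \<and> (infinite (born x \<infinity>) \<longrightarrow> (\<forall>g. gen x g \<noteq> {}))"

lemma AE_regular: "AE x in P. regular x"
  using AE_generic AE_infinite_imp_gen_nonempty by eventually_elim (simp add: regular_def)

text \<open>An event of the family process alone. Its slow part is restricted to nonempty
  generations, since a process that dies out is slow for all large \<open>L\<close>.\<close>

definition exceptional :: "real \<Rightarrow> real \<Rightarrow> real \<Rightarrow> real \<Rightarrow> (label \<Rightarrow> individual) set" where
  "exceptional \<epsilon> \<delta> \<eta> L = {x \<in> slow \<eta> L. \<forall>g. gen x g \<noteq> {}}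
    \<union> {x \<in> space P. ennreal (\<delta> * exp L) \<le> emeasure (count_space UNIV) (bad_heights \<epsilon> \<eta> L x)}
    \<union> {x \<in> space P. ennreal (\<delta> * exp (2 * L)) \<le> emeasure (count_space UNIV) (bad_pairs \<epsilon> \<eta> L x)}"

lemma survivors_slow_sets: "{x \<in> slow \<eta> L. \<forall>g. gen x g \<noteq> {}} \<in> sets P"
proof -
  have "{x \<in> slow \<eta> L. \<forall>g. gen x g \<noteq> {}} = {x \<in> space P. x \<in> slow \<eta> L \<and> (\<forall>g. \<not> gen x g = {})}"
    by (auto simp: slow_def)
  then show ?thesis by simp
qed

lemma exceptional_sets[measurable]: "exceptional \<epsilon> \<delta> \<eta> L \<in> sets P"
  unfolding exceptional_def by (intro sets.Un survivors_slow_sets) measurable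

lemma prob_exceptional_tendsto_0:
  assumes \<epsilon>: "\<epsilon> > 0" and \<delta>: "\<delta> > 0"
  obtains \<eta> where "((\<lambda>L. P.prob (exceptional \<epsilon> \<delta> \<eta> L)) \<longlongrightarrow> 0) at_top"
proof -
  obtain \<eta>1 where 1: "\<eta>1 > 0" "\<And>\<eta>. \<eta> \<le> \<eta>1 \<Longrightarrow>
    ((\<lambda>L. P.prob {x \<in> space P. ennreal (\<delta> * exp L) \<le> emeasure (count_space UNIV) (bad_heights \<epsilon> \<eta> L x)}) \<longlongrightarrow> 0) at_top"
    by (rule prob_bad_heights_tendsto_0[OF \<epsilon> \<delta>]) (rule that)
  obtain \<eta>2 where 2: "\<eta>2 > 0" "\<And>\<eta>. \<eta> \<le> \<eta>2 \<Longrightarrow>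
    ((\<lambda>L. P.prob {x \<in> space P. ennreal (\<delta> * exp (2 * L)) \<le> emeasure (count_space UNIV) (bad_pairs \<epsilon> \<eta> L x)}) \<longlongrightarrow> 0) at_top"
    by (rule prob_bad_pairs_tendsto_0[OF \<epsilon> \<delta>]) (rule that)
  define \<eta> where "\<eta> = min \<eta>1 \<eta>2"
  have \<eta>: "\<eta> > 0" "\<eta> \<le> \<eta>1" "\<eta> \<le> \<eta>2" using 1 2 by (auto simp: \<eta>_def)
  let ?A = "\<lambda>L. {x \<in> slow \<eta> L. \<forall>g. gen x g \<noteq> {}}"
  let ?B = "\<lambda>L. {x \<in> space P. ennreal (\<delta> * exp L) \<le> emeasure (count_space UNIV) (bad_heights \<epsilon> \<eta> L x)}"
  let ?C = "\<lambda>L. {x \<in> space P. ennreal (\<delta> * exp (2 * L)) \<le> emeasure (count_space UNIV) (bad_pairs \<epsilon> \<eta> L x)}"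
  have A: "?A L \<in> sets P" for L by (rule survivors_slow_sets)
  have B: "?B L \<in> sets P" for L by measurable
  have C: "?C L \<in> sets P" for L by measurable
  have "((\<lambda>L. P.prob (?A L) + P.prob (?B L) + P.prob (?C L)) \<longlongrightarrow> 0 + 0 + 0) at_top"
    by (intro tendsto_add prob_surviving_slow_tendsto_0 1(2) 2(2) \<eta>)
  then have lim: "((\<lambda>L. P.prob (?A L) + P.prob (?B L) + P.prob (?C L)) \<longlongrightarrow> 0) at_top" by simp
  have le: "P.prob (exceptional \<epsilon> \<delta> \<eta> L) \<le> P.prob (?A L) + P.prob (?B L) + P.prob (?C L)" for L
    unfolding exceptional_def
    using measure_Un_le[OF sets.Un[OF A B] C, of L L L] measure_Un_le[OF A B, of L L] by linarith
  show thesis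
  proof (rule that)
    show "((\<lambda>L. P.prob (exceptional \<epsilon> \<delta> \<eta> L)) \<longlongrightarrow> 0) at_top"
      by (rule tendsto_sandwich[OF _ _ tendsto_const lim]) (auto intro!: always_eventually le)
  qed
qed

lemma root_cluster_deviation:
  assumes reg: "regular x" and inf: "Z x \<infinity> = \<infinity>" and n: "n \<ge> 1" and L: "L = ln (real n)"
    and x: "x \<in> space P" "x \<notin> exceptional \<epsilon> \<delta> \<eta> L" and \<delta>: "\<delta> > 0"
  obtains B where "finite B" "B \<noteq> {}" "card B = n" "first_born x B"
    "typical (L / dPsi - \<epsilon> * L) (L / dPsi + \<epsilon> * L) (nat \<lceil>\<epsilon> * L\<rceil>) \<delta> B"
    "\<And>\<kappa>. root_cluster_size x \<kappa> n = card {w \<in> B. path_open \<kappa> w}"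
proof (rule that[of "born x (tau x n)"])
  have gx: "generic x" using reg by (simp add: regular_def)
  have "infinite (born x \<infinity>)" using inf by (auto simp: Z_def split: if_splits)
  then have "\<forall>g. gen x g \<noteq> {}" using reg by (simp add: regular_def)
  then have s: "x \<notin> slow \<eta> L" using x by (auto simp: exceptional_def)
  have h: "\<not> ennreal (\<delta> * exp L) \<le> emeasure (count_space UNIV) (bad_heights \<epsilon> \<eta> L x)"
    and pr: "\<not> ennreal (\<delta> * exp (2 * L)) \<le> emeasure (count_space UNIV) (bad_pairs \<epsilon> \<eta> L x)"
    using x by (auto simp: exceptional_def)
  note B = typical_first_individuals[OF gx n L x(1) s h pr \<delta>]
  show "finite (born x (tau x n))" "card (born x (tau x n)) = n" "first_born x (born x (tau x n))"
    "typical (L / dPsi - \<epsilon> * L) (L / dPsi + \<epsilon> * L) (nat \<lceil>\<epsilon> * L\<rceil>) \<delta> (born x (tau x n))"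
    by (fact B)+
  show "born x (tau x n) \<noteq> {}" using B(4) by blast
  show "root_cluster_size x \<kappa> n = card {w \<in> born x (tau x n). path_open \<kappa> w}" for \<kappa>
    unfolding root_cluster_size_def cluster_root_eq[OF gx B(4)] ..
qed

lemma measurable_cluster_deviation:
  fixes y :: real
  assumes "finite B"
  shows "{\<kappa>. \<bar>real (card {w \<in> B. path_open \<kappa> w}) / real (card B) - y\<bar> > \<epsilon>} \<in> sets (percolation_law p)"
proof -
  have "real (card {w \<in> B. path_open \<kappa> w}) = (\<Sum>w\<in>B. of_bool (path_open \<kappa> w))" for \<kappa>
    using assms by (simp add: Int_def of_bool_def sum.If_cases)
  then have "(\<lambda>\<kappa>. real (card {w \<in> B. path_open \<kappa> w})) \<in> borel_measurable (percolation_law p)" by simp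
  then have "{\<kappa> \<in> space (percolation_law p). \<epsilon> < \<bar>real (card {w \<in> B. path_open \<kappa> w}) / real (card B) - y\<bar>} \<in> sets (percolation_law p)"
    by (intro borel_measurable_less borel_measurable_const borel_measurable_abs borel_measurable_diff borel_measurable_divide)
  then show ?thesis by simp
qed

text \<open>Outside a null set and the exceptional event, survival makes the vertex set
  \<open>B\<close> of the stopped tree typical, and the deviation becomes the event
  \<open>?F B\<close> of percolation on a fixed tree. The cells \<open>?A B\<close> are disjoint and
  depend on \<open>X\<close> only, so independence bounds the probability within each cell by
  \<open>?r\<close> times that of the cell.\<close>

lemma prob_root_cluster_deviation_le:
  fixes M :: "'w measure" and X :: "'w \<Rightarrow> label \<Rightarrow> individual" and \<K> :: "'w \<Rightarrow> edge \<Rightarrow> bool" and y :: real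
  assumes M: "prob_space M" and X: "X \<in> M \<rightarrow>\<^sub>M P" "distr M P X = P"
    and \<K>: "\<K> \<in> M \<rightarrow>\<^sub>M percolation_law p" "distr M (percolation_law p) \<K> = percolation_law p"
    and indep: "prob_space.indep_set M {X -` A \<inter> space M | A. A \<in> sets P}
      {\<K> -` B \<inter> space M | B. B \<in> sets (percolation_law p)}"
    and n: "n \<ge> 1" and L: "L = ln (real n)" and p: "0 < p" "p < 1" and \<delta>: "\<delta> > 0" and e: "e > 0"
    and y: "0 \<le> y" "y \<le> 1"
  shows "measure M {\<omega> \<in> space M. \<bar>real (root_cluster_size (X \<omega>) (\<K> \<omega>) n) / real n - y\<bar> > e \<and> Z (X \<omega>) \<infinity> = \<infinity>}
    \<le> P.prob (exceptional \<epsilon> \<delta> \<eta> L)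
      + (\<bar>p powr (2 * (L / dPsi - \<epsilon> * L) - real (nat \<lceil>\<epsilon> * L\<rceil>)) - 2 * y * p powr (L / dPsi + \<epsilon> * L) + y\<^sup>2\<bar> + 6 * \<delta>) / e\<^sup>2"
    (is "measure M ?bad \<le> _ + ?r")
proof -
  interpret M: prob_space M by (rule M)
  have r: "?r \<ge> 0" using \<delta> by simp
  \<comment> \<open>Measurability of \<open>regular\<close> is not established, so its failure is
    covered by a measurable null set.\<close>
  obtain N where N: "{x \<in> space P. \<not> regular x} \<subseteq> N" "N \<in> sets P" "emeasure P N = 0"
    using AE_regular by (auto elim!: AE_E)
  let ?typ = "typical (L / dPsi - \<epsilon> * L) (L / dPsi + \<epsilon> * L) (nat \<lceil>\<epsilon> * L\<rceil>) \<delta>"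
  let ?S = "{B :: label set. finite B \<and> B \<noteq> {} \<and> card B = n \<and> ?typ B}"
  let ?A = "\<lambda>B. X -` {x \<in> space P. first_born x B} \<inter> space M"
  let ?F = "\<lambda>B. {\<kappa>. \<bar>real (card {w \<in> B. path_open \<kappa> w}) / real (card B) - y\<bar> > e}"
  let ?E = "\<lambda>B. ?A B \<inter> (\<K> -` ?F B \<inter> space M)"
  let ?T1 = "X -` (N \<union> exceptional \<epsilon> \<delta> \<eta> L) \<inter> space M"
  let ?T2 = "\<Union>B\<in>?S. ?E B"
  have cS: "countable ?S"
    by (rule countable_subset[OF _ countable_Collect_finite]) auto
  have first: "{x \<in> space P. first_born x B} \<in> sets P" for B by measurable
  have A: "?A B \<in> sets M" for B
    using measurable_sets[OF X(1) first] .
  have F: "?F B \<in> sets (percolation_law p)" if "B \<in> ?S" for B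
    using that by (intro measurable_cluster_deviation) auto
  have E: "?E B \<in> sets M" if "B \<in> ?S" for B
    using A measurable_sets[OF \<K>(1) F[OF that]] by (rule sets.Int)
  have T1: "?T1 \<in> sets M" by (rule measurable_sets[OF X(1)]) (use N(2) in auto)
  have T2: "?T2 \<in> sets M" by (rule sets.countable_UN'[OF cS], rule image_subsetI, erule E)
  have sub: "?bad \<subseteq> ?T1 \<union> ?T2"
  proof
    fix \<omega> assume w: "\<omega> \<in> ?bad"
    then have sp: "\<omega> \<in> space M" and xP: "X \<omega> \<in> space P" using measurable_space[OF X(1)] by auto
    show "\<omega> \<in> ?T1 \<union> ?T2"
    proof (rule ccontr)
      assume not: "\<omega> \<notin> ?T1 \<union> ?T2"
      then have "X \<omega> \<notin> N" and ex: "X \<omega> \<notin> exceptional \<epsilon> \<delta> \<eta> L" using sp by auto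
      then have reg: "regular (X \<omega>)" using N(1) xP by auto
      have inf: "Z (X \<omega>) \<infinity> = \<infinity>" using w by simp
      obtain B where B: "finite B" "B \<noteq> {}" "card B = n" "first_born (X \<omega>) B" "?typ B"
        "\<And>\<kappa>. root_cluster_size (X \<omega>) \<kappa> n = card {w \<in> B. path_open \<kappa> w}"
        by (rule root_cluster_deviation[OF reg inf n L xP ex \<delta>]) (rule that)
      then have "B \<in> ?S" by simp
      moreover have "\<omega> \<in> ?E B" using w sp xP B by simp
      ultimately have "\<omega> \<in> ?T2" by blast
      with not show False by blast
    qed
  qed
  have "emeasure M ?T2 \<le> ennreal ?r * emeasure M (\<Union>B\<in>?S. ?A B)"
  proof (rule emeasure_disjoint_UN_le[OF cS A E])
    show "?E B \<subseteq> ?A B" for B by blast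
    show "disjoint_family_on ?A ?S"
    proof (unfold disjoint_family_on_def, intro ballI impI)
      fix B B' assume "B \<in> ?S" "B' \<in> ?S" "B \<noteq> B'"
      then show "?A B \<inter> ?A B' = {}" using first_born_unique[of _ B B'] by auto
    qed
    fix B assume B: "B \<in> ?S"
    have "M.prob (?E B) = M.prob (?A B) * M.prob (\<K> -` ?F B \<inter> space M)"
    proof (rule M.indep_setD[OF indep])
      show "?A B \<in> {X -` A \<inter> space M | A. A \<in> sets P}" using first[of B] by blast
      show "\<K> -` ?F B \<inter> space M \<in> {\<K> -` B \<inter> space M | B. B \<in> sets (percolation_law p)}" using F[OF B] by blast
    qed
    also have "\<dots> \<le> M.prob (?A B) * ?r"
    proof (rule mult_left_mono)
      have "M.prob (\<K> -` ?F B \<inter> space M) = measure (percolation_law p) (?F B)"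
        using measure_distr[OF \<K>(1) F[OF B]] \<K>(2) by simp
      also have "\<dots> \<le> ?r"
        using B \<delta> by (intro prob_cluster_deviation_le p y e) auto
      finally show "M.prob (\<K> -` ?F B \<inter> space M) \<le> ?r" .
    qed simp
    finally have "M.prob (?E B) \<le> ?r * M.prob (?A B)" by (simp only: mult.commute)
    then show "emeasure M (?E B) \<le> ennreal ?r * emeasure M (?A B)"
      unfolding M.emeasure_eq_measure ennreal_mult'[OF r, symmetric] by (rule ennreal_leI)
  qed
  also have "\<dots> \<le> ennreal ?r * 1" by (intro mult_left_mono M.emeasure_le_1) simp
  finally have T2le: "M.prob ?T2 \<le> ?r" using r by (simp add: M.emeasure_eq_measure)
  have "M.prob ?T1 = P.prob (N \<union> exceptional \<epsilon> \<delta> \<eta> L)"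
    using measure_distr[OF X(1), of "N \<union> exceptional \<epsilon> \<delta> \<eta> L"] X(2) N(2) by simp
  also have "\<dots> \<le> P.prob N + P.prob (exceptional \<epsilon> \<delta> \<eta> L)"
    by (intro measure_Un_le N(2) exceptional_sets)
  also have "P.prob N = 0" using N(3) by (simp add: measure_def)
  finally have T1le: "M.prob ?T1 \<le> P.prob (exceptional \<epsilon> \<delta> \<eta> L)" by simp
  have "M.prob ?bad \<le> M.prob (?T1 \<union> ?T2)"
    using sub T1 T2 by (intro M.finite_measure_mono) auto
  also have "\<dots> \<le> M.prob ?T1 + M.prob ?T2" by (intro measure_Un_le T1 T2)
  finally show ?thesis using T1le T2le by linarith
qed

end

text \<open>The percolations for different \<open>n\<close> may be coupled in any way. Conditioning
  divides by the probability of survival, which is the same for all \<open>n\<close>, so it is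
  enough that the joint probability of deviation and survival tends to 0.\<close>

theorem corollary5:
  fixes \<Lambda> :: "ennreal measure"
    and M :: "'w measure"
    and X :: "'w \<Rightarrow> label \<Rightarrow> individual"
    and K :: "nat \<Rightarrow> 'w \<Rightarrow> edge \<Rightarrow> bool"
    and p :: "nat \<Rightarrow> real"
    and \<alpha> c :: real
  assumes "sets \<Lambda> = sets (restrict_space borel {0<..})"
    and "finite_measure \<Lambda>"
    and "1 < (\<integral>\<^sup>+ t. t \<partial>\<Lambda>)" and "(\<integral>\<^sup>+ t. t \<partial>\<Lambda>) < \<infinity>"
    and "\<alpha> > 0" and "Psi \<Lambda> \<alpha> = 0"
    and "c > 0"
    and "\<And>n. n \<ge> 1 \<Longrightarrow> 0 < p n \<and> p n < 1"
    and "(\<lambda>n. 1 - p n) \<sim>[sequentially] (\<lambda>n. c / ln (real n))"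
    and "prob_space M"
    and "X \<in> M \<rightarrow>\<^sub>M process_law \<Lambda>"
    and "distr M (process_law \<Lambda>) X = process_law \<Lambda>"
    and "\<And>n. n \<ge> 1 \<Longrightarrow> K n \<in> M \<rightarrow>\<^sub>M percolation_law (p n)"
    and "\<And>n. n \<ge> 1 \<Longrightarrow> distr M (percolation_law (p n)) (K n) = percolation_law (p n)"
    and "\<And>n. n \<ge> 1 \<Longrightarrow>
           prob_space.indep_set M
             {X -` A \<inter> space M | A. A \<in> sets (process_law \<Lambda>)}
             {K n -` B \<inter> space M | B. B \<in> sets (percolation_law (p n))}"
  shows "\<forall>\<epsilon>>0. (\<lambda>n. \<P>(\<omega> in M.
             \<bar>real (root_cluster_size (X \<omega>) (K n \<omega>) n) / real n
                - exp (- c / deriv (Psi \<Lambda>) \<alpha>)\<bar> > \<epsilon>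
             \<bar> Z (X \<omega>) \<infinity> = \<infinity>)) \<longlonglongrightarrow> 0"
proof (intro allI impI)
  fix e :: real assume e: "e > 0"
  interpret cmj \<Lambda> \<alpha> by (rule cmj.intro[OF assms(1,2,4,5,6)])
  define a where "a = 1 / dPsi"
  define y where "y = exp (- c * a)"
  have a: "a > 0" using dPsi_pos by (simp add: a_def)
  have y: "0 \<le> y" "y \<le> 1" using a \<open>c > 0\<close> by (auto simp: y_def)
  have y_eq: "exp (- c / deriv (Psi \<Lambda>) \<alpha>) = y" by (simp add: y_def a_def deriv_Psi)
  let ?bad = "\<lambda>n. {\<omega> \<in> space M. \<bar>real (root_cluster_size (X \<omega>) (K n \<omega>) n) / real n - y\<bar> > e \<and> Z (X \<omega>) \<infinity> = \<infinity>}"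
  have lnp: "(\<lambda>n. ln (real n) * ln (p n)) \<longlonglongrightarrow> - c"
    using assms(7-9) by (rule ln_retention_asymp)
  \<comment> \<open>The limit of the second-moment bound at height tolerance
    \<open>\<epsilon>\<close>; at 0 it is y^2 - 2 y^2 + y^2.\<close>
  define r where "r \<epsilon> = \<bar>exp (- c * (2 * (a - \<epsilon>) - \<epsilon>)) - 2 * y * exp (- c * (a + \<epsilon>)) + y\<^sup>2\<bar>" for \<epsilon>
  have "(\<lambda>n. measure M (?bad n)) \<longlonglongrightarrow> 0"
  proof (rule tendstoI)
    fix \<xi> :: real assume \<xi>: "\<xi> > 0"
    \<comment> \<open>Both \<open>?R n\<close> and \<open>6 * \<delta>\<close> will be at most
      \<open>\<zeta>\<close>; divided by the square of \<open>e\<close> they amount to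
      \<open>\<xi> / 2\<close>, and the exceptional event takes the other half.\<close>
    define \<zeta> where "\<zeta> = \<xi> * e\<^sup>2 / 4"
    have \<zeta>: "\<zeta> > 0" using \<xi> e by (simp add: \<zeta>_def)
    have "isCont r 0" unfolding r_def by (intro continuous_intros)
    moreover have "r 0 = 0"
    proof -
      have "exp (- c * (2 * a)) = y * y" by (simp add: y_def mult_exp_exp)
      moreover have "exp (- c * a) = y" by (simp add: y_def)
      ultimately show ?thesis by (simp add: r_def power2_eq_square)
    qed
    ultimately have "(r \<longlongrightarrow> 0) (at_right 0)" unfolding isCont_def by (simp add: filterlim_at_split)
    then have "eventually (\<lambda>\<epsilon>. r \<epsilon> < \<zeta>) (at_right 0)" using \<zeta> by (rule order_tendstoD)
    then obtain \<epsilon> where \<epsilon>: "\<epsilon> > 0" "r \<epsilon> < \<zeta>"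
      unfolding eventually_at_right_field by (metis field_lbound_gt_zero)
    define \<delta> where "\<delta> = \<zeta> / 6"
    have \<delta>: "\<delta> > 0" using \<zeta> by (simp add: \<delta>_def)
    obtain \<eta> where ex: "((\<lambda>L. P.prob (exceptional \<epsilon> \<delta> \<eta> L)) \<longlongrightarrow> 0) at_top"
      using prob_exceptional_tendsto_0[OF \<epsilon>(1) \<delta>] .
    let ?L = "\<lambda>n. ln (real n)"
    let ?R = "\<lambda>n. \<bar>p n powr (2 * (?L n / dPsi - \<epsilon> * ?L n) - real (nat \<lceil>\<epsilon> * ?L n\<rceil>)) - 2 * y * p n powr (?L n / dPsi + \<epsilon> * ?L n) + y\<^sup>2\<bar>"
    have "filterlim (\<lambda>n. ln (real n)) at_top sequentially"
      by (rule filterlim_compose[OF ln_at_top filterlim_real_sequentially])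
    from filterlim_compose[OF ex this]
    have exn: "(\<lambda>n. P.prob (exceptional \<epsilon> \<delta> \<eta> (?L n))) \<longlonglongrightarrow> 0" .
    \<comment> \<open>The two exponents of \<open>p n\<close> are measured in units of ln n, as
      \<open>retention_powr_tendsto\<close> requires; rounding up the generation of the common
      ancestor disappears in the limit.\<close>
    have z1: "(\<lambda>n. (2 * (?L n / dPsi - \<epsilon> * ?L n) - real (nat \<lceil>\<epsilon> * ?L n\<rceil>)) / ?L n) \<longlonglongrightarrow> 2 * (a - \<epsilon>) - \<epsilon>"
    proof -
      have "(\<lambda>n. 2 * (a - \<epsilon>) - real (nat \<lceil>\<epsilon> * ?L n\<rceil>) / ?L n) \<longlonglongrightarrow> 2 * (a - \<epsilon>) - \<epsilon>"
        by (intro tendsto_diff tendsto_const ceiling_div_tendsto \<epsilon>)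
      moreover have "eventually (\<lambda>n. 2 * (a - \<epsilon>) - real (nat \<lceil>\<epsilon> * ?L n\<rceil>) / ?L n
          = (2 * (?L n / dPsi - \<epsilon> * ?L n) - real (nat \<lceil>\<epsilon> * ?L n\<rceil>)) / ?L n) sequentially"
        using eventually_gt_at_top[of "1::nat"]
      proof eventually_elim
        case (elim n)
        then have "?L n > 0" by simp
        moreover have "2 * (?L n / dPsi - \<epsilon> * ?L n) = 2 * (a - \<epsilon>) * ?L n" by (simp add: a_def algebra_simps)
        ultimately show ?case by (simp add: diff_divide_distrib)
      qed
      ultimately show ?thesis by (rule Lim_transform_eventually)
    qed
    have z2: "(\<lambda>n. (?L n / dPsi + \<epsilon> * ?L n) / ?L n) \<longlonglongrightarrow> a + \<epsilon>"
    proof -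
      have "eventually (\<lambda>n. a + \<epsilon> = (?L n / dPsi + \<epsilon> * ?L n) / ?L n) sequentially"
        using eventually_gt_at_top[of "1::nat"]
      proof eventually_elim
        case (elim n)
        then have "?L n > 0" by simp
        moreover have "?L n / dPsi + \<epsilon> * ?L n = (a + \<epsilon>) * ?L n" by (simp add: a_def algebra_simps)
        ultimately show ?case by simp
      qed
      with tendsto_const show ?thesis by (rule Lim_transform_eventually)
    qed
    have "?R \<longlonglongrightarrow> r \<epsilon>"
      unfolding r_def
      by (intro tendsto_rabs tendsto_add tendsto_diff tendsto_mult tendsto_const
          retention_powr_tendsto[OF lnp assms(8) z1] retention_powr_tendsto[OF lnp assms(8) z2])
    then have ev1: "eventually (\<lambda>n. ?R n < \<zeta>) sequentially" using \<epsilon>(2) by (rule order_tendstoD)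
    have ev2: "eventually (\<lambda>n. P.prob (exceptional \<epsilon> \<delta> \<eta> (?L n)) < \<xi> / 2) sequentially"
      using order_tendstoD(2)[OF exn, of "\<xi> / 2"] \<xi> by simp
    show "eventually (\<lambda>n. dist (measure M (?bad n)) 0 < \<xi>) sequentially"
      using ev1 ev2 eventually_ge_at_top[of "1::nat"]
    proof eventually_elim
      case (elim n)
      have "measure M (?bad n) \<le> P.prob (exceptional \<epsilon> \<delta> \<eta> (?L n)) + (?R n + 6 * \<delta>) / e\<^sup>2"
        using assms elim(3) by (intro prob_root_cluster_deviation_le[OF assms(10)] refl \<delta> e y) auto
      also have "(?R n + 6 * \<delta>) / e\<^sup>2 \<le> (2 * \<zeta>) / e\<^sup>2"
        using elim(1) by (intro divide_right_mono) (auto simp: \<delta>_def)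
      also have "(2 * \<zeta>) / e\<^sup>2 = \<xi> / 2" using e by (simp add: \<zeta>_def)
      finally show ?case using elim(2) by simp
    qed
  qed
  from tendsto_divide_zero[OF this]
  show "(\<lambda>n. \<P>(\<omega> in M.
             \<bar>real (root_cluster_size (X \<omega>) (K n \<omega>) n) / real n
                - exp (- c / deriv (Psi \<Lambda>) \<alpha>)\<bar> > e
             \<bar> Z (X \<omega>) \<infinity> = \<infinity>)) \<longlonglongrightarrow> 0"
    unfolding cond_prob_def y_eq .
qed

end
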